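(* Assume $m_B,m_E>0$ are not integers and let the probability of non-zero secrecy capacity be $P_{nz}=\int_0^\infty F_E(\gamma)f_B(\gamma)\,d\gamma$. Then $P_{nz}=\sum_{i,j\in\{1,2\}}D_{i,j}$ with $$D_{i,j}=\frac{Q_{B,i}Q_{E,j}}{\Gamma(1-m_B)\Gamma(1-m_E)\Gamma(m_E)}\frac{\bar\gamma_B(1+\bar K_E)}{\bar\gamma_E(1+\bar K_B)}\Big(\frac{m_E}{m_E+K_{E,j}}\Big)^{m_E}\Big(\frac{m_B}{m_B+K_{B,i}}\Big)^{m_B-2}H^{0,1:1,1;1,1;1,1}_{1,2:1,1;1,1;1,1}[y_1,y_2,y_3],$$ where $$y_1=\frac{\bar\gamma_B(m_B+K_{B,i})(1+\bar K_E)}{\bar\gamma_E m_B(1+\bar K_B)},\quad y_2=\frac{\bar\gamma_B m_E(m_B+K_{B,i})(1+\bar K_E)}{\bar\gamma_E m_B(m_E+K_{E,j})(1+\bar K_B)},\quad y_3=\frac{K_{B,i}}{m_B},$$ and the trivariate Fox H-function has upper joint list $(-1;1,1,1)$, lower joint list $(-1;1,1,0),(0;0,0,1)$; variable 1: upper $(m_E,1)$, lower $(0,1)$; variable 2: upper $(1-m_E,1)$, lower $(0,1)$; variable 3: upper $(m_B,1)$, lower $(0,1)$.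
   Context: Setting. For each $\ell\in\{B,E\}$ (legitimate receiver $B$, eavesdropper $E$) fix parameters $p_\ell\in[0,1]$, $m_\ell>0$, $K_{\ell,1},K_{\ell,2}>0$ and $\bar\gamma_\ell>0$; put $\bar K_\ell=p_\ell K_{\ell,1}+(1-p_\ell)K_{\ell,2}$, $Q_{\ell,1}=p_\ell$, $Q_{\ell,2}=1-p_\ell$. For $r\in\{1,2\}$ and $\gamma\ge0$ let $f_{RS,\ell,r}(\gamma)=\frac{1+\bar K_\ell}{\bar\gamma_\ell}\big(\frac{m_\ell}{m_\ell+K_{\ell,r}}\big)^{m_\ell}\exp\big(-\frac{(1+\bar K_\ell)\gamma}{\bar\gamma_\ell}\big)\,{}_1F_1\big(m_\ell;1;\frac{K_{\ell,r}(1+\bar K_\ell)\gamma}{\bar\gamma_\ell(m_\ell+K_{\ell,r})}\big)$ and $F_{RS,\ell,r}(\gamma)=\int_0^\gamma f_{RS,\ell,r}(t)\,dt$, where ${}_1F_1$ is Kummer's confluent hypergeometric function. The Alternate Rician Shadowed (ARS) SNR $\gamma_\ell$ has density $f_\ell=Q_{\ell,1}f_{RS,\ell,1}+Q_{\ell,2}f_{RS,\ell,2}$ and CDF $F_\ell=Q_{\ell,1}F_{RS,\ell,1}+Q_{\ell,2}F_{RS,\ell,2}$ on $[0,\infty)$; $\gamma_B,\gamma_E$ are independent. Multivariate Fox H-function: $H^{0,n:m_1,n_1;\dots;m_L,n_L}_{p,q:p_1,q_1;\dots;p_L,q_L}[x_1,\dots,x_L]$ with upper joint list $(a_j;\alpha^{(1)}_j,\dots,\alpha^{(L)}_j)_{j=1}^p$,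 lower joint list $(b_j;\beta^{(1)}_j,\dots,\beta^{(L)}_j)_{j=1}^q$, and for each variable $i$ upper list $(c^{(i)}_j,\gamma^{(i)}_j)_{j=1}^{p_i}$ and lower list $(d^{(i)}_j,\delta^{(i)}_j)_{j=1}^{q_i}$, is $\frac{1}{(2\pi i)^L}\int_{\mathcal L_1}\cdots\int_{\mathcal L_L}\psi(s_1,\dots,s_L)\prod_{i=1}^L\phi_i(s_i)x_i^{s_i}\,ds_1\cdots ds_L$, where $\psi=\frac{\prod_{j=1}^{n}\Gamma(1-a_j+\sum_i\alpha^{(i)}_js_i)}{\prod_{j=n+1}^{p}\Gamma(a_j-\sum_i\alpha^{(i)}_js_i)\prod_{j=1}^{q}\Gamma(1-b_j+\sum_i\beta^{(i)}_js_i)}$ and $\phi_i=\frac{\prod_{j=1}^{m_i}\Gamma(d^{(i)}_j-\delta^{(i)}_js_i)\prod_{j=1}^{n_i}\Gamma(1-c^{(i)}_j+\gamma^{(i)}_js_i)}{\prod_{j=m_i+1}^{q_i}\Gamma(1-d^{(i)}_j+\delta^{(i)}_js_i)\prod_{j=n_i+1}^{p_i}\Gamma(c^{(i)}_j-\gamma^{(i)}_js_i)}$, the $\mathcal L_i$ being Mellin–Barnes contours separating the poles of the $\Gamma(d-\delta s)$ factors from those of the $\Gamma(1-c+\gamma s)$ factors and of the numerator of $\psi$. *)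

theory Defs
  imports "HOL-Analysis.Analysis"
begin

definition hyp1F1 :: "real \<Rightarrow> real \<Rightarrow> real \<Rightarrow> real" where
  "hyp1F1 a b z = (\<Sum>n. pochhammer a n / pochhammer b n * z ^ n / fact n)"

definition f_RS :: "real \<Rightarrow> real \<Rightarrow> real \<Rightarrow> real \<Rightarrow> real \<Rightarrow> real" where
  "f_RS m K Kbar gbar g =
     (1 + Kbar) / gbar * (m / (m + K)) powr m * exp (- ((1 + Kbar) * g / gbar))
     * hyp1F1 m 1 (K * (1 + Kbar) * g / (gbar * (m + K)))"

definition F_RS :: "real \<Rightarrow> real \<Rightarrow> real \<Rightarrow> real \<Rightarrow> real \<Rightarrow> real" where
  "F_RS m K Kbar gbar g = integral {0..g} (f_RS m K Kbar gbar)"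

definition Kbar :: "real \<Rightarrow> real \<Rightarrow> real \<Rightarrow> real" where
  "Kbar p K1 K2 = p * K1 + (1 - p) * K2"

text \<open>ARS density and CDF (on [0,infinity)), Q_1 = p, Q_2 = 1 - p.\<close>
definition f_ARS :: "real \<Rightarrow> real \<Rightarrow> real \<Rightarrow> real \<Rightarrow> real \<Rightarrow> real \<Rightarrow> real" where
  "f_ARS p m K1 K2 gbar g =
     p * f_RS m K1 (Kbar p K1 K2) gbar g + (1 - p) * f_RS m K2 (Kbar p K1 K2) gbar g"

definition F_ARS :: "real \<Rightarrow> real \<Rightarrow> real \<Rightarrow> real \<Rightarrow> real \<Rightarrow> real \<Rightarrow> real" where
  "F_ARS p m K1 K2 gbar g =
     p * F_RS m K1 (Kbar p K1 K2) gbar g + (1 - p) * F_RS m K2 (Kbar p K1 K2) gbar g"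

text \<open>Parameters: n; upper joint list A of pairs (a_j, [alpha_j^(1),...,alpha_j^(L)]);
  lower joint list B of pairs (b_j, [beta_j^(1),...]); for each variable i a tuple
  (m_i, n_i, C_i, D_i) with C_i = [(c_j, gamma_j)], D_i = [(d_j, delta_j)].
  The number of variables L is the length of that list.\<close>

definition lin_comb :: "real list \<Rightarrow> (nat \<Rightarrow> complex) \<Rightarrow> complex" where
  "lin_comb \<alpha> s = (\<Sum>i<length \<alpha>. of_real (\<alpha> ! i) * s i)"

definition foxH_psi ::
  "nat \<Rightarrow> (real \<times> real list) list \<Rightarrow> (real \<times> real list) list \<Rightarrow> (nat \<Rightarrow> complex) \<Rightarrow> complex" where
  "foxH_psi n A B s =
     (\<Prod>j<n. Gamma (of_real (1 - fst (A ! j)) + lin_comb (snd (A ! j)) s))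
   * (\<Prod>j\<in>{n..<length A}. rGamma (of_real (fst (A ! j)) - lin_comb (snd (A ! j)) s))
   * (\<Prod>j<length B. rGamma (of_real (1 - fst (B ! j)) + lin_comb (snd (B ! j)) s))"

definition foxH_phi ::
  "nat \<times> nat \<times> (real \<times> real) list \<times> (real \<times> real) list \<Rightarrow> complex \<Rightarrow> complex" where
  "foxH_phi V z = (case V of (mi, ni, C, D) \<Rightarrow>
       (\<Prod>j<mi. Gamma (of_real (fst (D ! j)) - of_real (snd (D ! j)) * z))
     * (\<Prod>j<ni. Gamma (of_real (1 - fst (C ! j)) + of_real (snd (C ! j)) * z))
     * (\<Prod>j\<in>{mi..<length D}. rGamma (of_real (1 - fst (D ! j)) + of_real (snd (D ! j)) * z))
     * (\<Prod>j\<in>{ni..<length C}. rGamma (of_real (fst (C ! j)) - of_real (snd (C ! j)) * z)))"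

definition MB_contour :: "(real \<Rightarrow> complex) \<Rightarrow> bool" where
  "MB_contour L \<longleftrightarrow> L C1_differentiable_on UNIV \<and> (\<exists>c T. \<forall>t. T \<le> \<bar>t\<bar> \<longrightarrow> L t = Complex c t)"

definition MB_right_of :: "(real \<Rightarrow> complex) \<Rightarrow> complex \<Rightarrow> bool" where
  "MB_right_of L z \<longleftrightarrow>
     (\<forall>\<^sub>F R in at_top. z \<in> connected_component_set (- range L) (complex_of_real R))"

definition MB_left_of :: "(real \<Rightarrow> complex) \<Rightarrow> complex \<Rightarrow> bool" where
  "MB_left_of L z \<longleftrightarrow>
     (\<forall>\<^sub>F R in at_bot. z \<in> connected_component_set (- range L) (complex_of_real R))"

text \<open>Separation: the poles of Gamma(d - delta s_i) lie right of L_i, the poles of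
  Gamma(1 - c + gamma s_i) lie left of L_i, and for every choice of the other variables
  on their contours, the poles in s_i of the numerator factors of psi lie left of L_i.\<close>
definition foxH_separates ::
  "nat \<Rightarrow> (real \<times> real list) list \<Rightarrow> (nat \<times> nat \<times> (real \<times> real) list \<times> (real \<times> real) list) list
   \<Rightarrow> (nat \<Rightarrow> real \<Rightarrow> complex) \<Rightarrow> bool" where
  "foxH_separates n A Vs Ls \<longleftrightarrow>
    (\<forall>i<length Vs. case Vs ! i of (mi, ni, C, D) \<Rightarrow>
       (\<forall>j<mi. \<forall>k::nat. MB_right_of (Ls i) (of_real ((fst (D ! j) + real k) / snd (D ! j))))
     \<and> (\<forall>j<ni. \<forall>k::nat. MB_left_of (Ls i) (of_real ((fst (C ! j) - 1 - real k) / snd (C ! j))))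
     \<and> (\<forall>j<n. 0 < snd (A ! j) ! i \<longrightarrow>
          (\<forall>t::nat \<Rightarrow> real. \<forall>k::nat. MB_left_of (Ls i)
             ((of_real (fst (A ! j) - 1 - real k)
               - (\<Sum>l\<in>{..<length Vs} - {i}. of_real (snd (A ! j) ! l) * Ls l (t l)))
              / of_real (snd (A ! j) ! i)))))"

definition foxH_integrand ::
  "nat \<Rightarrow> (real \<times> real list) list \<Rightarrow> (real \<times> real list) list
   \<Rightarrow> (nat \<times> nat \<times> (real \<times> real) list \<times> (real \<times> real) list) list \<Rightarrow> complex list
   \<Rightarrow> (nat \<Rightarrow> real \<Rightarrow> complex) \<Rightarrow> (nat \<Rightarrow> real) \<Rightarrow> complex" where
  "foxH_integrand n A B Vs x Ls t =
     foxH_psi n A B (\<lambda>i. Ls i (t i))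
   * (\<Prod>i<length Vs. foxH_phi (Vs ! i) (Ls i (t i)) * (x ! i) powr (Ls i (t i))
                      * vector_derivative (Ls i) (at (t i)))"

definition foxH_admissible ::
  "nat \<Rightarrow> (real \<times> real list) list \<Rightarrow> (real \<times> real list) list
   \<Rightarrow> (nat \<times> nat \<times> (real \<times> real) list \<times> (real \<times> real) list) list \<Rightarrow> complex list
   \<Rightarrow> (nat \<Rightarrow> real \<Rightarrow> complex) \<Rightarrow> bool" where
  "foxH_admissible n A B Vs x Ls \<longleftrightarrow>
     (\<forall>i<length Vs. MB_contour (Ls i)) \<and> foxH_separates n A Vs Ls
     \<and> integrable (PiM {..<length Vs} (\<lambda>_. lborel)) (foxH_integrand n A B Vs x Ls)"

text \<open>H^{0,n: m_1,n_1; ...}[x_1,...,x_L]: the (absolutely convergent) Mellin--Barnes integral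
  over admissible contours (its value does not depend on the admissible contours chosen).\<close>
definition foxH ::
  "nat \<Rightarrow> (real \<times> real list) list \<Rightarrow> (real \<times> real list) list
   \<Rightarrow> (nat \<times> nat \<times> (real \<times> real) list \<times> (real \<times> real) list) list \<Rightarrow> complex list \<Rightarrow> complex" where
  "foxH n A B Vs x =
     (let Ls = (SOME Ls. foxH_admissible n A B Vs x Ls)
      in (LINT t | PiM {..<length Vs} (\<lambda>_. lborel). foxH_integrand n A B Vs x Ls t)
         / (2 * of_real pi * \<i>) ^ length Vs)"

definition D_term ::
  "real \<Rightarrow> real \<Rightarrow> real \<Rightarrow> real \<Rightarrow> real \<Rightarrow> real \<Rightarrow> real \<Rightarrow> real \<Rightarrow> real \<Rightarrow> real \<Rightarrow> complex" where
  "D_term QB QE mB mE KB KE KbB KbE gB gE =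
    (let y1 = gB * (mB + KB) * (1 + KbE) / (gE * mB * (1 + KbB));
         y2 = gB * mE * (mB + KB) * (1 + KbE) / (gE * mB * (mE + KE) * (1 + KbB));
         y3 = KB / mB
     in of_real (QB * QE / (Gamma (1 - mB) * Gamma (1 - mE) * Gamma mE)
          * (gB * (1 + KbE) / (gE * (1 + KbB)))
          * (mE / (mE + KE)) powr mE * (mB / (mB + KB)) powr (mB - 2))
        * foxH 1 [(-1, [1, 1, 1])] [(-1, [1, 1, 0]), (0, [0, 0, 1])]
            [(1, 1, [(mE, 1)], [(0, 1)]), (1, 1, [(1 - mE, 1)], [(0, 1)]), (1, 1, [(mB, 1)], [(0, 1)])]
            [of_real y1, of_real y2, of_real y3])"

end

theory Submission
  imports Defs "HOL-Complex_Analysis.Complex_Analysis" "HOL-Real_Asymp.Real_Asymp"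
begin

text \<open>
  Let \<open>\<theta>\<close> stand for \<open>m/(m + K)\<close> and \<open>a\<close> for \<open>(1 + Kbar)/gbar\<close>. The density \<open>f\<close> of a Rician shadowed SNR is
  \<open>a \<theta>\<^sup>m exp (-a \<theta> g) 1F1(1-m; 1; -(1-\<theta>) a g)\<close> by Kummer's transformation, and its distribution function is
  \<open>a \<theta>\<^sup>m g \<Phi>2(1-m, m; 2; -a g, -a \<theta> g)\<close>. Writing \<open>1F1\<close> and \<open>\<Phi>2\<close> as Mellin--Barnes integrals in \<open>s3\<close> and \<open>(s1, s2)\<close> and
  integrating over \<open>g\<close> produces the factor \<open>\<Gamma>(2 + s1 + s2 + s3)\<close>, that is, the trivariate H-function.

  The H-function is defined through an arbitrary choice of admissible contours, which may bend and need not keep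
  \<open>Re (2 + s1 + s2 + s3)\<close> positive. By the residue theorem each contour is replaced, one variable at a time, by the residues of
  \<open>\<Gamma>(-s)\<close> at \<open>0, ..., M\<close> and the line \<open>Re s = M + 1/2\<close>. That this respects the poles of \<open>\<Gamma>(2 + s1 + s2 + s3)\<close> is a
  topological consequence of the separation conditions. Afterwards all nodes have nonnegative real part, so the joint Gamma
  factor may be written as Euler's integral in \<open>x\<close>; for fixed \<open>x\<close> the line integrals tend to \<open>0\<close> as \<open>M\<close> grows,
  leaving the power series of \<open>1F1\<close> and \<open>\<Phi>2\<close>.
\<close>

section \<open>Gamma function on vertical strips\<close>

text \<open>No straight vertical line separates the poles in general: those of \<Gamma>(1 - m + s)
  start at m - 1 and for m > 1 interleave with 0, 1, 2, ... The contours have to bend, and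
  non-integral m keeps the two progressions apart. Expanding H into its full triple residue series
  is no way out: the joint factor makes the terms in s3 behave like powers of y3, so that series
  converges only for small arguments. Therefore M stays finite while the joint factor is present,
  and the line Re s = M + 1/2 is carried along as an exact remainder. M is sent to infinity only
  under Euler's integral, where the joint factor is gone and the series that remain are entire in
  their arguments. A second difficulty is that the poles of the joint factor in one variable move
  with the other two. Once a contour has been replaced, the separation condition for the next one
  has to be proved anew. For a node n it follows because n lies right of the contour just removed;
  for a node on the vertical line it follows because M is large compared with the width of the
  contours.\<close>

lemma norm_sin_le_exp: "norm (sin (z::complex)) \<le> exp \<bar>Im z\<bar>"
proof -
  have "norm (sin z) = norm (exp (\<i> * z) - exp (- (\<i> * z))) / 2"
    by (simp add: sin_exp_eq norm_divide norm_mult)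
  also have "\<dots> \<le> (norm (exp (\<i> * z)) + norm (exp (- (\<i> * z)))) / 2"
    by (intro divide_right_mono norm_triangle_ineq4) auto
  also have "\<dots> \<le> (exp \<bar>Im z\<bar> + exp \<bar>Im z\<bar>) / 2"
    by (intro divide_right_mono add_mono) auto
  finally show ?thesis by simp
qed

text \<open>On the line Re z = 1/2 conjugation is the map z -> 1 - z, so the squared modulus is that
  of \<open>rGamma z * rGamma (1 - z)\<close>, which the reflection formula evaluates.\<close>

lemma norm_rGamma_half_line:
  "norm (rGamma (Complex (1/2) t)) \<le> exp (pi / 2 * \<bar>t\<bar>)"
proof -
  let ?z = "Complex (1/2) t"
  have cz: "cnj ?z = 1 - ?z"
    by (simp add: complex_eq_iff)
  have "norm (rGamma ?z) ^ 2 = norm (rGamma ?z * rGamma (1 - ?z))"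
    by (simp add: norm_mult power2_eq_square cnj_rGamma[symmetric] flip: cz)
  also have "\<dots> = norm (sin (of_real pi * ?z)) / pi"
    by (simp add: rGamma_reflection_complex norm_divide)
  also have "\<dots> \<le> exp \<bar>Im (of_real pi * ?z)\<bar> / pi"
    by (intro divide_right_mono norm_sin_le_exp) auto
  also have "\<dots> \<le> exp (pi * \<bar>t\<bar>) / 1"
    using pi_gt3 by (intro frac_le) (auto simp: abs_mult)
  also have "\<dots> = exp (pi / 2 * \<bar>t\<bar>) ^ 2"
    by (simp add: exp_of_nat_mult[symmetric] power2_eq_square exp_add[symmetric])
  finally show ?thesis
    by (rule power2_le_imp_le) auto
qed

text \<open>In Euler's limit product the j-th factors compare as |x + j + i t| / (x + j) with |1/2 +
  j + i t| / (1/2 + j), and this quotient decreases in the abscissa. The bound on the half line thus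
  spreads to everything right of it without Stirling's formula.\<close>

lemma norm_rGamma_le_half_line:
  assumes "x \<ge> 1/2"
  shows "norm (rGamma (Complex x t)) * Gamma x \<le> norm (rGamma (Complex (1/2) t)) * Gamma (1/2)"
proof -
  have ratio: "norm (Complex (x + real j) t) * (1/2 + real j) \<le> norm (Complex (1/2 + real j) t) * (x + real j)" for j
  proof (rule power2_le_imp_le)
    have *: "(1/2 + real j)\<^sup>2 * t\<^sup>2 \<le> (x + real j)\<^sup>2 * t\<^sup>2"
      using assms by (intro mult_right_mono power_mono) auto
    have "((x + real j)\<^sup>2 + t\<^sup>2) * (1/2 + real j)\<^sup>2 \<le> ((1/2 + real j)\<^sup>2 + t\<^sup>2) * (x + real j)\<^sup>2"
      unfolding ring_distribs using * by (simp add: mult.commute)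
    then show "(norm (Complex (x + real j) t) * (1/2 + real j))\<^sup>2 \<le> (norm (Complex (1/2 + real j) t) * (x + real j))\<^sup>2"
      by (simp add: power_mult_distrib cmod_power2)
  qed (use assms in auto)
  have poch: "norm (pochhammer (Complex y t) (Suc n)) = (\<Prod>j\<le>n. norm (Complex (y + real j) t))" for y n
  proof -
    have "Complex y t + of_nat j = Complex (y + real j) t" for j
      by (simp add: complex_eq_iff)
    then show ?thesis
      by (simp add: pochhammer_Suc_prod prod_norm[symmetric] atLeast0AtMost)
  qed
  have prod: "norm (pochhammer (Complex x t) (Suc n)) * pochhammer (1/2) (Suc n)
      \<le> norm (pochhammer (Complex (1/2) t) (Suc n)) * pochhammer x (Suc n)" for n
    unfolding poch pochhammer_Suc_prod[of "_::real"] atLeast0AtMost prod.distrib[symmetric]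
    using assms by (intro prod_mono conjI ratio) auto
  have nexp: "norm (exp (Complex y t * of_real u)) = exp (y * u)" for y u
    by simp
  have ser: "norm (rGamma_series (Complex x t) n) * rGamma_series (1/2) n
      \<le> norm (rGamma_series (Complex (1/2) t) n) * rGamma_series x n" for n
  proof -
    let ?k = "fact n * exp (x * ln (real n)) * (fact n * exp (1/2 * ln (real n)))"
    have "norm (rGamma_series (Complex x t) n) * rGamma_series (1/2) n
      = (norm (pochhammer (Complex x t) (Suc n)) * pochhammer (1/2) (Suc n)) / ?k"
      unfolding rGamma_series_def norm_divide norm_mult nexp by simp
    also have "\<dots> \<le> (norm (pochhammer (Complex (1/2) t) (Suc n)) * pochhammer x (Suc n)) / ?k"
      by (intro divide_right_mono prod) auto
    also have "\<dots> = norm (rGamma_series (Complex (1/2) t) n) * rGamma_series x n"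
      unfolding rGamma_series_def norm_divide norm_mult nexp by simp
    finally show ?thesis .
  qed
  have "norm (rGamma (Complex x t)) * rGamma (1/2) \<le> norm (rGamma (Complex (1/2) t)) * rGamma x"
    by (rule LIMSEQ_le[of "\<lambda>n. norm (rGamma_series (Complex x t) n) * rGamma_series (1/2) n" _
          "\<lambda>n. norm (rGamma_series (Complex (1/2) t) n) * rGamma_series x n"])
       (auto intro!: tendsto_intros ser)
  moreover have "Gamma x > 0" "Gamma (1/2::real) > 0"
    using assms by (auto intro: Gamma_real_pos)
  ultimately show ?thesis
    by (simp add: rGamma_inverse_Gamma field_simps)
qed

lemma one_plus_power_le_exp:
  fixes \<epsilon> :: real
  assumes "\<epsilon> > 0"
  shows "\<exists>C>0. \<forall>u\<ge>0. (B + u) ^ k \<le> C * exp (\<epsilon> * u)"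
proof -
  have "((\<lambda>u. (B + u) ^ k * exp (- (\<epsilon> * u))) \<longlongrightarrow> 0) at_top"
    using assms by real_asymp
  then have "eventually (\<lambda>u. (B + u) ^ k * exp (- (\<epsilon> * u)) < 1) at_top"
    by (rule order_tendstoD) simp
  then obtain U where U: "\<And>u. u \<ge> U \<Longrightarrow> (B + u) ^ k * exp (- (\<epsilon> * u)) < 1"
    by (auto simp: eventually_at_top_linorder)
  have "bounded ((\<lambda>u. (B + u) ^ k * exp (- (\<epsilon> * u))) ` {0..U})"
    by (intro compact_imp_bounded compact_continuous_image continuous_intros) auto
  then obtain K where K: "\<And>u. u \<in> {0..U} \<Longrightarrow> \<bar>(B + u) ^ k * exp (- (\<epsilon> * u))\<bar> \<le> K"
    unfolding bounded_iff by (metis (no_types, lifting) image_eqI real_norm_def)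
  have "(B + u) ^ k \<le> max 1 K * exp (\<epsilon> * u)" if "u \<ge> 0" for u
  proof -
    have "(B + u) ^ k * exp (- (\<epsilon> * u)) \<le> max 1 K"
    proof (cases "u \<ge> U")
      case True
      then show ?thesis using U[of u] by linarith
    next
      case False
      then show ?thesis using K[of u] that by auto
    qed
    then show ?thesis
      by (simp add: exp_minus field_simps)
  qed
  moreover have "max 1 K > 0" by simp
  ultimately show ?thesis by blast
qed

text \<open>On vertical strips \<open>\<Gamma>\<close> and \<open>1/\<Gamma>\<close> behave like \<open>exp (\<mp>\<pi>|Im z|/2)\<close> up to a power of \<open>|Im z|\<close>. The rates
  \<open>14/10 < \<pi>/2 < 17/10\<close> absorb these powers and still satisfy \<open>2 * 14/10 - 17/10 \<ge> 1\<close>.\<close>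

lemma rGamma_strip_bound:
  "\<exists>C>0. \<forall>z. \<bar>Re z\<bar> \<le> B \<longrightarrow> norm (rGamma z) \<le> C * exp (17/10 * \<bar>Im z\<bar>)"
proof -
  \<comment> \<open>After a shift by \<open>k\<close> the real part is at least 1, hence right of
    the half line.\<close>
  obtain k :: nat where k: "real k \<ge> B + 1"
    using real_arch_simple by blast
  define K where "K = {1/2..B + real k}"
  have "bounded ((\<lambda>x::real. rGamma x) ` K)"
    unfolding K_def by (intro compact_imp_bounded compact_continuous_image continuous_intros) auto
  then obtain G where G: "\<And>x. x \<in> K \<Longrightarrow> \<bar>rGamma x\<bar> \<le> G"
    unfolding bounded_iff by auto
  \<comment> \<open>The final rate 17/10 is 16/10 from the half line plus 1/10, which pays for the
    \<open>k\<close> Pochhammer factors created by the shift.\<close>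
  have pi': "pi / 2 \<le> 16/10"
    using pi_less_4 pi_approx by (simp add: field_simps)
  obtain C where C: "C > 0" "\<And>u. u \<ge> 0 \<Longrightarrow> (B + real k + u) ^ k \<le> C * exp (1/10 * u)"
    using one_plus_power_le_exp[of "1/10" "B + real k" k] by auto
  define D where "D = C * (1 + \<bar>Gamma (1/2) * G\<bar>)"
  have "norm (rGamma z) \<le> D * exp (17/10 * \<bar>Im z\<bar>)" if z: "\<bar>Re z\<bar> \<le> B" for z
  proof -
    let ?t = "Im z" and ?x = "Re z + real k"
    have zk: "z + of_nat k = Complex ?x ?t" by (simp add: complex_eq_iff)
    have x: "?x \<ge> 1/2" "?x \<in> K" using z k by (auto simp: K_def)
    have Gp: "Gamma ?x > 0" using x by (intro Gamma_real_pos) auto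
    have "norm (rGamma (z + of_nat k)) \<le> norm (rGamma (Complex (1/2) ?t)) * Gamma (1/2) * rGamma ?x"
      using norm_rGamma_le_half_line[OF x(1), of ?t] Gp
      by (simp add: zk rGamma_inverse_Gamma field_simps)
    also have "\<dots> \<le> exp (pi / 2 * \<bar>?t\<bar>) * (Gamma (1/2) * rGamma ?x)"
      unfolding mult.assoc using Gp
      by (intro mult_right_mono norm_rGamma_half_line) (auto simp: rGamma_inverse_Gamma)
    also have "\<dots> \<le> exp (16/10 * \<bar>?t\<bar>) * (1 + \<bar>Gamma (1/2) * G\<bar>)"
    proof (intro mult_mono)
      have "Gamma (1/2) * rGamma ?x \<le> Gamma (1/2) * G"
        using G[OF x(2)] by (intro mult_left_mono) auto
      then show "Gamma (1/2) * rGamma ?x \<le> 1 + \<bar>Gamma (1/2) * G\<bar>" by linarith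
    next
      show "exp (pi / 2 * \<bar>?t\<bar>) \<le> exp (16/10 * \<bar>?t\<bar>)"
        unfolding exp_le_cancel_iff by (intro mult_right_mono pi') auto
    qed (use Gp in \<open>auto simp: rGamma_inverse_Gamma\<close>)
    finally have 1: "norm (rGamma (z + of_nat k)) \<le> exp (16/10 * \<bar>?t\<bar>) * (1 + \<bar>Gamma (1/2) * G\<bar>)" .
    have "norm (pochhammer z k) \<le> (\<Prod>j<k. B + real k + \<bar>?t\<bar>)"
      unfolding pochhammer_prod prod_norm[symmetric] atLeast0LessThan
    proof (intro prod_mono conjI)
      fix j assume j: "j \<in> {..<k}"
      have "norm (z + of_nat j) \<le> norm z + real j" by (rule norm_triangle_ineq[THEN order_trans]) simp
      also have "\<dots> \<le> (\<bar>Re z\<bar> + \<bar>?t\<bar>) + real k" using j cmod_le[of z] by auto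
      finally show "norm (z + of_nat j) \<le> B + real k + \<bar>?t\<bar>" using z by linarith
    qed auto
    then have 2: "norm (pochhammer z k) \<le> C * exp (1/10 * \<bar>?t\<bar>)"
      using C(2)[of "\<bar>?t\<bar>"] by simp
    have "norm (rGamma z) = norm (pochhammer z k) * norm (rGamma (z + of_nat k))"
      by (subst pochhammer_rGamma[of z k]) (simp add: norm_mult)
    also have "\<dots> \<le> (C * exp (1/10 * \<bar>?t\<bar>)) * (exp (16/10 * \<bar>?t\<bar>) * (1 + \<bar>Gamma (1/2) * G\<bar>))"
      by (intro mult_mono 1 2) (use C(1) in auto)
    also have "\<dots> = D * exp (17/10 * \<bar>?t\<bar>)"
      by (simp add: D_def exp_add[symmetric] mult_ac)
    finally show ?thesis .
  qed
  moreover have "D > 0" using C(1) by (simp add: D_def add_pos_nonneg)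
  ultimately show ?thesis by blast
qed

lemma exp_le_norm_sin:
  assumes "\<bar>Im z\<bar> \<ge> 1/2"
  shows "exp \<bar>Im z\<bar> \<le> 8 * norm (sin z)"
proof -
  let ?u = "\<bar>Im z\<bar>"
  have "norm (sin z) = norm (exp (\<i> * z) - exp (- (\<i> * z))) / 2"
    by (simp add: sin_exp_eq norm_divide norm_mult)
  moreover have "\<bar>norm (exp (\<i> * z)) - norm (exp (- (\<i> * z)))\<bar> \<le> norm (exp (\<i> * z) - exp (- (\<i> * z)))"
    by (rule norm_triangle_ineq3)
  moreover have "\<bar>norm (exp (\<i> * z)) - norm (exp (- (\<i> * z)))\<bar> = exp ?u - exp (- ?u)"
    by (auto simp: abs_if)
  moreover have "exp (- ?u) \<le> 3/4 * exp ?u"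
  proof -
    have "exp (2 * ?u) \<ge> 1 + 2 * ?u" by (rule exp_ge_add_one_self)
    then have "exp (2 * ?u) \<ge> 4/3" using assms by linarith
    then have "exp (- ?u) * exp (2 * ?u) \<ge> exp (- ?u) * (4/3)" by (intro mult_left_mono) auto
    then show ?thesis by (simp add: exp_add[symmetric])
  qed
  ultimately show ?thesis by linarith
qed

text \<open>By reflection \<Gamma>(z) = \<pi> \<open>rGamma (1 - z)\<close> / sin(\<pi> z): the
  numerator grows at rate 17/10, the sine at rate \<pi> > 31/10, and 17/10 - 31/10 = -14/10. The
  distance 1/2 from the real axis keeps the sine comparable to its exponential.\<close>

lemma Gamma_strip_bound:
  "\<exists>C>0. \<forall>z. \<bar>Re z\<bar> \<le> B \<longrightarrow> \<bar>Im z\<bar> \<ge> 1/2 \<longrightarrow> norm (Gamma z) \<le> C * exp (- (14/10 * \<bar>Im z\<bar>))"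
proof -
  obtain C where C: "C > 0" "\<And>z. \<bar>Re z\<bar> \<le> B + 1 \<Longrightarrow> norm (rGamma z) \<le> C * exp (17/10 * \<bar>Im z\<bar>)"
    using rGamma_strip_bound[of "B + 1"] by auto
  have "norm (Gamma z) \<le> (8 * pi * C) * exp (- (14/10 * \<bar>Im z\<bar>))"
    if z: "\<bar>Re z\<bar> \<le> B" "\<bar>Im z\<bar> \<ge> 1/2" for z
  proof -
    let ?t = "\<bar>Im z\<bar>"
    have nz: "z \<notin> \<int>\<^sub>\<le>\<^sub>0" using z(2) by (auto elim!: nonpos_Ints_cases)
    have "pi * ?t \<ge> 1/2"
      using mult_mono[of 1 pi "1/2" ?t] z(2) pi_gt3 by simp
    then have s: "exp (pi * ?t) \<le> 8 * norm (sin (of_real pi * z))"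
      using exp_le_norm_sin[of "of_real pi * z"] by (simp add: abs_mult)
    then have s0: "norm (sin (of_real pi * z)) > 0"
      using exp_gt_zero[of "pi * ?t"] by linarith
    have "rGamma z * rGamma (1 - z) = sin (of_real pi * z) / of_real pi"
      by (rule rGamma_reflection_complex)
    then have "Gamma z * (rGamma z * rGamma (1 - z)) = Gamma z * (sin (of_real pi * z) / of_real pi)"
      by simp
    then have "rGamma (1 - z) = Gamma z * (sin (of_real pi * z) / of_real pi)"
      using nz unfolding mult.assoc[symmetric]
      by (simp add: rGamma_inverse_Gamma[of z] Gamma_eq_zero_iff)
    then have "norm (rGamma (1 - z)) = norm (Gamma z) * norm (sin (of_real pi * z)) / pi"
      by (simp add: norm_mult norm_divide)
    then have "norm (Gamma z) = pi * norm (rGamma (1 - z)) / norm (sin (of_real pi * z))"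
      using s0 by (simp add: field_simps)
    also have "\<dots> \<le> pi * norm (rGamma (1 - z)) / (exp (pi * ?t) / 8)"
      using s s0 by (intro divide_left_mono) auto
    also have "\<dots> \<le> pi * (C * exp (17/10 * ?t)) / (exp (pi * ?t) / 8)"
      using C(2)[of "1 - z"] z(1) by (intro divide_right_mono mult_left_mono) auto
    also have "\<dots> = 8 * pi * C * exp (17/10 * ?t - pi * ?t)"
      by (simp add: exp_diff)
    also have "\<dots> \<le> 8 * pi * C * exp (- (14/10 * ?t))"
    proof -
      have "31/10 * ?t \<le> pi * ?t" using pi_approx by (intro mult_right_mono) auto
      then show ?thesis using C(1) by (intro mult_left_mono) auto
    qed
    finally show ?thesis .
  qed
  then show ?thesis using C(1) by (intro exI[of _ "8 * pi * C"]) auto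
qed

text \<open>A bent contour passes the poles at no explicit distance. Near the real axis the set is
  compact and misses the poles, so compactness bounds \<Gamma> there; farther away the strip
  estimate applies.\<close>

lemma Gamma_closed_bound:
  fixes X :: "complex set"
  assumes "closed X" and B: "\<And>z. z \<in> X \<Longrightarrow> \<bar>Re z\<bar> \<le> B" and "X \<inter> \<int>\<^sub>\<le>\<^sub>0 = {}"
  shows "\<exists>C>0. \<forall>z\<in>X. norm (Gamma z) \<le> C * exp (- (14/10 * \<bar>Im z\<bar>))"
proof -
  obtain C where C: "C > 0" "\<And>z. \<bar>Re z\<bar> \<le> B \<Longrightarrow> \<bar>Im z\<bar> \<ge> 1/2 \<Longrightarrow> norm (Gamma z) \<le> C * exp (- (14/10 * \<bar>Im z\<bar>))"
    using Gamma_strip_bound[of B] by auto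
  define K where "K = X \<inter> cbox (Complex (-B) (-1)) (Complex B 1)"
  have "compact K" unfolding K_def using assms(1) by (intro closed_Int_compact compact_cbox)
  then have "bounded (Gamma ` K)"
    using assms(3) by (intro compact_imp_bounded compact_continuous_image continuous_on_Gamma) (auto simp: K_def)
  then obtain D where D: "\<And>z. z \<in> K \<Longrightarrow> norm (Gamma z) \<le> D"
    unfolding bounded_iff by auto
  define E where "E = C + \<bar>D\<bar> * exp (14/10)"
  have "norm (Gamma z) \<le> E * exp (- (14/10 * \<bar>Im z\<bar>))" if z: "z \<in> X" for z
  proof (cases "\<bar>Im z\<bar> \<ge> 1/2")
    case True
    have "norm (Gamma z) \<le> C * exp (- (14/10 * \<bar>Im z\<bar>))" using C(2) B z True by auto
    also have "\<dots> \<le> E * exp (- (14/10 * \<bar>Im z\<bar>))" by (intro mult_right_mono) (auto simp: E_def)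
    finally show ?thesis .
  next
    case False
    then have "z \<in> K" using B[OF z] z by (auto simp: K_def in_cbox_complex_iff)
    then have "norm (Gamma z) \<le> \<bar>D\<bar> * 1" using D[of z] by linarith
    also have "\<dots> \<le> \<bar>D\<bar> * (exp (14/10) * exp (- (14/10 * \<bar>Im z\<bar>)))"
      using False by (intro mult_left_mono) (auto simp: exp_add[symmetric])
    also have "\<dots> \<le> E * exp (- (14/10 * \<bar>Im z\<bar>))"
      unfolding mult.assoc[symmetric] using C(1) by (intro mult_right_mono) (auto simp: E_def)
    finally show ?thesis .
  qed
  moreover have "E > 0" using C(1) by (simp add: E_def add_pos_nonneg)
  ultimately show ?thesis by blast
qed

section \<open>Winding numbers around Mellin--Barnes contours\<close>

text \<open>Cauchy's theorem for a degenerate triangle, so the three abscissas may come in any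
  order.\<close>

lemma contour_integral_collinear:
  assumes "f holomorphic_on S" "{z. Im z = y} \<subseteq> S"
  shows "contour_integral (linepath (Complex a y) (Complex b y)) f
    = contour_integral (linepath (Complex a y) (Complex d y)) f + contour_integral (linepath (Complex d y) (Complex b y)) f"
proof -
  have "convex {z. Im z = y}"
    by (auto simp: convex_def algebra_simps simp flip: distrib_right)
  then have hull: "convex hull {Complex a y, Complex d y, Complex b y} \<subseteq> {z. Im z = y}"
    by (intro hull_minimal) auto
  then have "f holomorphic_on convex hull {Complex a y, Complex d y, Complex b y}"
    using assms by (meson holomorphic_on_subset order_trans)
  then have 0: "(f has_contour_integral 0) (linepath (Complex a y) (Complex d y)
       +++ linepath (Complex d y) (Complex b y) +++ linepath (Complex b y) (Complex a y))"
    by (rule Cauchy_theorem_triangle)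
  have cont: "continuous_on (closed_segment (Complex u y) (Complex v y)) f" for u v
  proof (rule continuous_on_subset[OF holomorphic_on_imp_continuous_on[OF assms(1)]])
    show "closed_segment (Complex u y) (Complex v y) \<subseteq> S"
      using assms(2) by (auto simp: closed_segment_same_Im)
  qed
  have i: "f contour_integrable_on linepath (Complex u y) (Complex v y)" for u v
    by (intro contour_integrable_continuous_linepath cont)
  have "contour_integral (linepath (Complex a y) (Complex d y)) f + contour_integral (linepath (Complex d y) (Complex b y)) f
     + contour_integral (linepath (Complex b y) (Complex a y)) f = 0"
    using contour_integral_unique[OF 0] by (simp add: contour_integral_join contour_integrable_join i add.assoc)
  then show ?thesis
    using contour_integral_reverse_linepath[OF cont, of a b] by (simp add: add_eq_0_iff)
qed

text \<open>The witnesses \<open>c\<close> and \<open>T\<close> of \<open>MB_contour\<close> become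
  parameters; positivity of \<open>T\<close> is obtained by enlarging it.\<close>

locale mb_contour =
  fixes L :: "real \<Rightarrow> complex" and c T :: real
  assumes C1: "L C1_differentiable_on UNIV"
    and tail: "\<And>t. T \<le> \<bar>t\<bar> \<Longrightarrow> L t = Complex c t"
    and T_pos: "T > 0"
begin

abbreviation L' :: "real \<Rightarrow> complex" where
  "L' t \<equiv> vector_derivative L (at t)"

lemma has_deriv: "(L has_vector_derivative L' t) (at t)"
  using C1 by (meson C1_differentiable_on_eq UNIV_I vector_derivative_works)

lemma continuous_deriv: "continuous_on UNIV L'"
  using C1 by (simp add: C1_differentiable_on_eq)

lemma continuous: "continuous_on UNIV L"
  using has_deriv by (auto intro!: continuous_at_imp_continuous_on has_vector_derivative_continuous)

lemma deriv_tail: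
  assumes "T < \<bar>t\<bar>"
  shows "L' t = \<i>"
proof -
  have "((\<lambda>t. Complex c t) has_vector_derivative \<i>) (at t)"
    unfolding Complex_eq
    by (auto intro!: derivative_eq_intros simp: has_vector_derivative_def[of of_real])
  then have "(L has_vector_derivative \<i>) (at t)"
  proof (rule has_vector_derivative_transform_within_open)
    show "open {t. T < \<bar>t\<bar>}"
      by (intro open_Collect_less continuous_intros)
  qed (use assms tail in auto)
  then show ?thesis
    by (rule vector_derivative_at)
qed

lemma range_eq: "range L = L ` {-T..T} \<union> {z. Re z = c \<and> T \<le> \<bar>Im z\<bar>}"
proof (intro equalityI subsetI)
  fix z assume "z \<in> range L"
  then obtain t where t: "z = L t" by auto
  show "z \<in> L ` {-T..T} \<union> {z. Re z = c \<and> T \<le> \<bar>Im z\<bar>}"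
  proof (cases "T \<le> \<bar>t\<bar>")
    case True
    then show ?thesis using tail[of t] t by auto
  next
    case False
    then have "t \<in> {-T..T}" by auto
    then show ?thesis using t by blast
  qed
next
  fix z assume "z \<in> L ` {-T..T} \<union> {z. Re z = c \<and> T \<le> \<bar>Im z\<bar>}"
  then show "z \<in> range L"
  proof
    assume "z \<in> {z. Re z = c \<and> T \<le> \<bar>Im z\<bar>}"
    then have "z = L (Im z)" by (simp add: tail complex_eq_iff)
    then show ?thesis by (rule range_eqI)
  qed auto
qed

lemma compact_middle: "compact (L ` {-T..T})"
  by (intro compact_continuous_image continuous_on_subset[OF continuous]) auto

lemma closed_range: "closed (range L)"
  unfolding range_eq Collect_conj_eq
  by (intro closed_Un compact_imp_closed[OF compact_middle] closed_Int closed_Collect_eq closed_Collect_le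
      continuous_intros)

lemma bounded_offset: "\<exists>B>0. \<forall>t. norm (L t - Complex 0 t) \<le> B"
proof -
  have "bounded ((\<lambda>t. L t - Complex 0 t) ` {-T..T})"
    unfolding Complex_eq
    by (intro compact_imp_bounded compact_continuous_image continuous_intros continuous_on_subset[OF continuous]) auto
  then obtain B where B: "\<And>t. t \<in> {-T..T} \<Longrightarrow> norm (L t - Complex 0 t) \<le> B"
    unfolding bounded_iff by blast
  have "norm (L t - Complex 0 t) \<le> 1 + \<bar>B\<bar> + \<bar>c\<bar>" for t
  proof (cases "T \<le> \<bar>t\<bar>")
    case True
    have "Complex c t - Complex 0 t = of_real c" by (simp add: complex_eq_iff)
    then show ?thesis by (simp add: tail[OF True])
  next
    case False
    then have "t \<in> {-T..T}" by auto
    then have "norm (L t - Complex 0 t) \<le> B" by (rule B)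
    then show ?thesis by linarith
  qed
  then show ?thesis by (intro exI[of _ "1 + \<bar>B\<bar> + \<bar>c\<bar>"]) auto
qed

lemma bounded_Re: "\<exists>B>0. \<bar>c\<bar> < B \<and> (\<forall>t. \<bar>Re (L t)\<bar> < B)"
proof -
  obtain B where B: "B > 0" "\<And>t. norm (L t - Complex 0 t) \<le> B"
    using bounded_offset by auto
  have *: "\<bar>Re (L t)\<bar> < B + 1" for t
    using abs_Re_le_cmod[of "L t - Complex 0 t"] B(2)[of t] by simp
  moreover have "\<bar>c\<bar> < B + 1" using *[of T] tail[of T] T_pos by simp
  ultimately show ?thesis using B(1) by (intro exI[of _ "B + 1"]) auto
qed

definition seg :: "real \<Rightarrow> real \<Rightarrow> complex" where
  "seg R x = L (- R + 2 * R * x)"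

text \<open>The loop goes up along \<open>L\<close> and comes down on the line Re z = e. With
  \<open>e\<close> to the right of \<open>L\<close> it runs clockwise, so enclosed points have
  winding number -1.\<close>

definition boxpath :: "real \<Rightarrow> real \<Rightarrow> real \<Rightarrow> complex" where
  "boxpath e R = seg R +++ linepath (Complex c R) (Complex e R)
     +++ linepath (Complex e R) (Complex e (- R)) +++ linepath (Complex e (- R)) (Complex c (- R))"

lemma seg_deriv: "(seg R has_vector_derivative (2 * R) *\<^sub>R L' (- R + 2 * R * x)) (at x)"
proof -
  have "(L \<circ> (\<lambda>x. - R + 2 * R * x) has_vector_derivative (2 * R) *\<^sub>R L' (- R + 2 * R * x)) (at x)"
    by (intro vector_diff_chain_at has_deriv) (auto intro!: derivative_eq_intros)
  then show ?thesis by (simp add: seg_def[abs_def] o_def)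
qed

lemma valid_path_seg: "valid_path (seg R)"
proof -
  have "seg R C1_differentiable_on {0..1}"
    unfolding C1_differentiable_on_def
    by (intro exI[of _ "\<lambda>x. (2 * R) *\<^sub>R L' (- R + 2 * R * x)"] conjI ballI seg_deriv continuous_intros
        continuous_on_compose2[OF continuous_deriv]) auto
  then show ?thesis
    by (simp add: valid_path_def C1_differentiable_imp_piecewise)
qed

lemma seg_ends:
  assumes "R \<ge> T"
  shows "pathstart (seg R) = Complex c (- R)" "pathfinish (seg R) = Complex c R"
  using assms T_pos tail[of "-R"] tail[of R] by (auto simp: pathstart_def pathfinish_def seg_def)

lemma path_image_seg: "path_image (seg R) \<subseteq> range L"
  by (auto simp: path_image_def seg_def)

lemma valid_path_boxpath: "R \<ge> T \<Longrightarrow> valid_path (boxpath e R)"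
  unfolding boxpath_def by (intro valid_path_join valid_path_seg valid_path_linepath) (auto simp: seg_ends)

lemma boxpath_loop: "R \<ge> T \<Longrightarrow> pathfinish (boxpath e R) = pathstart (boxpath e R)"
  by (simp add: boxpath_def seg_ends)

lemma path_image_boxpath:
  assumes "R \<ge> T"
  shows "path_image (boxpath e R) = path_image (seg R) \<union> closed_segment (Complex c R) (Complex e R) \<union>
     closed_segment (Complex e R) (Complex e (- R)) \<union> closed_segment (Complex e (- R)) (Complex c (- R))"
  using assms by (auto simp: boxpath_def path_image_join seg_ends)

lemma boxpath_subset:
  assumes "R \<ge> T"
  shows "path_image (boxpath e R) \<subseteq> range L \<union> {z. Im z = R \<and> Re z \<in> closed_segment c e} \<union> {z. Im z = -R \<and> Re z \<in> closed_segment c e}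
           \<union> {z. Re z = e \<and> \<bar>Im z\<bar> \<le> R}"
proof -
  have "R > 0" using assms T_pos by linarith
  have h: "closed_segment (Complex a y) (Complex b y) \<subseteq> {z. Im z = y \<and> Re z \<in> closed_segment a b}" for a b y
    by (auto simp: closed_segment_same_Im)
  have "closed_segment (Complex e R) (Complex e (- R)) \<subseteq> {z. Re z = e \<and> \<bar>Im z\<bar> \<le> R}"
    using \<open>R > 0\<close> by (auto simp: closed_segment_same_Re closed_segment_eq_real_ivl)
  then show ?thesis
    unfolding path_image_boxpath[OF assms]
    using h[of c R e] h[of e "-R" c, unfolded closed_segment_commute[of e c]] path_image_seg[of R] by blast
qed

lemma contour_integral_boxpath:
  assumes R: "R \<ge> T" and S: "open S" "f holomorphic_on S" "path_image (boxpath e R) \<subseteq> S"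
  shows "contour_integral (boxpath e R) f = contour_integral (seg R) f
     + contour_integral (linepath (Complex c R) (Complex e R)) f
     + contour_integral (linepath (Complex e R) (Complex e (- R))) f
     + contour_integral (linepath (Complex e (- R)) (Complex c (- R))) f"
proof -
  have int: "f contour_integrable_on p" if "valid_path p" "path_image p \<subseteq> path_image (boxpath e R)" for p
    using that S by (intro contour_integrable_holomorphic_simple[of f S p]) auto
  have i: "f contour_integrable_on seg R"
    "f contour_integrable_on linepath (Complex c R) (Complex e R)"
    "f contour_integrable_on linepath (Complex e R) (Complex e (- R))"
    "f contour_integrable_on linepath (Complex e (- R)) (Complex c (- R))"
    by (intro int valid_path_seg valid_path_linepath; auto simp: path_image_boxpath[OF R])+
  then show ?thesis
    unfolding boxpath_def
    by (simp add: contour_integral_join contour_integrable_join valid_path_seg seg_ends R add_ac)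
qed

text \<open>The two loops share the stretch of \<open>L\<close> and differ by the boundary of the
  rectangle between their closing lines, as the integrals of 1/(w - z) show. The rectangle is run
  counterclockwise, the loops clockwise, hence the minus sign. The abscissa \<open>c\<close> may lie
  on either side of \<open>e1\<close> and \<open>e2\<close>.\<close>

lemma winding_number_boxpath_diff:
  assumes R: "R \<ge> T" and z: "z \<notin> range L" "\<bar>Im z\<bar> < R" "Re z \<noteq> e1" "Re z \<noteq> e2" and e: "e1 \<le> e2"
  shows "winding_number (boxpath e2 R) z
    = winding_number (boxpath e1 R) z - winding_number (rectpath (Complex e1 (- R)) (Complex e2 R)) z"
proof -
  let ?f = "\<lambda>w. 1 / (w - z)"
  have Rp: "R > 0" using R T_pos by linarith
  have hol: "?f holomorphic_on - {z}" by (intro holomorphic_intros) auto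
  have zb: "z \<notin> path_image (boxpath e R)" if "Re z \<noteq> e" for e
    using boxpath_subset[OF R, of e] z that by auto
  have box: "contour_integral (boxpath e R) ?f = contour_integral (seg R) ?f
     + contour_integral (linepath (Complex c R) (Complex e R)) ?f
     + contour_integral (linepath (Complex e R) (Complex e (- R))) ?f
     + contour_integral (linepath (Complex e (- R)) (Complex c (- R))) ?f" if "Re z \<noteq> e" for e
    by (rule contour_integral_boxpath[OF R _ hol]) (use zb[OF that] in auto)
  have zr: "z \<notin> path_image (rectpath (Complex e1 (- R)) (Complex e2 R))"
    using z e Rp by (subst path_image_rectpath) auto
  have cont: "continuous_on (closed_segment a b) ?f" if "z \<notin> closed_segment a b" for a b
    using that by (intro continuous_intros) auto
  have seg_h: "z \<notin> closed_segment (Complex a y) (Complex b y)" if "\<bar>y\<bar> = R" for a b y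
    using z that by (auto simp: closed_segment_same_Im)
  have seg_v: "z \<notin> closed_segment (Complex a y) (Complex a y')" if "a \<noteq> Re z" for a y y'
    using z that by (auto simp: closed_segment_same_Re)
  have ci: "?f contour_integrable_on linepath a b" if "z \<notin> closed_segment a b" for a b
    by (intro contour_integrable_continuous_linepath cont that)
  have rect: "contour_integral (rectpath (Complex e1 (- R)) (Complex e2 R)) ?f
     = contour_integral (linepath (Complex e1 (-R)) (Complex e2 (-R))) ?f
     + contour_integral (linepath (Complex e2 (-R)) (Complex e2 R)) ?f
     + contour_integral (linepath (Complex e2 R) (Complex e1 R)) ?f
     + contour_integral (linepath (Complex e1 R) (Complex e1 (-R))) ?f"
  proof -
    have i: "?f contour_integrable_on linepath (Complex e1 (-R)) (Complex e2 (-R))"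
      "?f contour_integrable_on linepath (Complex e2 (-R)) (Complex e2 R)"
      "?f contour_integrable_on linepath (Complex e2 R) (Complex e1 R)"
      "?f contour_integrable_on linepath (Complex e1 R) (Complex e1 (-R))"
      using z Rp by (auto intro!: ci seg_h seg_v)
    show ?thesis
      unfolding rectpath_def Let_def complex.sel
      by (simp add: contour_integral_join contour_integrable_join i)
  qed
  have rv: "contour_integral (linepath (Complex a y) (Complex a y')) ?f = - contour_integral (linepath (Complex a y') (Complex a y)) ?f"
    if "a \<noteq> Re z" for a y y'
    by (rule contour_integral_reverse_linepath) (intro cont seg_v that)
  have rh: "contour_integral (linepath (Complex a y) (Complex b y)) ?f = - contour_integral (linepath (Complex b y) (Complex a y)) ?f"
    if "\<bar>y\<bar> = R" for a b y
    by (rule contour_integral_reverse_linepath) (intro cont seg_h that)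
  have top: "contour_integral (linepath (Complex c R) (Complex e2 R)) ?f
    = contour_integral (linepath (Complex c R) (Complex e1 R)) ?f + contour_integral (linepath (Complex e1 R) (Complex e2 R)) ?f"
    by (rule contour_integral_collinear[OF hol]) (use z Rp in auto)
  have bot: "contour_integral (linepath (Complex e2 (-R)) (Complex c (-R))) ?f
    = contour_integral (linepath (Complex e2 (-R)) (Complex e1 (-R))) ?f + contour_integral (linepath (Complex e1 (-R)) (Complex c (-R))) ?f"
    by (rule contour_integral_collinear[OF hol]) (use z Rp in auto)
  have main: "contour_integral (boxpath e2 R) ?f = contour_integral (boxpath e1 R) ?f
      - contour_integral (rectpath (Complex e1 (- R)) (Complex e2 R)) ?f"
    unfolding box[OF z(3)] box[OF z(4)] rect top bot
    using rv[of e2 R "-R"] rh[of R e2 e1] rh[of "-R" e1 e2] z Rp by (simp add: algebra_simps)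
  have "winding_number p z = 1 / (2 * pi * \<i>) * contour_integral p ?f" if "valid_path p" "z \<notin> path_image p" for p
    using winding_number_valid_path[OF that] by simp
  then show ?thesis
    using main zb[OF z(3)] zb[OF z(4)] zr
    by (simp add: valid_path_boxpath R algebra_simps diff_divide_distrib[symmetric])
qed

text \<open>The winding number is constant on the connected set \<open>C\<close>, which the loop
  avoids because its horizontal sides and its closing line lie beyond \<open>\<rho>\<close>. At
  \<open>w\<close> it vanishes, since the whole loop lies in an open half-plane bounded by the
  vertical line through \<open>w\<close>.\<close>

lemma winding_number_boxpath_zero:
  assumes R: "R \<ge> T" "R \<ge> \<rho>" "\<bar>e\<bar> \<ge> \<rho>"
    and C: "connected C" "z \<in> C" "w \<in> C" "C \<inter> range L = {}" "\<And>v. v \<in> C \<Longrightarrow> \<bar>Re v\<bar> < \<rho> \<and> \<bar>Im v\<bar> < \<rho>"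
    and w: "(\<forall>t. Re w < Re (L t)) \<and> Re w < e \<or> (\<forall>t. Re (L t) < Re w) \<and> e < Re w"
  shows "winding_number (boxpath e R) z = 0"
proof -
  have cR: "c = Re (L T)" using tail[of T] T_pos by simp
  have dis: "C \<inter> path_image (boxpath e R) = {}"
  proof (rule ccontr)
    assume "C \<inter> path_image (boxpath e R) \<noteq> {}"
    then obtain v where v: "v \<in> C" "v \<in> path_image (boxpath e R)" by auto
    then have "v \<notin> range L" "\<bar>Re v\<bar> < \<rho>" "\<bar>Im v\<bar> < \<rho>" using C(4,5) by auto
    then show False using v(2) boxpath_subset[OF R(1), of e] R(2,3) by auto
  qed
  have "winding_number (boxpath e R) z = winding_number (boxpath e R) w"
    by (rule winding_number_eq[where S = C])
       (use C dis R in \<open>auto simp: boxpath_loop valid_path_imp_path valid_path_boxpath\<close>)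
  also have "\<dots> = 0"
    using w
  proof
    assume w: "(\<forall>t. Re w < Re (L t)) \<and> Re w < e"
    then have "closed_segment c e \<subseteq> {x. Re w < x}"
      by (auto simp: closed_segment_eq_real_ivl cR intro: less_le_trans le_less_trans)
    then have "path_image (boxpath e R) \<subseteq> {v. Re w < Re v}"
      using w by (intro order_trans[OF boxpath_subset[OF R(1), of e]]) auto
    then show ?thesis
      using R convex_halfspace_Re_gt[of "Re w"]
      by (intro winding_number_zero_outside[of _ "{v. Re w < Re v}"])
         (auto simp: boxpath_loop valid_path_imp_path valid_path_boxpath)
  next
    assume w: "(\<forall>t. Re (L t) < Re w) \<and> e < Re w"
    then have "closed_segment c e \<subseteq> {x. x < Re w}"
      by (auto simp: closed_segment_eq_real_ivl cR intro: less_le_trans le_less_trans)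
    then have "path_image (boxpath e R) \<subseteq> {v. Re v < Re w}"
      using w by (intro order_trans[OF boxpath_subset[OF R(1), of e]]) auto
    then show ?thesis
      using R convex_halfspace_Re_lt[of "Re w"]
      by (intro winding_number_zero_outside[of _ "{v. Re v < Re w}"])
         (auto simp: boxpath_loop valid_path_imp_path valid_path_boxpath)
  qed
  finally show ?thesis .
qed

text \<open>A component of the complement may be unbounded, whereas the loops can only be kept away
  from a bounded set. As the complement is open, the connected set can be taken to be the image of a
  path.\<close>

lemma component_path:
  assumes "z \<in> connected_component_set (- range L) w"
  obtains C \<rho> where "connected C" "z \<in> C" "w \<in> C" "C \<inter> range L = {}" "\<And>v. v \<in> C \<Longrightarrow> \<bar>Re v\<bar> < \<rho> \<and> \<bar>Im v\<bar> < \<rho>"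
proof -
  have "path_component (- range L) w z"
    using assms closed_range by (simp add: open_path_connected_component open_Compl)
  then obtain g where g: "path g" "path_image g \<subseteq> - range L" "pathstart g = w" "pathfinish g = z"
    unfolding path_component_def by auto
  obtain \<rho> where \<rho>: "\<And>v. v \<in> path_image g \<Longrightarrow> norm v \<le> \<rho>"
    using compact_imp_bounded[OF compact_path_image[OF g(1)]] unfolding bounded_iff by auto
  show ?thesis
  proof
    show "connected (path_image g)" using g(1) by (rule connected_path_image)
    show "z \<in> path_image g" "w \<in> path_image g" using g by (auto simp: pathstart_in_path_image pathfinish_in_path_image)
    show "path_image g \<inter> range L = {}" using g(2) by auto
    fix v assume "v \<in> path_image g"
    then show "\<bar>Re v\<bar> < \<rho> + 1 \<and> \<bar>Im v\<bar> < \<rho> + 1"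
      using \<rho>[of v] abs_Re_le_cmod[of v] abs_Im_le_cmod[of v] by linarith
  qed
qed

text \<open>A point left of \<open>L\<close> is joined to a real point left of everything. With the
  closing line pushed out beyond the joining path the winding number is 0, and moving the line back
  to \<open>b\<close> changes nothing because \<open>z\<close> lies outside the rectangle swept
  over. One threshold for \<open>R\<close> serves all \<open>b\<close>.\<close>

lemma left_winding:
  assumes "MB_left_of L z"
  shows "z \<notin> range L" "\<forall>\<^sub>F R in at_top. \<forall>b>Re z. winding_number (boxpath b R) z = 0"
proof -
  obtain B where B: "\<And>t. \<bar>Re (L t)\<bar> < B" using bounded_Re by auto
  obtain N where N: "\<And>r. r \<le> N \<Longrightarrow> z \<in> connected_component_set (- range L) (of_real r)"
    using assms unfolding MB_left_of_def eventually_at_bot_linorder by blast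
  define r0 where "r0 = min N (min (- B - 1) (Re z - 1))"
  have r0: "r0 < - B" "r0 < Re z" "z \<in> connected_component_set (- range L) (of_real r0)"
    using N[of r0] by (auto simp: r0_def)
  from component_path[OF r0(3)] obtain C \<rho> where C: "connected C" "z \<in> C" "of_real r0 \<in> C" "C \<inter> range L = {}"
    "\<And>v. v \<in> C \<Longrightarrow> \<bar>Re v\<bar> < \<rho> \<and> \<bar>Im v\<bar> < \<rho>" by metis
  show zL: "z \<notin> range L" using C by auto
  have "winding_number (boxpath b R) z = 0" if R: "R \<ge> max T \<rho>" and b: "b > Re z" for R b
  proof -
    define b' where "b' = max b \<rho>"
    have "\<rho> > 0" "\<bar>Im z\<bar> < \<rho>" using C(5)[OF C(2)] by linarith+
    have "winding_number (boxpath b' R) z = 0"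
    proof (rule winding_number_boxpath_zero[OF _ _ _ C(1-5)])
      have "r0 < Re (L t)" for t using B[of t] r0(1) by linarith
      then show "(\<forall>t. Re (complex_of_real r0) < Re (L t)) \<and> Re (complex_of_real r0) < b'
          \<or> (\<forall>t. Re (L t) < Re (complex_of_real r0)) \<and> b' < Re (complex_of_real r0)"
        using r0 b by (auto simp: b'_def)
    qed (use R \<open>\<rho> > 0\<close> in \<open>auto simp: b'_def\<close>)
    moreover have "winding_number (rectpath (Complex b (- R)) (Complex b' R)) z = 0"
      using R b T_pos by (intro winding_number_rectpath_outside) (auto simp: b'_def in_cbox_complex_iff)
    moreover have "winding_number (boxpath b' R) z
        = winding_number (boxpath b R) z - winding_number (rectpath (Complex b (- R)) (Complex b' R)) z"
      using R b zL \<open>\<bar>Im z\<bar> < \<rho>\<close> by (intro winding_number_boxpath_diff) (auto simp: b'_def)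
    ultimately show ?thesis by simp
  qed
  then show "\<forall>\<^sub>F R in at_top. \<forall>b>Re z. winding_number (boxpath b R) z = 0"
    unfolding eventually_at_top_linorder by blast
qed

text \<open>Here the loop is first closed on the far left, at \<open>- \<rho>\<close>, where the far
  right real point sees it from outside. Moving the closing line to \<open>b\<close> sweeps over a
  rectangle containing \<open>z\<close>, which contributes -1.\<close>

lemma right_winding:
  assumes "MB_right_of L z"
  shows "z \<notin> range L" "\<forall>\<^sub>F R in at_top. \<forall>b>Re z. winding_number (boxpath b R) z = -1"
proof -
  obtain B where B: "\<And>t. \<bar>Re (L t)\<bar> < B" using bounded_Re by auto
  obtain N where N: "\<And>r. r \<ge> N \<Longrightarrow> z \<in> connected_component_set (- range L) (of_real r)"
    using assms unfolding MB_right_of_def eventually_at_top_linorder by blast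
  define r0 where "r0 = max N (max (B + 1) (Re z + 1))"
  have r0: "r0 > B" "r0 > Re z" "z \<in> connected_component_set (- range L) (of_real r0)"
    using N[of r0] by (auto simp: r0_def)
  from component_path[OF r0(3)] obtain C \<rho> where C: "connected C" "z \<in> C" "of_real r0 \<in> C" "C \<inter> range L = {}"
    "\<And>v. v \<in> C \<Longrightarrow> \<bar>Re v\<bar> < \<rho> \<and> \<bar>Im v\<bar> < \<rho>" by metis
  show zL: "z \<notin> range L" using C by auto
  have "winding_number (boxpath b R) z = -1" if R: "R \<ge> max T \<rho>" and b: "b > Re z" for R b
  proof -
    have \<rho>: "\<rho> > 0" "\<bar>Im z\<bar> < \<rho>" "- \<rho> < Re z" "\<rho> > r0"
      using C(5)[OF C(2)] C(5)[OF C(3)] by auto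
    have "winding_number (boxpath (- \<rho>) R) z = 0"
    proof (rule winding_number_boxpath_zero[OF _ _ _ C(1-5)])
      have "Re (L t) < r0" for t using B[of t] r0(1) by linarith
      moreover have "r0 > - \<rho>" using C(5)[OF C(3)] by auto
      ultimately show "(\<forall>t. Re (complex_of_real r0) < Re (L t)) \<and> Re (complex_of_real r0) < - \<rho>
          \<or> (\<forall>t. Re (L t) < Re (complex_of_real r0)) \<and> - \<rho> < Re (complex_of_real r0)"
        by auto
    qed (use R \<rho> in auto)
    moreover have "winding_number (rectpath (Complex (- \<rho>) (- R)) (Complex b R)) z = 1"
      using R b \<rho> by (intro winding_number_rectpath) (auto simp: in_box_complex_iff)
    moreover have "winding_number (boxpath b R) z
        = winding_number (boxpath (- \<rho>) R) z - winding_number (rectpath (Complex (- \<rho>) (- R)) (Complex b R)) z"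
      using R b zL \<rho> by (intro winding_number_boxpath_diff) auto
    ultimately show ?thesis by simp
  qed
  then show "\<forall>\<^sub>F R in at_top. \<forall>b>Re z. winding_number (boxpath b R) z = -1"
    unfolding eventually_at_top_linorder by blast
qed

lemma not_left_and_right:
  assumes "MB_left_of L z" "MB_right_of L z"
  shows False
proof -
  have "\<forall>\<^sub>F R in at_top. (\<forall>b>Re z. winding_number (boxpath b R) z = 0) \<and> (\<forall>b>Re z. winding_number (boxpath b R) z = -1)"
    using left_winding(2)[OF assms(1)] right_winding(2)[OF assms(2)] by eventually_elim blast
  then obtain R where R: "\<forall>b>Re z. winding_number (boxpath b R) z = 0" "\<forall>b>Re z. winding_number (boxpath b R) z = -1"
    using eventually_happens'[OF trivial_limit_at_top_linorder] by blast
  then have "winding_number (boxpath (Re z + 1) R) z = 0" "winding_number (boxpath (Re z + 1) R) z = -1"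
    using less_add_one[of "Re z"] by blast+
  then show False by simp
qed

end

section \<open>Transport of the sides of a contour\<close>

lemma MB_left_of_connected:
  assumes "connected D" "D \<inter> range L = {}" "z \<in> D" "w \<in> D" "MB_left_of L w"
  shows "MB_left_of L z"
  using assms(5) unfolding MB_left_of_def
proof eventually_elim
  case (elim R)
  have "connected_component (- range L) w z"
    unfolding connected_component_def using assms(1-4) by blast
  then show ?case
    using elim by (simp add: connected_component_trans)
qed

lemma MB_right_of_connected:
  assumes "connected D" "D \<inter> range L = {}" "z \<in> D" "w \<in> D" "MB_right_of L w"
  shows "MB_right_of L z"
  using assms(5) unfolding MB_right_of_def
proof eventually_elim
  case (elim R)
  have "connected_component (- range L) w z"
    unfolding connected_component_def using assms(1-4) by blast
  then show ?case
    using elim by (simp add: connected_component_trans)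
qed

lemma MB_left_of_halfplane:
  assumes "\<And>t. m \<le> Re (L t)" "Re z < m"
  shows "MB_left_of L z"
  unfolding MB_left_of_def eventually_at_bot_linorder
proof (intro exI allI impI)
  fix R assume "R \<le> m - 1"
  then show "z \<in> connected_component_set (- range L) (complex_of_real R)"
    using assms convex_connected[OF convex_halfspace_Re_lt[of m]]
    by (auto simp: connected_component_def not_le[symmetric] intro!: exI[of _ "{w. Re w < m}"])
qed

lemma MB_right_of_halfplane:
  assumes "\<And>t. Re (L t) \<le> m" "m < Re z"
  shows "MB_right_of L z"
  unfolding MB_right_of_def eventually_at_top_linorder
proof (intro exI allI impI)
  fix R assume "R \<ge> m + 1"
  then show "z \<in> connected_component_set (- range L) (complex_of_real R)"
    using assms convex_connected[OF convex_halfspace_Re_gt[of m]]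
    by (auto simp: connected_component_def not_le[symmetric] intro!: exI[of _ "{w. m < Re w}"])
qed

text \<open>The right component of \<open>L\<close> avoids the reflected curve \<open>p - L2\<close>, so the reflection of a path from
  \<open>q\<close> to infinity in it joins \<open>p - q\<close> to infinity on the left of \<open>L2\<close>.\<close>
lemma MB_left_of_reflect:
  assumes "mb_contour L c T" "mb_contour L2 c2 T2"
    and left: "\<And>t. MB_left_of L (p - L2 t)" and right: "MB_right_of L q"
  shows "MB_left_of L2 (p - q)"
proof -
  interpret L: mb_contour L c T by fact
  interpret L2: mb_contour L2 c2 T2 by fact
  obtain B where B: "\<And>t. \<bar>Re (L2 t)\<bar> < B" using L2.bounded_Re by auto
  have "\<forall>\<^sub>F R in at_top. R > \<bar>Re p\<bar> + \<bar>B\<bar> \<and> q \<in> connected_component_set (- range L) (complex_of_real R)"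
    using right unfolding MB_right_of_def by (intro eventually_conj eventually_gt_at_top)
  then obtain R where R: "R > \<bar>Re p\<bar> + \<bar>B\<bar>" "q \<in> connected_component_set (- range L) (complex_of_real R)"
    using eventually_happens'[OF trivial_limit_at_top_linorder] by blast
  then obtain C where C: "connected C" "C \<subseteq> - range L" "q \<in> C" "of_real R \<in> C"
    by (auto simp: connected_component_def)
  define D where "D = (\<lambda>w. p - w) ` C"
  have "connected D" unfolding D_def
    by (intro connected_continuous_image continuous_intros C)
  moreover have "D \<inter> range L2 = {}"
  proof (rule ccontr)
    assume "D \<inter> range L2 \<noteq> {}"
    then obtain w t where w: "w \<in> C" "p - w = L2 t" by (auto simp: D_def)
    have "w = p - L2 t" using w(2) by (simp add: algebra_simps)
    then have "MB_left_of L w" using left by simp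
    moreover have "MB_right_of L w"
      using MB_right_of_connected[OF C(1) _ w(1) C(3) right] C(2) by auto
    ultimately show False by (rule L.not_left_and_right)
  qed
  \<comment> \<open>The choice of \<open>R\<close> puts this end of the reflected set left of all of
    \<open>L2\<close>.\<close>
  moreover have "MB_left_of L2 (p - of_real R)"
  proof (rule MB_left_of_halfplane[of "- \<bar>B\<bar>"])
    show "- \<bar>B\<bar> \<le> Re (L2 t)" for t using B[of t] by linarith
  qed (use R in auto)
  moreover have "p - q \<in> D" "p - of_real R \<in> D"
    using C unfolding D_def by blast+
  ultimately show ?thesis
    using MB_left_of_connected by blast
qed

section \<open>Deformation to residues and a vertical line\<close>

lemma integrable_exp_abs: "integrable lborel (\<lambda>t::real. exp (- \<bar>t\<bar>))"
proof -
  have "(\<lambda>x::real. exp (- x)) absolutely_integrable_on {0..}"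
    using integrable_on_exp_minus_to_infinity[of 1 0]
    by (intro nonnegative_absolutely_integrable_1) auto
  then have *: "integrable lborel (\<lambda>t. indicator {0..} t *\<^sub>R exp (- t :: real))"
    unfolding set_integrable_def by (subst (asm) integrable_completion) auto
  then have "integrable lborel (\<lambda>t. indicator {0..} (0 + (- 1) * t) *\<^sub>R exp (- (0 + (- 1) * t) :: real))"
    by (rule lborel_integrable_real_affine) auto
  with * have i: "integrable lborel (\<lambda>t. indicator {0..} t *\<^sub>R exp (- t :: real)
      + indicator {0..} (0 + (- 1) * t) *\<^sub>R exp (- (0 + (- 1) * t) :: real))"
    by (rule Bochner_Integration.integrable_add)
  show ?thesis
    by (rule Bochner_Integration.integrable_bound[OF i]) (auto simp: indicator_def)
qed

lemma integrable_exp_bound: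
  fixes F :: "real \<Rightarrow> complex"
  assumes "F \<in> borel_measurable borel" "\<And>t. norm (F t) \<le> K * exp (- \<bar>t\<bar>)"
  shows "integrable lborel F"
proof (rule Bochner_Integration.integrable_bound)
  show "integrable lborel (\<lambda>t. K * exp (- \<bar>t\<bar>))"
    using integrable_exp_abs by simp
  show "AE t in lborel. norm (F t) \<le> norm (K * exp (- \<bar>t\<bar>))"
    by (intro AE_I2 order_trans[OF assms(2)]) simp
qed (use assms in simp)

lemma continuous_exp_tail_bound:
  fixes F :: "real \<Rightarrow> complex"
  assumes "continuous_on UNIV F" "\<And>t. \<bar>t\<bar> \<ge> U \<Longrightarrow> norm (F t) \<le> C * exp (- \<bar>t\<bar>)"
  shows "\<exists>K. \<forall>t. norm (F t) \<le> K * exp (- \<bar>t\<bar>)"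
proof -
  have "bounded ((\<lambda>t. F t * of_real (exp \<bar>t\<bar>)) ` {-U..U})"
    by (intro compact_imp_bounded compact_continuous_image continuous_intros continuous_on_subset[OF assms(1)]) auto
  then obtain K where K: "\<And>t. t \<in> {-U..U} \<Longrightarrow> norm (F t * of_real (exp \<bar>t\<bar>)) \<le> K"
    unfolding bounded_iff by blast
  have "norm (F t) \<le> max K C * exp (- \<bar>t\<bar>)" for t
  proof (cases "\<bar>t\<bar> \<ge> U")
    case True
    then show ?thesis
      by (intro order_trans[OF assms(2)] mult_right_mono) auto
  next
    case False
    then have "t \<in> {-U..U}" by auto
    then have "norm (F t) * exp \<bar>t\<bar> \<le> K" using K[of t] by (simp add: norm_mult)
    then have "norm (F t) * exp \<bar>t\<bar> * exp (- \<bar>t\<bar>) \<le> K * exp (- \<bar>t\<bar>)"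
      by (intro mult_right_mono) auto
    also have "\<dots> \<le> max K C * exp (- \<bar>t\<bar>)" by (intro mult_right_mono) auto
    finally show ?thesis by (simp add: mult.assoc exp_add[symmetric])
  qed
  then show ?thesis by blast
qed

lemma integral_symmetric_limit:
  fixes F :: "real \<Rightarrow> complex"
  assumes F: "integrable lborel F"
  shows "((\<lambda>R. integral {-R..R} F) \<longlongrightarrow> (\<integral>t. F t \<partial>lborel)) at_top"
proof -
  have si: "set_integrable lborel {-R..R} F" for R
    unfolding set_integrable_def using F by (intro integrable_mult_indicator) auto
  have eq: "integral {-R..R} F = (\<integral>t. indicator {-R..R} t *\<^sub>R F t \<partial>lborel)" for R
    using set_borel_integral_eq_integral(2)[OF si] by (simp add: set_lebesgue_integral_def)
  show ?thesis unfolding eq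
  proof (rule integral_dominated_convergence_at_top[where w = "\<lambda>t. norm (F t)"])
    show "AE x in lborel. ((\<lambda>R. indicator {-R..R} x *\<^sub>R F x) \<longlongrightarrow> F x) at_top"
    proof (rule AE_I2)
      fix x :: real
      have "\<forall>\<^sub>F R in at_top. indicator {-R..R} x *\<^sub>R F x = F x"
        using eventually_ge_at_top[of "\<bar>x\<bar>"] by eventually_elim (auto simp: indicator_def)
      then show "((\<lambda>R. indicator {-R..R} x *\<^sub>R F x) \<longlongrightarrow> F x) at_top"
        by (rule tendsto_eventually)
    qed
  qed (use F in \<open>auto simp: indicator_def intro!: always_eventually\<close>)
qed

text \<open>The index functions of the deformed contour: for \<open>n \<le> M\<close> the interval from \<open>n\<close> to \<open>n + 1\<close> carries the residue of
  \<open>\<Gamma>(-s)\<close> at \<open>n\<close>, and the remaining half-lines together parametrise the vertical line \<open>Re s = M + 1/2\<close>.\<close>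

definition res_node :: "nat \<Rightarrow> real \<Rightarrow> complex" where
  "res_node M u = (if u < 0 then Complex (real M + 1/2) u
     else if u < real M + 1 then of_nat (nat \<lfloor>u\<rfloor>) else Complex (real M + 1/2) (u - (real M + 1)))"

definition res_weight :: "nat \<Rightarrow> real \<Rightarrow> complex" where
  "res_weight M u = (if 0 \<le> u \<and> u < real M + 1 then 2 * of_real pi * \<i> * (-1) ^ nat \<lfloor>u\<rfloor> / fact (nat \<lfloor>u\<rfloor>)
     else \<i> * Gamma (- res_node M u))"

lemma res_integral:
  fixes g :: "complex \<Rightarrow> complex"
  assumes line: "integrable lborel (\<lambda>t. Gamma (- Complex (real M + 1/2) t) * g (Complex (real M + 1/2) t))"
  shows "has_bochner_integral lborel (\<lambda>u. res_weight M u * g (res_node M u))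
     (2 * of_real pi * \<i> * (\<Sum>n\<le>M. (-1) ^ n / fact n * g (of_nat n))
      + \<i> * (\<integral>t. Gamma (- Complex (real M + 1/2) t) * g (Complex (real M + 1/2) t) \<partial>lborel))"
proof -
  define h where "h t = \<i> * (Gamma (- Complex (real M + 1/2) t) * g (Complex (real M + 1/2) t))" for t
  define a where "a n = 2 * of_real pi * \<i> * ((-1) ^ n / fact n * g (of_nat n))" for n :: nat
  have h: "integrable lborel h" unfolding h_def using line by simp
  have hs: "integrable lborel (\<lambda>t. indicator A t *\<^sub>R h t)" if "A \<in> sets borel" for A
    using that h by (intro integrable_mult_indicator) auto
  have 1: "has_bochner_integral lborel (\<lambda>u. indicator {real n..<real n + 1} u *\<^sub>R a n) (a n)" for n
    using has_bochner_integral_scaleR_left[OF has_bochner_integral_real_indicator[of "{real n..<real n + 1}" lborel], of "a n"]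
    by simp
  have 2: "has_bochner_integral lborel (\<lambda>u. indicator {..<0} u *\<^sub>R h u) (\<integral>u. indicator {..<0} u *\<^sub>R h u \<partial>lborel)"
    by (intro has_bochner_integral_integrable hs) auto
  \<comment> \<open>The upper half of the line is shifted by M + 1 to make room for the unit
    intervals that carry the M + 1 residues.\<close>
  have 3: "has_bochner_integral lborel (\<lambda>u. indicator {real M + 1..} u *\<^sub>R h (u - (real M + 1)))
     (\<integral>u. indicator {0..} u *\<^sub>R h u \<partial>lborel)"
  proof -
    have "has_bochner_integral lborel (\<lambda>u. indicator {0..} u *\<^sub>R h u) (\<integral>u. indicator {0..} u *\<^sub>R h u \<partial>lborel)"
      by (intro has_bochner_integral_integrable hs) auto
    then have "has_bochner_integral lborel (\<lambda>u. indicator {0..} (- (real M + 1) + 1 * u) *\<^sub>R h (- (real M + 1) + 1 * u))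
      ((\<integral>u. indicator {0..} u *\<^sub>R h u \<partial>lborel) /\<^sub>R \<bar>1\<bar>)"
      by (subst (asm) lborel_has_bochner_integral_real_affine_iff[where c = 1 and t = "- (real M + 1)"]) auto
    then show ?thesis
      by (simp add: indicator_def algebra_simps cong: if_cong)
  qed
  have 4: "(\<integral>u. indicator {..<0} u *\<^sub>R h u \<partial>lborel) + (\<integral>u. indicator {0..} u *\<^sub>R h u \<partial>lborel) = (\<integral>u. h u \<partial>lborel)"
    by (subst Bochner_Integration.integral_add[symmetric, OF hs hs])
       (auto intro!: Bochner_Integration.integral_cong simp: indicator_def)
  have S: "has_bochner_integral lborel (\<lambda>u. (\<Sum>n\<le>M. indicator {real n..<real n + 1} u *\<^sub>R a n)
      + (indicator {..<0} u *\<^sub>R h u + indicator {real M + 1..} u *\<^sub>R h (u - (real M + 1))))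
      ((\<Sum>n\<le>M. a n) + (\<integral>u. h u \<partial>lborel))"
    unfolding 4[symmetric]
    by (intro has_bochner_integral_add has_bochner_integral_sum 1 2 3)
  have "(\<lambda>u. (\<Sum>n\<le>M. indicator {real n..<real n + 1} u *\<^sub>R a n)
      + (indicator {..<0} u *\<^sub>R h u + indicator {real M + 1..} u *\<^sub>R h (u - (real M + 1))))
      = (\<lambda>u. res_weight M u * g (res_node M u))"
  proof
    fix u :: real
    show "(\<Sum>n\<le>M. indicator {real n..<real n + 1} u *\<^sub>R a n)
      + (indicator {..<0} u *\<^sub>R h u + indicator {real M + 1..} u *\<^sub>R h (u - (real M + 1))) = res_weight M u * g (res_node M u)"
    proof (cases "0 \<le> u \<and> u < real M + 1")
      case True
      define k where "k = nat \<lfloor>u\<rfloor>"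
      have k: "real k \<le> u" "u < real k + 1" "k \<le> M"
        using True unfolding k_def by linarith+
      have "(\<Sum>n\<le>M. indicator {real n..<real n + 1} u *\<^sub>R a n) = (\<Sum>n\<le>M. if n = k then a k else 0)"
      proof (intro sum.cong refl)
        fix n
        have "u \<in> {real n..<real n + 1} \<longleftrightarrow> n = k" using k by auto
        then show "indicator {real n..<real n + 1} u *\<^sub>R a n = (if n = k then a k else 0)"
          by (simp add: indicator_def)
      qed
      also have "\<dots> = a k" using k by simp
      finally show ?thesis
        using True by (simp add: res_weight_def res_node_def a_def flip: k_def)
    next
      case False
      then have "(\<Sum>n\<le>M. indicator {real n..<real n + 1} u *\<^sub>R a n) = 0"
        by (intro sum.neutral) (auto simp: indicator_def)
      then show ?thesis
        using False by (auto simp: res_weight_def res_node_def h_def)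
    qed
  qed
  moreover have "(\<Sum>n\<le>M. a n) = 2 * of_real pi * \<i> * (\<Sum>n\<le>M. (-1) ^ n / fact n * g (of_nat n))"
    by (simp add: a_def sum_distrib_left)
  moreover have "(\<integral>u. h u \<partial>lborel) = \<i> * (\<integral>t. Gamma (- Complex (real M + 1/2) t) * g (Complex (real M + 1/2) t) \<partial>lborel)"
    unfolding h_def by (rule integral_mult_right_zero)
  ultimately show ?thesis using S by simp
qed

text \<open>The substitution s -> -s reverses the sign of the residue of \<Gamma> at -n, and the
  holomorphic factor only contributes its value at n.\<close>

lemma residue_Gamma_uminus_mult:
  assumes "open S" "of_nat n \<in> S" "g holomorphic_on S"
  shows "residue (\<lambda>s. Gamma (- s) * g s) (of_nat n) = - ((-1) ^ n / fact n * g (of_nat n))"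
proof -
  let ?D = "S \<inter> ball (of_nat n) 1"
  have *: "isCont g (of_nat n)"
    using assms by (metis continuous_on_eq_continuous_at holomorphic_on_imp_continuous_on)
  have "(\<lambda>w. Gamma w * (w + of_nat n)) \<midarrow> - of_nat n \<rightarrow> ((-1) ^ n / fact n :: complex)"
    by (rule Gamma_residues)
  moreover have "filterlim uminus (at (- of_nat n :: complex)) (at (of_nat n))"
    unfolding filterlim_at by (auto intro!: tendsto_eq_intros simp: eventually_at_filter)
  ultimately have "(\<lambda>w. Gamma (- w) * (- w + of_nat n)) \<midarrow> of_nat n \<rightarrow> ((-1) ^ n / fact n :: complex)"
    by (rule filterlim_compose)
  then have lim: "(\<lambda>w. - (Gamma (- w) * (- w + of_nat n) * g w)) \<midarrow> of_nat n \<rightarrow> - ((-1) ^ n / fact n * g (of_nat n))"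
    using * by (intro tendsto_intros) (auto simp: isCont_def)
  show ?thesis
  proof (rule residue_simple'[of ?D])
    show "(\<lambda>s. Gamma (- s) * g s) holomorphic_on ?D - {of_nat n}"
    proof (intro holomorphic_intros holomorphic_on_subset[OF assms(3)])
      fix s :: complex assume s: "s \<in> ?D - {of_nat n}"
      show "- s \<notin> \<int>\<^sub>\<le>\<^sub>0"
      proof
        assume "- s \<in> \<int>\<^sub>\<le>\<^sub>0"
        then obtain k :: nat where "s = of_nat k" by (auto elim!: nonpos_Ints_cases')
        then have "dist (of_nat n :: complex) (of_nat k) < 1" "k \<noteq> n" using s by auto
        moreover have "(of_nat n - of_nat k :: complex) = of_real (real n - real k)" by simp
        ultimately show False unfolding dist_norm by (simp only: norm_of_real)
      qed
    qed auto
    show "(\<lambda>w. Gamma (- w) * g w * (w - of_nat n)) \<midarrow> of_nat n \<rightarrow> - ((-1) ^ n / fact n * g (of_nat n))"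
      using lim by (simp add: algebra_simps)
  qed (use assms in auto)
qed

section \<open>The residue theorem for a single contour\<close>

context mb_contour
begin

lemma contour_integral_seg:
  assumes "R > 0" "continuous_on (range L) f"
  shows "contour_integral (seg R) f = integral {-R..R} (\<lambda>t. f (L t) * L' t)"
proof -
  let ?F = "\<lambda>t. f (L t) * L' t"
  have "continuous_on UNIV ?F"
    by (intro continuous_intros continuous_on_compose2[OF assms(2)] continuous continuous_deriv) auto
  then have "?F integrable_on {-R..R}"
    by (intro integrable_continuous_interval) (auto elim: continuous_on_subset)
  then have "(?F has_integral integral {-R..R} ?F) (cbox (-R) R)"
    by (simp add: has_integral_integral)
  from has_integral_affinity'[OF this, of "2 * R" "- R"]
  have "((\<lambda>x. ?F (2 * R * x + - R)) has_integral integral {-R..R} ?F /\<^sub>R (2 * R)) {0..1}"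
    using assms(1) by (simp add: field_simps)
  from has_integral_mult_left[OF this, of "of_real (2 * R)"]
  have "((\<lambda>x. ?F (2 * R * x + - R) * of_real (2 * R)) has_integral integral {-R..R} ?F) {0..1}"
    using assms(1) by (simp add: scaleR_conv_of_real field_simps)
  then have "(f has_contour_integral integral {-R..R} ?F) (seg R)"
    unfolding has_contour_integral
    by (simp add: vector_derivative_at[OF seg_deriv] seg_def scaleR_conv_of_real mult_ac add.commute)
  then show ?thesis by (rule contour_integral_unique)
qed

text \<open>The residue theorem is applied to \<open>boxpath b R\<close> with b = M + 1/2. The loop
  winds once, clockwise, around 0, ..., M and not at all around the points of \<open>P\<close>, the
  possible poles of \<open>g\<close>; as \<open>R\<close> grows, the decay hypothesis removes the
  horizontal sides. The case distinction on the position of poles is entirely in the winding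
  numbers, so the shape of \<open>L\<close> never enters.\<close>

lemma contour_deformation:
  fixes g :: "complex \<Rightarrow> complex"
  assumes right: "\<And>n::nat. MB_right_of L (of_nat n)"
    and left: "\<And>p. p \<in> P \<Longrightarrow> MB_left_of L p"
    and finP: "\<And>A. finite {p\<in>P. A \<le> Re p}" and closedP: "closed P"
    and g: "g holomorphic_on - P"
    and decay: "\<And>B. \<exists>C U. \<forall>s. \<bar>Re s\<bar> \<le> B \<longrightarrow> U \<le> \<bar>Im s\<bar> \<longrightarrow> norm (Gamma (- s) * g s) \<le> C * exp (- \<bar>Im s\<bar>)"
    and M: "\<And>p. p \<in> P \<Longrightarrow> Re p < real M + 1/2" "\<And>t. Re (L t) < real M + 1/2"
  shows "integrable lborel (\<lambda>t. Gamma (- Complex (real M + 1/2) t) * g (Complex (real M + 1/2) t))"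
    "(\<integral>t. Gamma (- L t) * L' t * g (L t) \<partial>lborel) = (\<integral>u. res_weight M u * g (res_node M u) \<partial>lborel)"
proof -
  define b where "b = real M + 1/2"
  define G where "G s = Gamma (- s) * g s" for s
  \<comment> \<open>The target line is itself a contour of the same kind, so its integral over
    [-R, R] comes from the same change of variables.\<close>
  interpret V: mb_contour "Complex b" b 1
  proof
    show "Complex b C1_differentiable_on UNIV"
      unfolding C1_differentiable_on_def Complex_eq
      by (intro exI[of _ "\<lambda>_. \<i>"]) (auto intro!: derivative_eq_intros simp: has_vector_derivative_def[of of_real])
  qed auto
  have V': "V.L' t = \<i>" for t
    unfolding Complex_eq
    by (intro vector_derivative_at) (auto intro!: derivative_eq_intros simp: has_vector_derivative_def[of of_real])
  define N :: "complex set" where "N = range of_nat"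
  have N: "- s \<in> \<int>\<^sub>\<le>\<^sub>0 \<longleftrightarrow> s \<in> N" for s :: complex
    unfolding N_def by (auto elim!: nonpos_Ints_cases' intro: nonpos_IntsI simp: minus_equation_iff)
  have closedN: "closed N"
    unfolding N_def using closed_of_nat_image[of UNIV] by simp
  have Ghol: "G holomorphic_on - P - N"
    unfolding G_def by (intro holomorphic_intros holomorphic_on_subset[OF g]) (auto simp: N)
  have openD: "open (- P - N)" using closedP closedN by (simp add: open_Compl open_Diff)
  have LD: "range L \<subseteq> - P - N"
  proof -
    have "z \<notin> N" if "z \<in> range L" for z
      using right_winding(1)[OF right] that unfolding N_def by blast
    then show ?thesis using left_winding(1)[OF left] by blast
  qed
  have bN: "Complex b t \<notin> N" for t
  proof
    assume "Complex b t \<in> N"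
    then obtain n :: nat where "b = real n" by (auto simp: N_def complex_eq_iff)
    then have "2 * real M + 1 = 2 * real n" by (simp add: b_def)
    then have "real (2 * M + 1) = real (2 * n)" by simp
    then have "2 * M + 1 = 2 * n" by (simp only: of_nat_eq_iff)
    then show False by presburger
  qed
  have VD: "range (Complex b) \<subseteq> - P - N"
    using bN M(1) by (force simp: b_def)
  obtain B0 where B0: "B0 > 0" "\<bar>c\<bar> < B0" "\<And>t. \<bar>Re (L t)\<bar> < B0" using bounded_Re by auto
  \<comment> \<open>Wide enough for both contours and for the horizontal sides between them.\<close>
  define B where "B = B0 + b"
  have b0: "b > 0" by (simp add: b_def)
  obtain C U0 where C0: "\<And>s. \<bar>Re s\<bar> \<le> B \<Longrightarrow> U0 \<le> \<bar>Im s\<bar> \<Longrightarrow> norm (G s) \<le> C * exp (- \<bar>Im s\<bar>)"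
    using decay[of B] unfolding G_def by blast
  define U where "U = max U0 (T + 1)"
  have C: "norm (G s) \<le> C * exp (- \<bar>Im s\<bar>)" if "\<bar>Re s\<bar> \<le> B" "U \<le> \<bar>Im s\<bar>" for s
    using C0 that by (simp add: U_def)
  have contG: "continuous_on (- P - N) G"
    by (rule holomorphic_on_imp_continuous_on[OF Ghol])
  define FL where "FL t = G (L t) * L' t" for t
  define FV where "FV t = G (Complex b t) * \<i>" for t
  have cFL: "continuous_on UNIV FL"
    unfolding FL_def using LD
    by (intro continuous_intros continuous_on_compose2[OF contG] continuous continuous_deriv) auto
  have cFV: "continuous_on UNIV FV"
    unfolding FV_def using VD
    by (intro continuous_intros continuous_on_compose2[OF contG] V.continuous) auto
  have "norm (FL t) \<le> C * exp (- \<bar>t\<bar>)" if "\<bar>t\<bar> \<ge> U" for t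
    using C[of "Complex c t"] that B0 b0 tail[of t] deriv_tail[of t]
    by (simp add: FL_def norm_mult B_def U_def)
  then have iFL: "integrable lborel FL"
    using continuous_exp_tail_bound[OF cFL] integrable_exp_bound[of FL] cFL borel_measurable_continuous_onI by blast
  have "norm (FV t) \<le> C * exp (- \<bar>t\<bar>)" if "\<bar>t\<bar> \<ge> U" for t
    using C[of "Complex b t"] that B0 b0 by (simp add: FV_def norm_mult B_def)
  then have iFV: "integrable lborel FV"
    using continuous_exp_tail_bound[OF cFV] integrable_exp_bound[of FV] cFV borel_measurable_continuous_onI by blast
  then have "integrable lborel (\<lambda>t. - \<i> * FV t)" by simp
  then show line: "integrable lborel (\<lambda>t. Gamma (- Complex (real M + 1/2) t) * g (Complex (real M + 1/2) t))"
    by (simp add: FV_def G_def b_def mult_ac)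

  define RS where "RS = 2 * of_real pi * \<i> * (\<Sum>n\<le>M. (-1) ^ n / fact n * g (of_nat n))"
  \<comment> \<open>Only finitely many points of \<open>P\<close> lie in the range of the loops, so
    a single \<open>R\<close> is eventually good for all of them.\<close>
  define P0 where "P0 = {p\<in>P. - B0 \<le> Re p}"
  have finP0: "finite P0" unfolding P0_def by (rule finP)
  \<comment> \<open>A convex strip around all loops; its right edge M + 1 excludes every natural
    number beyond M.\<close>
  define Q where "Q = {s. - B0 < Re s \<and> Re s < real M + 1}"
  have Q: "open Q" "convex Q"
    unfolding Q_def Collect_conj_eq
    by (intro open_Int open_halfspace_Re_gt open_halfspace_Re_lt convex_Int convex_halfspace_Re_gt convex_halfspace_Re_lt)+
  define H where "H R = contour_integral (linepath (Complex c R) (Complex b R)) G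
        + contour_integral (linepath (Complex b (- R)) (Complex c (- R))) G" for R
  have key: "\<forall>\<^sub>F R in at_top. integral {-R..R} FL - integral {-R..R} FV + H R = RS"
  proof -
    have e1: "\<forall>\<^sub>F R in at_top. \<forall>p\<in>P0. \<forall>b>Re p. winding_number (boxpath b R) p = 0"
      by (intro eventually_ball_finite finP0 ballI left_winding(2) left) (auto simp: P0_def)
    have e2: "\<forall>\<^sub>F R in at_top. \<forall>n\<in>{..M}. \<forall>b>Re (of_nat n). winding_number (boxpath b R) (of_nat n) = -1"
      by (intro eventually_ball_finite ballI right_winding(2) right) auto
    have e3: "\<forall>\<^sub>F R in at_top. \<forall>p\<in>P0. \<bar>Im p\<bar> < R"
      by (intro eventually_ball_finite finP0 ballI eventually_gt_at_top)
    show ?thesis using e1 e2 e3 eventually_ge_at_top[of U]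
    proof eventually_elim
      case (elim R)
      have R: "R \<ge> T" "R > 0" using elim(4) T_pos by (auto simp: U_def)
      \<comment> \<open>The points of \<open>P0\<close> are deleted from the domain instead of being
        counted as singularities: the loop does not wind around them, which is what the residue
        theorem asks of points outside the domain.\<close>
      define S where "S = Q - P0"
      define pts :: "complex set" where "pts = of_nat ` {..M}"
      have S: "open S" unfolding S_def using Q finP0 by (intro open_Diff finite_imp_closed)
      have "connected S" unfolding S_def
        using Q finP0 by (intro connected_open_delete_finite convex_connected) auto
      have SP: "S \<inter> P = {}" by (auto simp: S_def P0_def Q_def)
      have QN: "Q \<inter> N \<subseteq> pts"
        by (auto simp: Q_def N_def pts_def)
      have SD: "S - pts \<subseteq> - P - N" using SP QN by (auto simp: S_def)
      have cb: "c < b" using M(2)[of T] tail[of T] T_pos by (simp add: b_def)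
      have PQ: "path_image (boxpath b R) \<subseteq> Q"
      proof (rule order_trans[OF boxpath_subset[OF R(1)]])
        have "range L \<subseteq> Q"
        proof safe
          fix t show "L t \<in> Q" using B0(3)[of t] M(2)[of t] by (auto simp: Q_def)
        qed
        then show "range L \<union> {z. Im z = R \<and> Re z \<in> closed_segment c b} \<union> {z. Im z = -R \<and> Re z \<in> closed_segment c b}
           \<union> {z. Re z = b \<and> \<bar>Im z\<bar> \<le> R} \<subseteq> Q"
          using cb B0 b0 by (auto simp: Q_def closed_segment_eq_real_ivl b_def)
      qed
      have PS: "path_image (boxpath b R) \<subseteq> - P0 - pts"
      proof (rule order_trans[OF boxpath_subset[OF R(1)]])
        have a: "range L \<subseteq> - P0 - pts" using LD by (auto simp: P0_def pts_def N_def)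
        have d: "Im z = 0" if "z \<in> pts" for z using that by (auto simp: pts_def)
        have "z \<notin> P0 \<and> z \<notin> pts" if "Re z = b" for z
        proof -
          have "z = Complex b (Im z)" using that by (simp add: complex_eq_iff)
          then have "z \<in> - P - N" using VD by blast
          then show ?thesis by (auto simp: P0_def pts_def N_def)
        qed
        then show "range L \<union> {z. Im z = R \<and> Re z \<in> closed_segment c b} \<union> {z. Im z = -R \<and> Re z \<in> closed_segment c b}
           \<union> {z. Re z = b \<and> \<bar>Im z\<bar> \<le> R} \<subseteq> - P0 - pts"
          using a elim(3) R(2) d by fastforce
      qed
      have PSS: "path_image (boxpath b R) \<subseteq> S - pts" using PQ PS by (auto simp: S_def)
      have w0: "winding_number (boxpath b R) z = 0" if "z \<notin> S" for z
      proof (cases "z \<in> Q")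
        case True
        then have "z \<in> P0" using that by (auto simp: S_def)
        then show ?thesis using elim(1) M(1)[of z] by (auto simp: P0_def b_def)
      next
        case False
        show ?thesis
          by (rule winding_number_zero_outside[OF _ Q(2) _ False PQ])
             (use R in \<open>auto simp: boxpath_loop valid_path_imp_path valid_path_boxpath\<close>)
      qed
      have "contour_integral (boxpath b R) G = 2 * pi * \<i> * (\<Sum>p\<in>pts. winding_number (boxpath b R) p * residue G p)"
        by (rule Residue_theorem[OF S \<open>connected S\<close>])
           (use PSS w0 R in \<open>auto simp: boxpath_loop valid_path_boxpath pts_def intro: holomorphic_on_subset[OF Ghol SD, unfolded pts_def]\<close>)
      also have "(\<Sum>p\<in>pts. winding_number (boxpath b R) p * residue G p)
          = (\<Sum>n\<le>M. winding_number (boxpath b R) (of_nat n) * residue G (of_nat n))"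
        unfolding pts_def by (subst sum.reindex) (auto simp: inj_on_def)
      also have "\<dots> = (\<Sum>n\<le>M. (-1) ^ n / fact n * g (of_nat n))"
      proof (intro sum.cong refl)
        fix n assume n: "n \<in> {..M}"
        \<comment> \<open>The clockwise orientation cancels the minus sign of the residue.\<close>
        have "winding_number (boxpath b R) (of_nat n) = -1"
          using elim(2) n by (auto simp: b_def)
        moreover have "of_nat n \<notin> P"
          using left right not_left_and_right by blast
        then have "residue G (of_nat n) = - ((-1) ^ n / fact n * g (of_nat n))"
          unfolding G_def[abs_def] using closedP g by (intro residue_Gamma_uminus_mult[of "- P"]) auto
        ultimately show "winding_number (boxpath b R) (of_nat n) * residue G (of_nat n) = (-1) ^ n / fact n * g (of_nat n)"
          by simp
      qed
      finally have 1: "contour_integral (boxpath b R) G = RS" by (simp add: RS_def)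
      have oS: "open (S - pts)" using S by (intro open_Diff finite_imp_closed) (auto simp: pts_def)
      have 2: "contour_integral (boxpath b R) G = contour_integral (seg R) G
         + contour_integral (linepath (Complex c R) (Complex b R)) G
         + contour_integral (linepath (Complex b R) (Complex b (- R))) G
         + contour_integral (linepath (Complex b (- R)) (Complex c (- R))) G"
        by (rule contour_integral_boxpath[OF R(1) oS holomorphic_on_subset[OF Ghol SD] PSS])
      have 3: "contour_integral (seg R) G = integral {-R..R} FL"
        unfolding FL_def[abs_def] using R LD
        by (intro contour_integral_seg continuous_on_subset[OF contG]) auto
      have "V.seg R = linepath (Complex b (- R)) (Complex b R)"
        by (auto simp: V.seg_def linepath_def complex_eq_iff algebra_simps)
      then have 4: "contour_integral (linepath (Complex b (- R)) (Complex b R)) G = integral {-R..R} FV"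
        unfolding FV_def[abs_def] using R VD V.contour_integral_seg[of R G, unfolded V']
        by (simp add: continuous_on_subset[OF contG])
      have 5: "contour_integral (linepath (Complex b R) (Complex b (- R))) G = - contour_integral (linepath (Complex b (- R)) (Complex b R)) G"
        using VD by (intro contour_integral_reverse_linepath continuous_on_subset[OF contG]) (auto simp: closed_segment_same_Re image_iff complex_eq_iff)
      show ?case
        using 1 2 3 4 5 by (simp add: H_def algebra_simps)
    qed
  qed
  have Hlim: "(H \<longlongrightarrow> 0) at_top"
  proof (rule Lim_null_comparison)
    have "\<forall>\<^sub>F R in at_top. \<forall>p\<in>P0. \<bar>Im p\<bar> < R"
      by (intro eventually_ball_finite finP0 ballI eventually_gt_at_top)
    then show "\<forall>\<^sub>F R in at_top. norm (H R) \<le> 2 * (\<bar>C\<bar> * exp (- R) * \<bar>b - c\<bar>)"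
      using eventually_ge_at_top[of U]
    proof eventually_elim
      case (elim R)
      have R: "R > 0" using elim(2) T_pos by (auto simp: U_def)
      have cb: "c < b" using M(2)[of T] tail[of T] T_pos by (simp add: b_def)
      have bnd: "norm (contour_integral (linepath (Complex x y) (Complex x' y)) G) \<le> (\<bar>C\<bar> * exp (- R)) * norm (Complex x' y - Complex x y)"
        if y: "\<bar>y\<bar> = R" and x: "x \<in> {c..b}" "x' \<in> {c..b}" for x x' y
      proof (rule contour_integral_bound_linepath)
        have seg: "\<bar>Re s\<bar> \<le> B \<and> Im s = y \<and> - B0 \<le> Re s" if "s \<in> closed_segment (Complex x y) (Complex x' y)" for s
          using that x B0 b0 by (auto simp: closed_segment_same_Im closed_segment_eq_real_ivl B_def split: if_splits)
        have "closed_segment (Complex x y) (Complex x' y) \<subseteq> - P - N"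
        proof
          fix s assume "s \<in> closed_segment (Complex x y) (Complex x' y)"
          from seg[OF this] have s: "Im s = y" "- B0 \<le> Re s" by auto
          then have "s \<notin> P" using elim(1) y by (auto simp: P0_def)
          moreover have "s \<notin> N" using s y R by (auto simp: N_def)
          ultimately show "s \<in> - P - N" by auto
        qed
        then show "G contour_integrable_on linepath (Complex x y) (Complex x' y)"
          by (intro contour_integrable_continuous_linepath continuous_on_subset[OF contG])
        fix s assume "s \<in> closed_segment (Complex x y) (Complex x' y)"
        then have "norm (G s) \<le> C * exp (- R)" using C[of s] seg[of s] y elim(2) by auto
        also have "\<dots> \<le> \<bar>C\<bar> * exp (- R)" by (intro mult_right_mono) auto
        finally show "norm (G s) \<le> \<bar>C\<bar> * exp (- R)" .
      qed auto
      have n: "norm (Complex x' y - Complex x y) = \<bar>x' - x\<bar>" for x x' y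
        by (simp add: cmod_def)
      show ?case
        unfolding H_def using bnd[of R c b] bnd[of "-R" b c] R cb
        by (intro order_trans[OF norm_triangle_ineq]) (auto simp: n)
    qed
    show "((\<lambda>R. 2 * (\<bar>C\<bar> * exp (- R) * \<bar>b - c\<bar>)) \<longlongrightarrow> 0) at_top"
      by (intro tendsto_mult_right_zero tendsto_mult_left_zero filterlim_compose[OF exp_at_bot] filterlim_uminus_at_bot_at_top)
  qed
  have "((\<lambda>R. integral {-R..R} FL - integral {-R..R} FV + H R) \<longlongrightarrow> (\<integral>t. FL t \<partial>lborel) - (\<integral>t. FV t \<partial>lborel) + 0) at_top"
    by (intro tendsto_intros integral_symmetric_limit iFL iFV Hlim)
  moreover have "((\<lambda>R. integral {-R..R} FL - integral {-R..R} FV + H R) \<longlongrightarrow> RS) at_top"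
    by (rule tendsto_eventually[OF key])
  ultimately have "(\<integral>t. FL t \<partial>lborel) - (\<integral>t. FV t \<partial>lborel) + 0 = RS"
    using tendsto_unique trivial_limit_at_top_linorder by blast
  moreover have "(\<integral>t. FV t \<partial>lborel) = \<i> * (\<integral>t. Gamma (- Complex (real M + 1/2) t) * g (Complex (real M + 1/2) t) \<partial>lborel)"
    unfolding FV_def G_def b_def by (subst integral_mult_left_zero) (simp add: mult.commute)
  ultimately have "(\<integral>t. FL t \<partial>lborel) = (\<integral>u. res_weight M u * g (res_node M u) \<partial>lborel)"
    using has_bochner_integral_integral_eq[OF res_integral[OF line]] by (simp add: RS_def algebra_simps)
  then show "(\<integral>t. Gamma (- L t) * L' t * g (L t) \<partial>lborel) = (\<integral>u. res_weight M u * g (res_node M u) \<partial>lborel)"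
    by (simp add: FL_def G_def mult_ac)
qed

end

section \<open>Absolute convergence of the trivariate integral\<close>

lemma measurable_rGamma [measurable]: "(rGamma :: complex \<Rightarrow> complex) \<in> borel_measurable borel"
  by (intro borel_measurable_continuous_onI continuous_intros)

lemma measurable_Gamma [measurable]: "(Gamma :: complex \<Rightarrow> complex) \<in> borel_measurable borel"
  unfolding Gamma_def[abs_def] by measurable

lemma measurable_powr_complex [measurable]: "(\<lambda>s. of_real y powr s :: complex) \<in> borel_measurable borel"
  unfolding powr_def by measurable

definition vray :: "real \<Rightarrow> real \<Rightarrow> complex set" where
  "vray c T = {z. Re z = c \<and> T \<le> \<bar>Im z\<bar>}"

lemma closed_vray: "closed (vray c T)"
  unfolding vray_def Collect_conj_eq
  by (intro closed_Int closed_Collect_eq closed_Collect_le continuous_intros)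

text \<open>One tail taken high up and the other low down reach every height, so the gaps of the two
  sets disappear in the sum.\<close>

lemma vray_plus_vray: "vray c T + vray c' T' = {z. Re z = c + c'}"
proof (intro equalityI subsetI)
  fix z assume "z \<in> {z. Re z = c + c'}"
  define \<tau> where "\<tau> = \<bar>T\<bar> + \<bar>T'\<bar> + \<bar>Im z\<bar>"
  have "Complex c \<tau> \<in> vray c T" "Complex c' (Im z - \<tau>) \<in> vray c' T'"
    by (auto simp: vray_def \<tau>_def)
  moreover have "z = Complex c \<tau> + Complex c' (Im z - \<tau>)"
    using \<open>z \<in> _\<close> by (simp add: complex_eq_iff)
  ultimately show "z \<in> vray c T + vray c' T'" by (metis set_plus_intro)
qed (auto simp: vray_def set_plus_def)

lemma closed_compact_plus:
  fixes A B :: "complex set"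
  assumes "compact A" "closed B"
  shows "closed (A + B)"
proof -
  have "A + B = (\<Union>x\<in>A. \<Union>y\<in>B. {x + y})" by (auto simp: set_plus_def)
  then show ?thesis using compact_closed_sums[OF assms] by simp
qed

lemma compact_plus:
  fixes A B :: "complex set"
  assumes "compact A" "compact B"
  shows "compact (A + B)"
proof -
  have "A + B = {x + y | x y. x \<in> A \<and> y \<in> B}" by (auto simp: set_plus_def)
  then show ?thesis using compact_sums[OF assms] by simp
qed

lemma set_plus_Un:
  "(A \<union> B) + C = (A + C) \<union> (B + C)" "C + (A \<union> B) = (C + A) \<union> (C + B :: 'a::plus set)"
  by (auto simp: set_plus_def)

text \<open>A contour with weight \<open>\<Gamma>(-s) ds\<close> and its residue form are both treated as a parametrisation \<open>S\<close> with weight \<open>W\<close>,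
  integrating \<open>g\<close> to \<open>\<integral>W(u) g(S(u)) du\<close>.\<close>

definition node_system :: "(real \<Rightarrow> complex) \<Rightarrow> (real \<Rightarrow> complex) \<Rightarrow> bool" where
  "node_system S W \<longleftrightarrow> S \<in> borel_measurable borel \<and> W \<in> borel_measurable borel
     \<and> (\<exists>K c T. compact K \<and> range S = K \<union> vray c T)
     \<and> (\<exists>B. \<forall>u. norm (S u - Complex 0 u) \<le> B)
     \<and> (\<exists>C. \<forall>u. norm (W u) \<le> C * exp (- (14/10 * \<bar>u\<bar>)))"

lemma closed_range_node_system:
  assumes "node_system S W"
  shows "closed (range S)"
  using assms closed_vray unfolding node_system_def by (metis closed_Un compact_imp_closed)

text \<open>Sums of closed sets need not be closed. Here each range is a compact set plus vertical
  tails, compact plus closed is closed, and two tails add up to a full line.\<close>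

lemma closed_range_plus:
  assumes "node_system S0 W0" "node_system S1 W1" "node_system S2 W2"
  shows "closed (range S0 + (range S1 + range S2))"
proof -
  obtain K0 c0 T0 where 0: "compact K0" "range S0 = K0 \<union> vray c0 T0" using assms(1) by (auto simp: node_system_def)
  obtain K1 c1 T1 where 1: "compact K1" "range S1 = K1 \<union> vray c1 T1" using assms(2) by (auto simp: node_system_def)
  obtain K2 c2 T2 where 2: "compact K2" "range S2 = K2 \<union> vray c2 T2" using assms(3) by (auto simp: node_system_def)
  let ?v0 = "vray c0 T0" and ?v1 = "vray c1 T1" and ?v2 = "vray c2 T2"
  have v: "vray c T + vray c' T' = vray (c + c') 0" for c T c' T'
    by (simp add: vray_plus_vray) (simp add: vray_def)
  have cv: "closed (K + vray c T)" "closed (vray c T + K)" if "compact K" for K c T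
    using that closed_compact_plus[OF that closed_vray] by (simp_all add: add.commute)
  have "closed (K0 + (K1 + K2))" "closed (?v0 + (K1 + K2))"
    by (intro compact_imp_closed compact_plus cv 0 1 2)+
  moreover have "closed (K0 + (K1 + ?v2))" "closed (K0 + (?v1 + K2))"
    by (intro closed_compact_plus[OF 0(1)] cv 1 2)+
  moreover have "closed (K0 + (?v1 + ?v2))"
    unfolding v by (intro cv 0)
  moreover have "closed (?v0 + (K1 + ?v2))"
    using cv(1)[OF 1(1), of "c0 + c2" 0] v[of c0 T0 c2 T2] by (metis add.left_commute)
  moreover have "closed (?v0 + (?v1 + K2))"
    using cv(2)[OF 2(1), of "c0 + c1" 0] v[of c0 T0 c1 T1] by (metis add.assoc)
  moreover have "closed (?v0 + (?v1 + ?v2))"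
    unfolding v by (rule closed_vray)
  ultimately show ?thesis
    unfolding 0 1 2 set_plus_Un by (intro closed_Un)
qed

lemma node_system_Re_Im:
  assumes "node_system S W"
  obtains B where "B > 0" "\<And>u. \<bar>Re (S u)\<bar> \<le> B" "\<And>u. \<bar>Im (S u)\<bar> \<le> \<bar>u\<bar> + B" "\<And>u. \<bar>u\<bar> \<le> \<bar>Im (S u)\<bar> + B"
proof -
  obtain B where B: "\<And>u. norm (S u - Complex 0 u) \<le> B" using assms by (auto simp: node_system_def)
  have a: "\<bar>Re (S u)\<bar> \<le> B" "\<bar>Im (S u) - u\<bar> \<le> B" for u
    using abs_Re_le_cmod[of "S u - Complex 0 u"] abs_Im_le_cmod[of "S u - Complex 0 u"] B[of u] by auto
  show ?thesis
  proof
    show "\<bar>B\<bar> + 1 > 0" by simp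
    fix u
    show "\<bar>Re (S u)\<bar> \<le> \<bar>B\<bar> + 1" "\<bar>Im (S u)\<bar> \<le> \<bar>u\<bar> + (\<bar>B\<bar> + 1)" "\<bar>u\<bar> \<le> \<bar>Im (S u)\<bar> + (\<bar>B\<bar> + 1)"
      using a[of u] by linarith+
  qed
qed

lemma norm_powr_le:
  assumes "y > 0" "\<bar>Re s\<bar> \<le> B"
  shows "norm (of_real y powr s) \<le> exp (B * \<bar>ln y\<bar>)"
proof -
  have "norm (of_real y powr s) = exp (Re s * ln y)"
    using assms by (simp add: norm_powr_real_powr powr_def)
  also have "\<dots> \<le> exp (B * \<bar>ln y\<bar>)"
  proof -
    have "\<bar>Re s * ln y\<bar> \<le> B * \<bar>ln y\<bar>"
      unfolding abs_mult using assms(2) by (intro mult_right_mono) auto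
    then show ?thesis by simp
  qed
  finally show ?thesis .
qed

text \<open>The weight and the Gamma factor each decay at rate 14/10, which gives 28/10; the power
  of \<open>y\<close> is bounded because the nodes stay in a vertical strip.\<close>

lemma node_factor_bound:
  assumes "node_system S W" and \<alpha>: "\<And>u. of_real \<alpha> + S u \<notin> \<int>\<^sub>\<le>\<^sub>0" and y: "y > 0"
  shows "\<exists>C\<ge>0. \<forall>u. norm (W u * (Gamma (of_real \<alpha> + S u) * of_real y powr S u)) \<le> C * exp (- (28/10 * \<bar>u\<bar>))"
proof -
  obtain B where B: "B > 0" "\<And>u. \<bar>Re (S u)\<bar> \<le> B" "\<And>u. \<bar>u\<bar> \<le> \<bar>Im (S u)\<bar> + B"
    using node_system_Re_Im[OF assms(1)] by metis
  obtain CW where CW: "\<And>u. norm (W u) \<le> CW * exp (- (14/10 * \<bar>u\<bar>))" using assms(1) by (auto simp: node_system_def)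
  define X where "X = (\<lambda>z. of_real \<alpha> + z) ` range S"
  have "closed X" unfolding X_def
    using closed_range_node_system[OF assms(1)] by (rule closed_translation)
  moreover have "\<bar>Re z\<bar> \<le> \<bar>\<alpha>\<bar> + B" if "z \<in> X" for z
    using that B(2) by (auto simp: X_def intro!: order_trans[OF abs_triangle_ineq])
  moreover have "X \<inter> \<int>\<^sub>\<le>\<^sub>0 = {}" using \<alpha> by (auto simp: X_def)
  ultimately obtain C where C: "C > 0" "\<And>z. z \<in> X \<Longrightarrow> norm (Gamma z) \<le> C * exp (- (14/10 * \<bar>Im z\<bar>))"
    using Gamma_closed_bound by metis
  have CW0: "CW \<ge> 0" using order_trans[OF norm_ge_zero CW[of 0]] by simp
  define D where "D = CW * ((C * exp (14/10 * B)) * exp (B * \<bar>ln y\<bar>))"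
  have "norm (W u * (Gamma (of_real \<alpha> + S u) * of_real y powr S u)) \<le> D * exp (- (28/10 * \<bar>u\<bar>))" for u
  proof -
    have "norm (Gamma (of_real \<alpha> + S u)) \<le> C * exp (- (14/10 * \<bar>Im (S u)\<bar>))"
      using C(2)[of "of_real \<alpha> + S u"] by (simp add: X_def)
    also have "\<dots> \<le> C * (exp (14/10 * B) * exp (- (14/10 * \<bar>u\<bar>)))"
      using B(3)[of u] C(1) by (intro mult_left_mono) (auto simp: exp_add[symmetric])
    finally have "norm (W u * (Gamma (of_real \<alpha> + S u) * of_real y powr S u))
       \<le> (CW * exp (- (14/10 * \<bar>u\<bar>))) * ((C * (exp (14/10 * B) * exp (- (14/10 * \<bar>u\<bar>)))) * exp (B * \<bar>ln y\<bar>))"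
      unfolding norm_mult using CW CW0 C(1) y B(2)
      by (intro mult_mono norm_powr_le mult_nonneg_nonneg) auto
    also have "\<dots> = D * (exp (- (14/10 * \<bar>u\<bar>)) * exp (- (14/10 * \<bar>u\<bar>)))"
      by (simp only: D_def mult_ac)
    also have "\<dots> = D * exp (- (28/10 * \<bar>u\<bar>))" by (simp add: exp_add[symmetric])
    finally show ?thesis .
  qed
  moreover have "D \<ge> 0" using CW0 C(1) by (auto simp: D_def)
  ultimately show ?thesis by blast
qed

abbreviation "lborel3 \<equiv> PiM {..<3::nat} (\<lambda>_. lborel :: real measure)"

lemma integrable_exp_abs_prod: "integrable lborel3 (\<lambda>t. exp (- \<bar>t 0\<bar>) * exp (- \<bar>t 1\<bar>) * exp (- \<bar>t 2\<bar>) :: real)"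
proof -
  interpret product_sigma_finite "\<lambda>_::nat. lborel :: real measure" ..
  have "integrable lborel3 (\<lambda>t. \<Prod>i\<in>{..<3}. exp (- \<bar>t i\<bar>) :: real)"
    by (intro product_integrable_prod integrable_exp_abs) auto
  moreover have "{..<3::nat} = {0,1,2}" by auto
  ultimately show ?thesis by (simp add: mult.assoc)
qed

text \<open>The integrand of the trivariate H-function without the factors \<open>\<Gamma>(-s\<^sub>i)\<close>, which belong to the weights;
  \<open>core0\<close> also omits the joint factor \<open>\<Gamma>(2 + s0 + s1 + s2)\<close>.\<close>

locale fox_params =
  fixes mE mB y1 y2 y3 :: real
  assumes m_pos: "0 < mE" "0 < mB" and m_nint: "mE \<notin> \<int>" "mB \<notin> \<int>"
    and y_pos: "0 < y1" "0 < y2" "0 < y3"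
begin

lemma one_minus_nint: "1 - mE \<notin> \<int>" "1 - mB \<notin> \<int>"
  using m_nint by (metis Ints_1 Ints_diff diff_diff_eq2 add_diff_cancel_left')+

definition core0 :: "complex \<Rightarrow> complex \<Rightarrow> complex \<Rightarrow> complex" where
  "core0 s0 s1 s2 = rGamma (2 + s0 + s1) * rGamma (1 + s2)
     * (Gamma (of_real (1 - mE) + s0) * of_real y1 powr s0)
     * (Gamma (of_real mE + s1) * of_real y2 powr s1)
     * (Gamma (of_real (1 - mB) + s2) * of_real y3 powr s2)"

definition core :: "complex \<Rightarrow> complex \<Rightarrow> complex \<Rightarrow> complex" where
  "core s0 s1 s2 = Gamma (2 + s0 + s1 + s2) * core0 s0 s1 s2"

text \<open>All that absolute convergence requires is that no Gamma factor of \<open>core\<close>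
  meets a pole on the nodes. The three slots are independent, so contours and residue forms can be
  mixed while the variables are replaced one at a time.\<close>

definition admissible_nodes ::
  "(real \<Rightarrow> complex) \<Rightarrow> (real \<Rightarrow> complex) \<Rightarrow> (real \<Rightarrow> complex) \<Rightarrow> (real \<Rightarrow> complex) \<Rightarrow> (real \<Rightarrow> complex) \<Rightarrow> (real \<Rightarrow> complex) \<Rightarrow> bool" where
  "admissible_nodes S0 W0 S1 W1 S2 W2 \<longleftrightarrow> node_system S0 W0 \<and> node_system S1 W1 \<and> node_system S2 W2
     \<and> (\<forall>u. of_real (1 - mE) + S0 u \<notin> \<int>\<^sub>\<le>\<^sub>0) \<and> (\<forall>u. of_real mE + S1 u \<notin> \<int>\<^sub>\<le>\<^sub>0) \<and> (\<forall>u. of_real (1 - mB) + S2 u \<notin> \<int>\<^sub>\<le>\<^sub>0)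
     \<and> (\<forall>u v w. 2 + S0 u + S1 v + S2 w \<notin> \<int>\<^sub>\<le>\<^sub>0)"

text \<open>Each of the three variables occurs in exactly one reciprocal Gamma factor and so loses
  17/10 only once, leaving 28/10 - 17/10 = 11/10.\<close>

lemma core0_bound:
  assumes "admissible_nodes S0 W0 S1 W1 S2 W2"
  shows "\<exists>C\<ge>0. \<forall>u v w. norm (W0 u * W1 v * W2 w * core0 (S0 u) (S1 v) (S2 w)) \<le> C * (exp (- \<bar>u\<bar>) * exp (- \<bar>v\<bar>) * exp (- \<bar>w\<bar>))"
proof -
  note A = assms[unfolded admissible_nodes_def]
  obtain C0 where C0: "C0 \<ge> 0" "\<And>u. norm (W0 u * (Gamma (of_real (1 - mE) + S0 u) * of_real y1 powr S0 u)) \<le> C0 * exp (- (28/10 * \<bar>u\<bar>))"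
    using node_factor_bound[of S0 W0 "1 - mE" y1] A y_pos by blast
  obtain C1 where C1: "C1 \<ge> 0" "\<And>u. norm (W1 u * (Gamma (of_real mE + S1 u) * of_real y2 powr S1 u)) \<le> C1 * exp (- (28/10 * \<bar>u\<bar>))"
    using node_factor_bound[of S1 W1 "mE" y2] A y_pos by blast
  obtain C2 where C2: "C2 \<ge> 0" "\<And>u. norm (W2 u * (Gamma (of_real (1 - mB) + S2 u) * of_real y3 powr S2 u)) \<le> C2 * exp (- (28/10 * \<bar>u\<bar>))"
    using node_factor_bound[of S2 W2 "1 - mB" y3] A y_pos by blast
  obtain B0 where B0: "B0 > 0" "\<And>u. \<bar>Re (S0 u)\<bar> \<le> B0" "\<And>u. \<bar>Im (S0 u)\<bar> \<le> \<bar>u\<bar> + B0"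
    using node_system_Re_Im A by metis
  obtain B1 where B1: "B1 > 0" "\<And>u. \<bar>Re (S1 u)\<bar> \<le> B1" "\<And>u. \<bar>Im (S1 u)\<bar> \<le> \<bar>u\<bar> + B1"
    using node_system_Re_Im A by metis
  obtain B2 where B2: "B2 > 0" "\<And>u. \<bar>Re (S2 u)\<bar> \<le> B2" "\<And>u. \<bar>Im (S2 u)\<bar> \<le> \<bar>u\<bar> + B2"
    using node_system_Re_Im A by metis
  define B where "B = 2 + B0 + B1 + B2"
  obtain Cr where Cr: "Cr > 0" "\<And>z. \<bar>Re z\<bar> \<le> B \<Longrightarrow> norm (rGamma z) \<le> Cr * exp (17/10 * \<bar>Im z\<bar>)"
    using rGamma_strip_bound[of B] by auto
  define K where "K = (Cr * exp (17/10 * B)) * (Cr * exp (17/10 * B)) * C0 * C1 * C2"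
  have "norm (W0 u * W1 v * W2 w * core0 (S0 u) (S1 v) (S2 w)) \<le> K * (exp (- \<bar>u\<bar>) * exp (- \<bar>v\<bar>) * exp (- \<bar>w\<bar>))" for u v w
  proof -
    have "norm (rGamma (2 + S0 u + S1 v)) \<le> Cr * exp (17/10 * \<bar>Im (2 + S0 u + S1 v)\<bar>)"
      using B0(2)[of u] B1(2)[of v] B0(1) B1(1) B2(1) by (intro Cr(2)) (auto simp: B_def abs_le_iff)
    also have "\<dots> \<le> Cr * exp (17/10 * (\<bar>u\<bar> + \<bar>v\<bar> + B))"
    proof -
      have "\<bar>Im (2 + S0 u + S1 v)\<bar> \<le> \<bar>u\<bar> + \<bar>v\<bar> + B"
        using B0(3)[of u] B1(3)[of v] B2(1) abs_triangle_ineq[of "Im (S0 u)" "Im (S1 v)"] by (simp add: B_def)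
      then show ?thesis using Cr(1) by (intro mult_left_mono) auto
    qed
    finally have r1: "norm (rGamma (2 + S0 u + S1 v)) \<le> (Cr * exp (17/10 * B)) * (exp (17/10 * \<bar>u\<bar>) * exp (17/10 * \<bar>v\<bar>))"
      by (simp add: exp_add[symmetric] ring_distribs mult.assoc add_ac)
    have "norm (rGamma (1 + S2 w)) \<le> Cr * exp (17/10 * \<bar>Im (1 + S2 w)\<bar>)"
      using B2(2)[of w] B0(1) B1(1) by (intro Cr(2)) (auto simp: B_def abs_le_iff)
    also have "\<dots> \<le> Cr * exp (17/10 * (\<bar>w\<bar> + B))"
      using B2(3)[of w] Cr(1) B0(1) B1(1) by (intro mult_left_mono) (auto simp: B_def)
    finally have r2: "norm (rGamma (1 + S2 w)) \<le> (Cr * exp (17/10 * B)) * exp (17/10 * \<bar>w\<bar>)"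
      by (simp add: exp_add[symmetric] ring_distribs mult.assoc add_ac)
    have "W0 u * W1 v * W2 w * core0 (S0 u) (S1 v) (S2 w)
      = rGamma (2 + S0 u + S1 v) * rGamma (1 + S2 w)
        * (W0 u * (Gamma (of_real (1 - mE) + S0 u) * of_real y1 powr S0 u))
        * (W1 v * (Gamma (of_real mE + S1 v) * of_real y2 powr S1 v))
        * (W2 w * (Gamma (of_real (1 - mB) + S2 w) * of_real y3 powr S2 w))"
      unfolding core0_def by (simp only: mult_ac)
    also have "norm \<dots> \<le> ((Cr * exp (17/10 * B)) * (exp (17/10 * \<bar>u\<bar>) * exp (17/10 * \<bar>v\<bar>))) * ((Cr * exp (17/10 * B)) * exp (17/10 * \<bar>w\<bar>))
        * (C0 * exp (- (28/10 * \<bar>u\<bar>))) * (C1 * exp (- (28/10 * \<bar>v\<bar>))) * (C2 * exp (- (28/10 * \<bar>w\<bar>)))"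
      unfolding norm_mult[of _ "W2 w * _"] norm_mult[of _ "W1 v * _"] norm_mult[of _ "W0 u * _"] norm_mult[of "rGamma _"]
      using Cr(1) C0(1) C1(1) C2(1)
      by (intro mult_mono r1 r2 C0(2) C1(2) C2(2) mult_nonneg_nonneg) auto
    also have "\<dots> = K * ((exp (17/10 * \<bar>u\<bar>) * exp (- (28/10 * \<bar>u\<bar>))) * (exp (17/10 * \<bar>v\<bar>) * exp (- (28/10 * \<bar>v\<bar>)))
         * (exp (17/10 * \<bar>w\<bar>) * exp (- (28/10 * \<bar>w\<bar>))))"
      unfolding K_def by (simp only: mult_ac)
    also have "\<dots> \<le> K * (exp (- \<bar>u\<bar>) * exp (- \<bar>v\<bar>) * exp (- \<bar>w\<bar>))"
    proof -
      have "exp (17/10 * \<bar>u\<bar>) * exp (- (28/10 * \<bar>u\<bar>)) \<le> exp (- \<bar>u\<bar>)" for u :: real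
        by (simp add: exp_add[symmetric])
      moreover have "K \<ge> 0" using Cr(1) C0(1) C1(1) C2(1) by (simp add: K_def)
      ultimately show ?thesis by (intro mult_left_mono mult_mono) auto
    qed
    finally show ?thesis .
  qed
  moreover have "K \<ge> 0" using Cr(1) C0(1) C1(1) C2(1) by (simp add: K_def)
  ultimately show ?thesis by blast
qed

text \<open>The argument runs through a closed subset of a strip that misses the poles. Its decay is
  discarded: boundedness suffices, since \<open>core0\<close> already carries the integrable
  majorant.\<close>

lemma joint_Gamma_bound:
  assumes "admissible_nodes S0 W0 S1 W1 S2 W2"
  shows "\<exists>C\<ge>0. \<forall>u v w. norm (Gamma (2 + S0 u + S1 v + S2 w)) \<le> C"
proof -
  note A = assms[unfolded admissible_nodes_def]
  define X where "X = (\<lambda>z. 2 + z) ` (range S0 + (range S1 + range S2))"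
  have "closed X" unfolding X_def
    using A by (intro closed_translation closed_range_plus) auto
  obtain B0 where B0: "\<And>u. \<bar>Re (S0 u)\<bar> \<le> B0" using node_system_Re_Im A by metis
  obtain B1 where B1: "\<And>u. \<bar>Re (S1 u)\<bar> \<le> B1" using node_system_Re_Im A by metis
  obtain B2 where B2: "\<And>u. \<bar>Re (S2 u)\<bar> \<le> B2" using node_system_Re_Im A by metis
  have X: "\<exists>u v w. z = 2 + S0 u + S1 v + S2 w" if z: "z \<in> X" for z
  proof -
    obtain a b where "z = 2 + (a + b)" "a \<in> range S0" "b \<in> range S1 + range S2"
      using z by (auto simp: X_def elim: set_plus_elim)
    moreover then obtain b' c where "b = b' + c" "b' \<in> range S1" "c \<in> range S2"
      by (auto elim: set_plus_elim)
    ultimately show ?thesis by (auto simp: add.assoc)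
  qed
  have "\<bar>Re z\<bar> \<le> 2 + B0 + B1 + B2" if z: "z \<in> X" for z
  proof -
    obtain u v w where "z = 2 + S0 u + S1 v + S2 w" using X[OF z] by auto
    then show ?thesis using B0[of u] B1[of v] B2[of w] by auto
  qed
  moreover have "X \<inter> \<int>\<^sub>\<le>\<^sub>0 = {}" using A X by blast
  ultimately obtain C where C: "C > 0" "\<And>z. z \<in> X \<Longrightarrow> norm (Gamma z) \<le> C * exp (- (14/10 * \<bar>Im z\<bar>))"
    using Gamma_closed_bound \<open>closed X\<close> by metis
  have "norm (Gamma (2 + S0 u + S1 v + S2 w)) \<le> C" for u v w
  proof -
    have "2 + S0 u + S1 v + S2 w \<in> X"
      unfolding X_def by (intro image_eqI[of _ _ "S0 u + (S1 v + S2 w)"] set_plus_intro) (auto simp: add.assoc)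
    from C(2)[OF this] show ?thesis
      by (rule order_trans) (use C(1) in \<open>simp add: mult_le_cancel_left1\<close>)
  qed
  then show ?thesis using C(1) by (intro exI[of _ C]) auto
qed

definition node_integrand where
  "node_integrand S0 W0 S1 W1 S2 W2 t = W0 (t 0) * W1 (t 1) * W2 (t 2) * core (S0 (t 0)) (S1 (t 1)) (S2 (t (2::nat)))"

lemma measurable_node_functions:
  assumes "S0 \<in> borel_measurable borel" "S1 \<in> borel_measurable borel" "S2 \<in> borel_measurable borel"
    "W0 \<in> borel_measurable borel" "W1 \<in> borel_measurable borel" "W2 \<in> borel_measurable borel"
  shows "(\<lambda>t. W0 (t 0) * W1 (t 1) * W2 (t 2) * core0 (S0 (t 0)) (S1 (t 1)) (S2 (t 2))) \<in> borel_measurable lborel3"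
    "node_integrand S0 W0 S1 W1 S2 W2 \<in> borel_measurable lborel3"
proof -
  note [measurable] = assms
  have [measurable]: "(\<lambda>t. t i) \<in> borel_measurable lborel3" if "i < 3" for i
    using that measurable_component_singleton[of i "{..<3::nat}" "\<lambda>_. lborel"] by simp
  have [measurable]: "(\<lambda>t. t 0) \<in> borel_measurable lborel3"
    "(\<lambda>t. t (Suc 0)) \<in> borel_measurable lborel3"
    "(\<lambda>t. t 2) \<in> borel_measurable lborel3" by auto
  show "(\<lambda>t. W0 (t 0) * W1 (t 1) * W2 (t 2) * core0 (S0 (t 0)) (S1 (t 1)) (S2 (t 2))) \<in> borel_measurable lborel3"
    "node_integrand S0 W0 S1 W1 S2 W2 \<in> borel_measurable lborel3"
    unfolding node_integrand_def core_def core0_def One_nat_def by measurable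
qed

lemma core0_integrable:
  assumes "admissible_nodes S0 W0 S1 W1 S2 W2"
  shows "integrable lborel3
     (\<lambda>t. W0 (t 0) * W1 (t 1) * W2 (t 2) * core0 (S0 (t 0)) (S1 (t 1)) (S2 (t 2)))"
proof -
  obtain C where C: "C \<ge> 0" "\<And>u v w. norm (W0 u * W1 v * W2 w * core0 (S0 u) (S1 v) (S2 w)) \<le> C * (exp (- \<bar>u\<bar>) * exp (- \<bar>v\<bar>) * exp (- \<bar>w\<bar>))"
    using core0_bound[OF assms] by auto
  show ?thesis
  proof (rule Bochner_Integration.integrable_bound)
    show "integrable lborel3 (\<lambda>t. C * (exp (- \<bar>t 0\<bar>) * exp (- \<bar>t 1\<bar>) * exp (- \<bar>t 2\<bar>)) :: real)"
      using integrable_exp_abs_prod by (rule integrable_mult_right)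
    show "(\<lambda>t. W0 (t 0) * W1 (t 1) * W2 (t 2) * core0 (S0 (t 0)) (S1 (t 1)) (S2 (t 2))) \<in> borel_measurable lborel3"
      using assms by (intro measurable_node_functions) (auto simp: admissible_nodes_def node_system_def)
    show "AE t in lborel3. norm (W0 (t 0) * W1 (t 1) * W2 (t 2) * core0 (S0 (t 0)) (S1 (t 1)) (S2 (t 2)))
        \<le> norm (C * (exp (- \<bar>t 0\<bar>) * exp (- \<bar>t 1\<bar>) * exp (- \<bar>t 2\<bar>)))"
      by (intro AE_I2 order_trans[OF C(2)]) simp
  qed
qed

lemma node_integrable:
  assumes "admissible_nodes S0 W0 S1 W1 S2 W2"
  shows "integrable lborel3 (node_integrand S0 W0 S1 W1 S2 W2)"
proof -
  obtain C where C: "C \<ge> 0" "\<And>u v w. norm (W0 u * W1 v * W2 w * core0 (S0 u) (S1 v) (S2 w)) \<le> C * (exp (- \<bar>u\<bar>) * exp (- \<bar>v\<bar>) * exp (- \<bar>w\<bar>))"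
    using core0_bound[OF assms] by auto
  obtain D where D: "D \<ge> 0" "\<And>u v w. norm (Gamma (2 + S0 u + S1 v + S2 w)) \<le> D"
    using joint_Gamma_bound[OF assms] by auto
  show ?thesis
  proof (rule Bochner_Integration.integrable_bound)
    show "integrable lborel3 (\<lambda>t. D * C * (exp (- \<bar>t 0\<bar>) * exp (- \<bar>t 1\<bar>) * exp (- \<bar>t 2\<bar>)) :: real)"
      using integrable_exp_abs_prod by (rule integrable_mult_right)
    show "node_integrand S0 W0 S1 W1 S2 W2 \<in> borel_measurable lborel3"
      using assms by (intro measurable_node_functions) (auto simp: admissible_nodes_def node_system_def)
    show "AE t in lborel3. norm (node_integrand S0 W0 S1 W1 S2 W2 t)
        \<le> norm (D * C * (exp (- \<bar>t 0\<bar>) * exp (- \<bar>t 1\<bar>) * exp (- \<bar>t 2\<bar>)))"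
    proof (rule AE_I2)
      fix t :: "nat \<Rightarrow> real"
      have "norm (node_integrand S0 W0 S1 W1 S2 W2 t) = norm (Gamma (2 + S0 (t 0) + S1 (t 1) + S2 (t 2)))
         * norm (W0 (t 0) * W1 (t 1) * W2 (t 2) * core0 (S0 (t 0)) (S1 (t 1)) (S2 (t 2)))"
        by (simp add: node_integrand_def core_def norm_mult)
      also have "\<dots> \<le> D * (C * (exp (- \<bar>t 0\<bar>) * exp (- \<bar>t 1\<bar>) * exp (- \<bar>t 2\<bar>)))"
        using D(1) by (intro mult_mono C D) auto
      finally show "norm (node_integrand S0 W0 S1 W1 S2 W2 t) \<le> norm (D * C * (exp (- \<bar>t 0\<bar>) * exp (- \<bar>t 1\<bar>) * exp (- \<bar>t 2\<bar>)))"
        using C(1) D(1) by (simp add: mult.assoc)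
    qed
  qed
qed

end

text \<open>By Fubini the coordinate \<open>i\<close> is integrated first; absolute integrability of
  both sides reduces the change of a contour to one-variable slices.\<close>

lemma PiM_integral_replace:
  fixes f f' :: "(nat \<Rightarrow> real) \<Rightarrow> complex"
  assumes "finite I" "i \<in> I" "integrable (PiM I (\<lambda>_. lborel)) f" "integrable (PiM I (\<lambda>_. lborel)) f'"
    and "\<And>t. (\<integral>y. f (t(i := y)) \<partial>lborel) = (\<integral>y. f' (t(i := y)) \<partial>lborel)"
  shows "(\<integral>t. f t \<partial>PiM I (\<lambda>_. lborel)) = (\<integral>t. f' t \<partial>PiM I (\<lambda>_. lborel))"
proof -
  interpret product_sigma_finite "\<lambda>_::nat. lborel :: real measure" ..
  have I: "insert i (I - {i}) = I" using assms(2) by auto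
  have eq: "(\<integral>t. h t \<partial>PiM I (\<lambda>_. lborel)) = (\<integral>t. (\<integral>y. h (t(i := y)) \<partial>lborel) \<partial>PiM (I - {i}) (\<lambda>_. lborel))"
    if "integrable (PiM I (\<lambda>_. lborel)) h" for h :: "(nat \<Rightarrow> real) \<Rightarrow> complex"
    using product_integral_insert[of "I - {i}" i h, unfolded I] assms(1) that by simp
  show ?thesis
    unfolding eq[OF assms(3)] eq[OF assms(4)] assms(5) ..
qed

section \<open>Residue forms and contours as node systems\<close>

lemma range_res_node: "range (res_node M) = of_nat ` {..M} \<union> vray (real M + 1/2) 0"
proof (intro equalityI subsetI)
  fix z assume "z \<in> range (res_node M)"
  then obtain u where u: "z = res_node M u" by auto
  show "z \<in> of_nat ` {..M} \<union> vray (real M + 1/2) 0"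
  proof (cases "0 \<le> u \<and> u < real M + 1")
    case True
    then have "nat \<lfloor>u\<rfloor> \<le> M" by linarith
    moreover have "z = of_nat (nat \<lfloor>u\<rfloor>)" using True u by (simp add: res_node_def)
    ultimately show ?thesis by blast
  next
    case False
    then show ?thesis using u by (auto simp: res_node_def vray_def)
  qed
next
  fix z assume "z \<in> of_nat ` {..M} \<union> vray (real M + 1/2) 0"
  then show "z \<in> range (res_node M)"
  proof
    assume "z \<in> of_nat ` {..M}"
    then obtain n where n: "z = of_nat n" "n \<le> M" by auto
    then have "z = res_node M (real n)" by (simp add: res_node_def)
    then show ?thesis by (rule range_eqI)
  next
    assume z: "z \<in> vray (real M + 1/2) 0"
    then have "z = res_node M (if Im z < 0 then Im z else Im z + real M + 1)"
      by (auto simp: res_node_def vray_def complex_eq_iff)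
    then show ?thesis by (rule range_eqI)
  qed
qed

lemma res_node_cases:
  obtains n where "n \<le> M" "res_node M u = of_nat n" | "Re (res_node M u) = real M + 1/2"
proof -
  have "res_node M u \<in> of_nat ` {..M} \<union> vray (real M + 1/2) 0"
    using range_res_node[of M] by blast
  then show ?thesis using that by (auto simp: vray_def)
qed

lemma Re_res_node_nonneg: "0 \<le> Re (res_node M u)"
  by (cases rule: res_node_cases[of M u]) auto

lemma measurable_res [measurable]: "res_node M \<in> borel_measurable borel" "res_weight M \<in> borel_measurable borel"
proof -
  show [measurable]: "res_node M \<in> borel_measurable borel"
    unfolding res_node_def Complex_eq by measurable
  show "res_weight M \<in> borel_measurable borel"
    unfolding res_weight_def by measurable
qed

lemma node_system_res: "node_system (res_node M) (res_weight M)"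
  unfolding node_system_def
proof (intro conjI measurable_res)
  show "\<exists>K c T. compact K \<and> range (res_node M) = K \<union> vray c T"
    using range_res_node[of M] by (intro exI[of _ "of_nat ` {..M}"] exI conjI) (auto intro: finite_imp_compact)
  have "norm (res_node M u - Complex 0 u) \<le> 2 * real M + 2" for u
  proof -
    have "norm (res_node M u - Complex 0 u) \<le> \<bar>Re (res_node M u)\<bar> + \<bar>Im (res_node M u) - u\<bar>"
      using cmod_le[of "res_node M u - Complex 0 u"] by simp
    moreover have "\<bar>Im (res_node M u) - u\<bar> \<le> real M + 1"
      by (auto simp: res_node_def)
    moreover have "\<bar>Re (res_node M u)\<bar> \<le> real M + 1"
      by (cases rule: res_node_cases[of M u]) auto
    ultimately show ?thesis by linarith
  qed
  then show "\<exists>B. \<forall>u. norm (res_node M u - Complex 0 u) \<le> B" by blast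
  define X where "X = {z::complex. Re z = - (real M + 1/2)}"
  have "closed X" unfolding X_def by (intro closed_Collect_eq continuous_intros)
  moreover have "X \<inter> \<int>\<^sub>\<le>\<^sub>0 = {}"
  proof (rule ccontr)
    assume "X \<inter> \<int>\<^sub>\<le>\<^sub>0 \<noteq> {}"
    then obtain n :: nat where "- real n = - (real M + 1/2)" by (auto simp: X_def elim!: nonpos_Ints_cases')
    then have "real (2 * M + 1) = real (2 * n)" by simp
    then have "2 * M + 1 = 2 * n" by (simp only: of_nat_eq_iff)
    then show False by presburger
  qed
  ultimately obtain C where C: "C > 0" "\<And>z. z \<in> X \<Longrightarrow> norm (Gamma z) \<le> C * exp (- (14/10 * \<bar>Im z\<bar>))"
    using Gamma_closed_bound[of X "real M + 1/2"] by (auto simp: X_def)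
  define D where "D = (C + 2 * pi) * exp (14/10 * (real M + 1))"
  have "norm (res_weight M u) \<le> D * exp (- (14/10 * \<bar>u\<bar>))" for u
  proof (cases "0 \<le> u \<and> u < real M + 1")
    case True
    have "norm (res_weight M u) = 2 * pi / fact (nat \<lfloor>u\<rfloor>)"
      using True by (simp add: res_weight_def norm_mult norm_divide norm_power)
    also have "\<dots> \<le> 2 * pi / 1" by (intro divide_left_mono fact_ge_1) auto
    also have "\<dots> \<le> (C + 2 * pi) * (exp (14/10 * (real M + 1)) * exp (- (14/10 * \<bar>u\<bar>)))"
    proof -
      have "1 \<le> exp (14/10 * (real M + 1)) * exp (- (14/10 * \<bar>u\<bar>))"
        using True by (simp add: exp_add[symmetric])
      then have "2 * pi * 1 \<le> (C + 2 * pi) * (exp (14/10 * (real M + 1)) * exp (- (14/10 * \<bar>u\<bar>)))"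
        using C(1) by (intro mult_mono) auto
      then show ?thesis by simp
    qed
    finally show ?thesis by (simp add: D_def mult.assoc)
  next
    case False
    have i: "\<bar>u\<bar> \<le> \<bar>Im (res_node M u)\<bar> + (real M + 1)" by (auto simp: res_node_def)
    have "norm (res_weight M u) = norm (Gamma (- res_node M u))"
      using False by (auto simp: res_weight_def norm_mult)
    also have "\<dots> \<le> C * exp (- (14/10 * \<bar>Im (- res_node M u)\<bar>))"
      using False by (intro C(2)) (auto simp: X_def res_node_def)
    also have "\<dots> \<le> (C + 2 * pi) * (exp (14/10 * (real M + 1)) * exp (- (14/10 * \<bar>u\<bar>)))"
    proof (intro mult_mono)
      show "exp (- (14/10 * \<bar>Im (- res_node M u)\<bar>)) \<le> exp (14/10 * (real M + 1)) * exp (- (14/10 * \<bar>u\<bar>))"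
        unfolding exp_add[symmetric] exp_le_cancel_iff using i by (simp add: field_simps)
    qed (use C(1) in auto)
    finally show ?thesis by (simp add: D_def mult.assoc)
  qed
  then show "\<exists>C. \<forall>u. norm (res_weight M u) \<le> C * exp (- (14/10 * \<bar>u\<bar>))" by blast
qed

context mb_contour
begin

text \<open>All natural numbers lie right of \<open>L\<close>, so \<open>- L t\<close> keeps off the
  poles of \<Gamma> and supplies the decay; the derivative is bounded since it equals
  \<open>\<i>\<close> on the tails.\<close>

lemma node_system_contour:
  assumes right: "\<And>n::nat. MB_right_of L (of_nat n)"
  shows "node_system L (\<lambda>t. Gamma (- L t) * L' t)"
  unfolding node_system_def
proof (intro conjI)
  have [measurable]: "L \<in> borel_measurable borel" "L' \<in> borel_measurable borel"
    by (intro borel_measurable_continuous_onI continuous continuous_deriv)+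
  show "L \<in> borel_measurable borel" by measurable
  show "(\<lambda>t. Gamma (- L t) * L' t) \<in> borel_measurable borel" by measurable
  show "\<exists>K c T. compact K \<and> range L = K \<union> vray c T"
    using compact_middle range_eq unfolding vray_def by blast
  show "\<exists>B. \<forall>u. norm (L u - Complex 0 u) \<le> B" using bounded_offset by blast
  obtain B where B: "B > 0" "\<And>t. norm (L t - Complex 0 t) \<le> B" using bounded_offset by auto
  have off: "\<bar>Re (L t)\<bar> \<le> B" "\<bar>t\<bar> \<le> \<bar>Im (L t)\<bar> + B" for t
    using abs_Re_le_cmod[of "L t - Complex 0 t"] abs_Im_le_cmod[of "L t - Complex 0 t"] B(2)[of t] by auto
  define X where "X = uminus ` range L"
  have "closed X" unfolding X_def by (rule closed_negations[OF closed_range])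
  moreover have "\<bar>Re z\<bar> \<le> B" if "z \<in> X" for z using that off by (auto simp: X_def)
  moreover have "X \<inter> \<int>\<^sub>\<le>\<^sub>0 = {}"
  proof (rule ccontr)
    assume "X \<inter> \<int>\<^sub>\<le>\<^sub>0 \<noteq> {}"
    then obtain t and n :: nat where "of_nat n = L t" by (auto simp: X_def elim!: nonpos_Ints_cases')
    then have "of_nat n \<in> range L" by (rule range_eqI)
    then show False using right_winding(1)[OF right] by blast
  qed
  ultimately obtain C where C: "C > 0" "\<And>z. z \<in> X \<Longrightarrow> norm (Gamma z) \<le> C * exp (- (14/10 * \<bar>Im z\<bar>))"
    using Gamma_closed_bound by metis
  have "bounded (L' ` {-T-1..T+1})"
    by (intro compact_imp_bounded compact_continuous_image continuous_on_subset[OF continuous_deriv]) auto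
  then obtain D where D: "\<And>t. t \<in> {-T-1..T+1} \<Longrightarrow> norm (L' t) \<le> D"
    unfolding bounded_iff by blast
  have D': "norm (L' t) \<le> \<bar>D\<bar> + 1" for t
  proof (cases "T < \<bar>t\<bar>")
    case True
    then show ?thesis using deriv_tail by simp
  next
    case False
    then have "t \<in> {-T-1..T+1}" by auto
    from D[OF this] show ?thesis by linarith
  qed
  have "norm (Gamma (- L t) * L' t) \<le> (C * exp (14/10 * B)) * (\<bar>D\<bar> + 1) * exp (- (14/10 * \<bar>t\<bar>))" for t
  proof -
    have "norm (Gamma (- L t)) \<le> C * exp (- (14/10 * \<bar>Im (- L t)\<bar>))" by (rule C(2)) (auto simp: X_def)
    also have "\<dots> \<le> C * (exp (14/10 * B) * exp (- (14/10 * \<bar>t\<bar>)))"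
      using off(2)[of t] C(1) by (intro mult_left_mono) (auto simp: exp_add[symmetric])
    finally have "norm (Gamma (- L t) * L' t) \<le> (C * (exp (14/10 * B) * exp (- (14/10 * \<bar>t\<bar>)))) * (\<bar>D\<bar> + 1)"
      unfolding norm_mult using C(1) D' by (intro mult_mono) auto
    then show ?thesis by (simp only: mult_ac)
  qed
  then show "\<exists>C. \<forall>u. norm (Gamma (- L u) * L' u) \<le> C * exp (- (14/10 * \<bar>u\<bar>))" by blast
qed

text \<open>Two progressions of poles lie on the left: those of the variable's own Gamma factor,
  with real \<alpha>, and those of \<open>h\<close>, with complex \<beta>, which will be 2 plus the
  two frozen variables. The rates -14/10 - 14/10 + 17/10 give the decay that the residue theorem
  needs.\<close>

lemma meijer_deformation:
  assumes right: "\<And>n::nat. MB_right_of L (of_nat n)"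
    and left_\<alpha>: "\<And>k::nat. MB_left_of L (- of_real \<alpha> - of_nat k)"
    and left_\<beta>: "\<And>k::nat. MB_left_of L (- \<beta> - of_nat k)"
    and h: "h holomorphic_on - range (\<lambda>k::nat. - \<beta> - of_nat k)"
    and growth: "\<And>B. \<exists>C U. \<forall>s. \<bar>Re s\<bar> \<le> B \<longrightarrow> U \<le> \<bar>Im s\<bar> \<longrightarrow> norm (h s) \<le> C * exp (17/10 * \<bar>Im s\<bar>)"
    and M: "- \<alpha> < real M + 1/2" "- Re \<beta> < real M + 1/2" "\<And>t. Re (L t) < real M + 1/2"
  shows "integrable lborel (\<lambda>t. Gamma (- Complex (real M + 1/2) t) * (Gamma (of_real \<alpha> + Complex (real M + 1/2) t) * h (Complex (real M + 1/2) t)))"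
    "(\<integral>t. Gamma (- L t) * L' t * (Gamma (of_real \<alpha> + L t) * h (L t)) \<partial>lborel)
      = (\<integral>u. res_weight M u * (Gamma (of_real \<alpha> + res_node M u) * h (res_node M u)) \<partial>lborel)"
proof -
  define P where "P = range (\<lambda>k::nat. - of_real \<alpha> - of_nat k) \<union> range (\<lambda>k::nat. - \<beta> - of_nat k)"
  let ?g = "\<lambda>s. Gamma (of_real \<alpha> + s) * h s"
  have cl: "closed (range (\<lambda>k::nat. a - of_nat k))" for a :: complex
  proof -
    have "range (\<lambda>k::nat. a - of_nat k) = (\<lambda>z. a + z) ` uminus ` range (of_nat :: nat \<Rightarrow> complex)"
      by (auto simp: image_image)
    moreover have "closed (range (of_nat :: nat \<Rightarrow> complex))" using closed_of_nat_image[of UNIV] by simp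
    ultimately show ?thesis by (simp only: closed_translation closed_negations)
  qed
  have fin: "finite {p \<in> range (\<lambda>k::nat. a - of_nat k). A \<le> Re p}" for a :: complex and A
  proof (rule finite_subset)
    show "{p \<in> range (\<lambda>k::nat. a - of_nat k). A \<le> Re p} \<subseteq> (\<lambda>k::nat. a - of_nat k) ` {..nat \<lceil>Re a - A\<rceil>}"
    proof safe
      fix k :: nat assume "A \<le> Re (a - of_nat k)"
      then have "k \<le> nat \<lceil>Re a - A\<rceil>" by simp linarith
      then show "a - of_nat k \<in> (\<lambda>k::nat. a - of_nat k) ` {..nat \<lceil>Re a - A\<rceil>}" by auto
    qed
  qed simp
  have 1: "MB_left_of L p" if "p \<in> P" for p using that left_\<alpha> left_\<beta> by (auto simp: P_def)
  have 2: "finite {p\<in>P. A \<le> Re p}" for A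
    using fin[of "- of_real \<alpha>" A] fin[of "- \<beta>" A] by (simp add: P_def Un_iff conj_disj_distribR)
  have 3: "closed P" unfolding P_def by (intro closed_Un cl)
  have 4: "?g holomorphic_on - P"
  proof (intro holomorphic_intros holomorphic_on_subset[OF h])
    fix s assume s: "s \<in> - P"
    show "of_real \<alpha> + s \<notin> \<int>\<^sub>\<le>\<^sub>0"
    proof
      assume "of_real \<alpha> + s \<in> \<int>\<^sub>\<le>\<^sub>0"
      then obtain n :: nat where "of_real \<alpha> + s = - of_nat n" by (auto elim!: nonpos_Ints_cases')
      then have "s = - of_real \<alpha> - of_nat n" by (simp add: algebra_simps eq_neg_iff_add_eq_0)
      then show False using s by (auto simp: P_def)
    qed
  qed (auto simp: P_def)
  have 5: "\<exists>C U. \<forall>s. \<bar>Re s\<bar> \<le> B \<longrightarrow> U \<le> \<bar>Im s\<bar> \<longrightarrow> norm (Gamma (- s) * ?g s) \<le> C * exp (- \<bar>Im s\<bar>)" for B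
  proof -
    obtain C1 where C1: "C1 > 0" "\<And>z. \<bar>Re z\<bar> \<le> B + \<bar>\<alpha>\<bar> \<Longrightarrow> \<bar>Im z\<bar> \<ge> 1/2 \<Longrightarrow> norm (Gamma z) \<le> C1 * exp (- (14/10 * \<bar>Im z\<bar>))"
      using Gamma_strip_bound[of "B + \<bar>\<alpha>\<bar>"] by auto
    obtain C2 U where C2: "\<And>s. \<bar>Re s\<bar> \<le> B \<Longrightarrow> U \<le> \<bar>Im s\<bar> \<Longrightarrow> norm (h s) \<le> C2 * exp (17/10 * \<bar>Im s\<bar>)"
      using growth[of B] by auto
    have "norm (Gamma (- s) * ?g s) \<le> (C1 * (C1 * \<bar>C2\<bar>)) * exp (- \<bar>Im s\<bar>)" if s: "\<bar>Re s\<bar> \<le> B" "max U (1/2) \<le> \<bar>Im s\<bar>" for s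
    proof -
      have a: "norm (Gamma (- s)) \<le> C1 * exp (- (14/10 * \<bar>Im s\<bar>))" using C1(2)[of "-s"] s by auto
      have b: "norm (Gamma (of_real \<alpha> + s)) \<le> C1 * exp (- (14/10 * \<bar>Im s\<bar>))"
        using C1(2)[of "of_real \<alpha> + s"] s by auto
      have "norm (h s) \<le> C2 * exp (17/10 * \<bar>Im s\<bar>)" using C2 s by auto
      also have "\<dots> \<le> \<bar>C2\<bar> * exp (17/10 * \<bar>Im s\<bar>)" by (intro mult_right_mono) auto
      finally have c: "norm (h s) \<le> \<bar>C2\<bar> * exp (17/10 * \<bar>Im s\<bar>)" .
      have "norm (Gamma (- s) * ?g s) \<le> (C1 * exp (- (14/10 * \<bar>Im s\<bar>))) * ((C1 * exp (- (14/10 * \<bar>Im s\<bar>))) * (\<bar>C2\<bar> * exp (17/10 * \<bar>Im s\<bar>)))"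
        unfolding norm_mult using C1(1) by (intro mult_mono a b c) auto
      also have "\<dots> = (C1 * (C1 * \<bar>C2\<bar>)) * (exp (- (14/10 * \<bar>Im s\<bar>)) * (exp (- (14/10 * \<bar>Im s\<bar>)) * exp (17/10 * \<bar>Im s\<bar>)))"
        by (simp only: mult_ac)
      also have "\<dots> \<le> (C1 * (C1 * \<bar>C2\<bar>)) * exp (- \<bar>Im s\<bar>)"
        using C1(1) by (intro mult_left_mono) (auto simp: exp_add[symmetric])
      finally show ?thesis .
    qed
    then show ?thesis by blast
  qed
  have 6: "Re p < real M + 1/2" if "p \<in> P" for p using that M(1,2) by (auto simp: P_def)
  show "integrable lborel (\<lambda>t. Gamma (- Complex (real M + 1/2) t) * ?g (Complex (real M + 1/2) t))"
    "(\<integral>t. Gamma (- L t) * L' t * ?g (L t) \<partial>lborel) = (\<integral>u. res_weight M u * ?g (res_node M u) \<partial>lborel)"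
    using contour_deformation[OF right 1 2 3 4 5 6 M(3)] by auto
qed

end

section \<open>Growth and holomorphy of the one-variable slices\<close>

lemma growth_rGamma_powr:
  assumes "y > 0"
  shows "\<exists>C>0. \<forall>s. \<bar>Re s\<bar> \<le> B \<longrightarrow> norm (rGamma (\<gamma> + s) * of_real y powr s) \<le> C * exp (17/10 * \<bar>Im s\<bar>)"
proof -
  obtain C where C: "C > 0" "\<And>z. \<bar>Re z\<bar> \<le> B + \<bar>Re \<gamma>\<bar> \<Longrightarrow> norm (rGamma z) \<le> C * exp (17/10 * \<bar>Im z\<bar>)"
    using rGamma_strip_bound[of "B + \<bar>Re \<gamma>\<bar>"] by auto
  have "norm (rGamma (\<gamma> + s) * of_real y powr s) \<le> (C * exp (17/10 * \<bar>Im \<gamma>\<bar>) * exp (B * \<bar>ln y\<bar>)) * exp (17/10 * \<bar>Im s\<bar>)"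
    if s: "\<bar>Re s\<bar> \<le> B" for s
  proof -
    have "norm (rGamma (\<gamma> + s)) \<le> C * exp (17/10 * \<bar>Im (\<gamma> + s)\<bar>)" using s by (intro C(2)) auto
    also have "\<dots> \<le> C * (exp (17/10 * \<bar>Im \<gamma>\<bar>) * exp (17/10 * \<bar>Im s\<bar>))"
      using C(1) abs_triangle_ineq[of "Im \<gamma>" "Im s"] by (intro mult_left_mono) (auto simp: exp_add[symmetric])
    finally have "norm (rGamma (\<gamma> + s) * of_real y powr s) \<le> (C * (exp (17/10 * \<bar>Im \<gamma>\<bar>) * exp (17/10 * \<bar>Im s\<bar>))) * exp (B * \<bar>ln y\<bar>)"
      unfolding norm_mult using C(1) s assms by (intro mult_mono norm_powr_le) auto
    then show ?thesis by (simp only: mult_ac)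
  qed
  then show ?thesis using C(1) by (intro exI[of _ "C * exp (17/10 * \<bar>Im \<gamma>\<bar>) * exp (B * \<bar>ln y\<bar>)"]) auto
qed

lemma growth_Gamma_rGamma_powr:
  assumes "y > 0"
  shows "\<exists>C U. \<forall>s. \<bar>Re s\<bar> \<le> B \<longrightarrow> U \<le> \<bar>Im s\<bar> \<longrightarrow> norm (Gamma (\<beta> + s) * (rGamma (\<gamma> + s) * of_real y powr s)) \<le> C * exp (17/10 * \<bar>Im s\<bar>)"
proof -
  obtain C where C: "C > 0" "\<And>s. \<bar>Re s\<bar> \<le> B \<Longrightarrow> norm (rGamma (\<gamma> + s) * of_real y powr s) \<le> C * exp (17/10 * \<bar>Im s\<bar>)"
    using growth_rGamma_powr[OF assms] by blast
  obtain D where D: "D > 0" "\<And>z. \<bar>Re z\<bar> \<le> B + \<bar>Re \<beta>\<bar> \<Longrightarrow> \<bar>Im z\<bar> \<ge> 1/2 \<Longrightarrow> norm (Gamma z) \<le> D * exp (- (14/10 * \<bar>Im z\<bar>))"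
    using Gamma_strip_bound[of "B + \<bar>Re \<beta>\<bar>"] by auto
  have "norm (Gamma (\<beta> + s) * (rGamma (\<gamma> + s) * of_real y powr s)) \<le> (D * C) * exp (17/10 * \<bar>Im s\<bar>)"
    if s: "\<bar>Re s\<bar> \<le> B" "\<bar>Im \<beta>\<bar> + 1 \<le> \<bar>Im s\<bar>" for s
  proof -
    have "norm (Gamma (\<beta> + s)) \<le> D * exp (- (14/10 * \<bar>Im (\<beta> + s)\<bar>))"
      using s abs_triangle_ineq[of "Im \<beta> + Im s" "- Im \<beta>"] by (intro D(2)) auto
    also have "\<dots> \<le> D * 1" using D(1) by (intro mult_left_mono) auto
    finally have "norm (Gamma (\<beta> + s) * (rGamma (\<gamma> + s) * of_real y powr s)) \<le> D * (C * exp (17/10 * \<bar>Im s\<bar>))"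
      unfolding norm_mult[of "Gamma _"] using D(1) s by (intro mult_mono C(2)) auto
    then show ?thesis by (simp only: mult_ac)
  qed
  then show ?thesis by blast
qed

lemma holomorphic_Gamma_rGamma_powr:
  "(\<lambda>s. Gamma (\<beta> + s) * (rGamma (\<gamma> + s) * of_real y powr s)) holomorphic_on - range (\<lambda>k::nat. - \<beta> - of_nat k)"
proof (intro holomorphic_intros)
  fix s assume s: "s \<in> - range (\<lambda>k::nat. - \<beta> - of_nat k)"
  show "\<beta> + s \<notin> \<int>\<^sub>\<le>\<^sub>0"
  proof
    assume "\<beta> + s \<in> \<int>\<^sub>\<le>\<^sub>0"
    then obtain n :: nat where "\<beta> + s = - of_nat n" by (auto elim!: nonpos_Ints_cases')
    then have "s = - \<beta> - of_nat n" by (simp add: algebra_simps eq_neg_iff_add_eq_0)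
    then show False using s by auto
  qed
qed

section \<open>Replacing the three contours\<close>

text \<open>Non-integral \<alpha> takes care of the nodes n; on the vertical line the sum has
  positive real part.\<close>

lemma res_node_avoids:
  assumes "\<alpha> \<notin> \<int>" "- \<alpha> < real M + 1/2"
  shows "of_real \<alpha> + res_node M u \<notin> \<int>\<^sub>\<le>\<^sub>0"
proof
  assume "of_real \<alpha> + res_node M u \<in> \<int>\<^sub>\<le>\<^sub>0"
  then obtain k :: nat where k: "of_real \<alpha> + res_node M u = - of_nat k" by (auto elim!: nonpos_Ints_cases')
  then have r: "\<alpha> + Re (res_node M u) = - real k" by (simp add: complex_eq_iff)
  show False
  proof (cases rule: res_node_cases[of M u])
    case (1 n)
    then have "\<alpha> = - of_nat (k + n)" using r by simp
    then show False using assms(1) by simp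
  next
    case 2
    then show False using r assms(2) by simp
  qed
qed

lemma left_imp_avoids:
  assumes "mb_contour L c T" "\<And>k::nat. MB_left_of L (- \<beta> - of_nat k)"
  shows "\<beta> + L t \<notin> \<int>\<^sub>\<le>\<^sub>0"
proof
  interpret mb_contour L c T by fact
  assume "\<beta> + L t \<in> \<int>\<^sub>\<le>\<^sub>0"
  then obtain k :: nat where "\<beta> + L t = - of_nat k" by (auto elim!: nonpos_Ints_cases')
  then have "L t = - \<beta> - of_nat k" by (simp add: algebra_simps eq_neg_iff_add_eq_0)
  then show False using left_winding(1)[OF assms(2)[of k]] by (metis rangeI)
qed

text \<open>The common shape of the three replacements: \<kappa> gathers every factor free of the
  current variable, and \<gamma> is the shift in the reciprocal Gamma factor that contains
  it.\<close>

lemma slot_deformation: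
  assumes "mb_contour L c T" and right: "\<And>n::nat. MB_right_of L (of_nat n)"
    and "\<And>k::nat. MB_left_of L (- of_real \<alpha> - of_nat k)" "\<And>k::nat. MB_left_of L (- \<beta> - of_nat k)"
    and "- \<alpha> < real M + 1/2" "- Re \<beta> < real M + 1/2" "\<And>t. Re (L t) < real M + 1/2" and y: "y > 0"
    and f: "\<And>x. f x = \<kappa> * (Gamma (- L x) * vector_derivative L (at x) * (Gamma (of_real \<alpha> + L x) * (Gamma (\<beta> + L x) * (rGamma (\<gamma> + L x) * of_real y powr L x))))"
    and f': "\<And>x. f' x = \<kappa> * (res_weight M x * (Gamma (of_real \<alpha> + res_node M x) * (Gamma (\<beta> + res_node M x) * (rGamma (\<gamma> + res_node M x) * of_real y powr res_node M x))))"
  shows "(\<integral>x. f x \<partial>lborel) = (\<integral>x. f' x \<partial>lborel)"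
  unfolding f f' integral_mult_right_zero
  by (subst mb_contour.meijer_deformation(2)[OF assms(1-4) holomorphic_Gamma_rGamma_powr growth_Gamma_rGamma_powr[OF y] assms(5-7)])
     simp_all

context fox_params
begin

abbreviation "res_admissible M \<equiv> admissible_nodes (res_node M) (res_weight M) (res_node M) (res_weight M) (res_node M) (res_weight M)"
abbreviation "res_integrand M \<equiv> node_integrand (res_node M) (res_weight M) (res_node M) (res_weight M) (res_node M) (res_weight M)"

text \<open>The variables are replaced in the order 0, 1, 2. Each replacement presupposes that the
  joint poles lie left of the contour being moved, for all values of the other two variables; as
  these values change from contour points to nodes, the condition is re-established by reflecting
  the previous one.\<close>

lemma contour_to_residues:
  assumes L: "mb_contour L0 c0 T0" "mb_contour L1 c1 T1" "mb_contour L2 c2 T2"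
    and right: "\<And>n::nat. MB_right_of L0 (of_nat n)" "\<And>n::nat. MB_right_of L1 (of_nat n)" "\<And>n::nat. MB_right_of L2 (of_nat n)"
    and left0: "\<And>k::nat. MB_left_of L0 (- of_real (1 - mE) - of_nat k)"
    and left1: "\<And>k::nat. MB_left_of L1 (- of_real mE - of_nat k)"
    and left2: "\<And>k::nat. MB_left_of L2 (- of_real (1 - mB) - of_nat k)"
    and joint: "\<And>t t' (k::nat). MB_left_of L0 (- (2 + L1 t + L2 t') - of_nat k)"
    and B: "\<And>t. \<bar>Re (L0 t)\<bar> < B" "\<And>t. \<bar>Re (L1 t)\<bar> < B" "\<And>t. \<bar>Re (L2 t)\<bar> < B"
    and M: "real M \<ge> 2 * B" "real M \<ge> mE" "real M \<ge> mB"
  defines "W \<equiv> \<lambda>L t. Gamma (- L t) * vector_derivative L (at t)"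
  shows "admissible_nodes L0 (W L0) L1 (W L1) L2 (W L2)"
    and "res_admissible M"
    and "(\<integral>t. node_integrand L0 (W L0) L1 (W L1) L2 (W L2) t \<partial>lborel3)
     = (\<integral>t. res_integrand M t \<partial>lborel3)"
proof -
  let ?S = "res_node M" and ?R = "res_weight M"
  have Bp: "B > 0" using B(1)[of 0] by linarith
  have sys: "node_system L0 (W L0)" "node_system L1 (W L1)" "node_system L2 (W L2)" "node_system ?S ?R"
    unfolding W_def
    using mb_contour.node_system_contour[OF L(1) right(1)] mb_contour.node_system_contour[OF L(2) right(2)]
      mb_contour.node_system_contour[OF L(3) right(3)] node_system_res by auto
  \<comment> \<open>For a node n this is the condition on \<open>L0\<close> reflected at n, which
    lies right of \<open>L0\<close>. On the vertical line, M at least 2 B pushes the pole left of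
    all of \<open>L1\<close>.\<close>
  have joint1: "MB_left_of L1 (- (2 + ?S u + L2 t') - of_nat k)" for u t' and k :: nat
  proof (cases rule: res_node_cases[of M u])
    case (1 n)
    have "MB_left_of L1 ((- (2 + L2 t') - of_nat k) - of_nat n)"
    proof (rule MB_left_of_reflect[OF L(1) L(2) _ right(1)])
      fix t show "MB_left_of L0 (- (2 + L2 t') - of_nat k - L1 t)"
        using joint[of t t' k] by (simp only: diff_conv_add_uminus minus_add_distrib add_ac)
    qed
    then show ?thesis unfolding 1(2) by (simp only: diff_conv_add_uminus minus_add_distrib add_ac)
  next
    case 2
    show ?thesis
      by (rule MB_left_of_halfplane[of "- B"])
         (use B(2,3)[of t'] B(2) 2 M(1) Bp in \<open>auto simp: abs_less_iff minus_less_iff intro: less_imp_le\<close>)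
  qed
  \<comment> \<open>The same argument once more, now reflecting the condition just obtained for
    \<open>L1\<close>.\<close>
  have joint2: "MB_left_of L2 (- (2 + ?S u + ?S v) - of_nat k)" for u v and k :: nat
  proof (cases rule: res_node_cases[of M v])
    case (1 n)
    have "MB_left_of L2 ((- (2 + ?S u) - of_nat k) - of_nat n)"
    proof (rule MB_left_of_reflect[OF L(2) L(3) _ right(2)])
      fix t show "MB_left_of L1 (- (2 + ?S u) - of_nat k - L2 t)"
        using joint1[of u t k] by (simp only: diff_conv_add_uminus minus_add_distrib add_ac)
    qed
    then show ?thesis unfolding 1(2) by (simp only: diff_conv_add_uminus minus_add_distrib add_ac)
  next
    case 2
    show ?thesis
      by (rule MB_left_of_halfplane[of "- B"])
         (use B(3) 2 M(1) Bp Re_res_node_nonneg[of M u] in \<open>auto simp: abs_less_iff minus_less_iff intro: less_imp_le\<close>)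
  qed
  have av: "of_real (1 - mE) + L0 t \<notin> \<int>\<^sub>\<le>\<^sub>0" "of_real mE + L1 t \<notin> \<int>\<^sub>\<le>\<^sub>0" "of_real (1 - mB) + L2 t \<notin> \<int>\<^sub>\<le>\<^sub>0" for t
    by (rule left_imp_avoids[OF L(1) left0] left_imp_avoids[OF L(2) left1] left_imp_avoids[OF L(3) left2])+
  have avR: "of_real (1 - mE) + ?S t \<notin> \<int>\<^sub>\<le>\<^sub>0" "of_real mE + ?S t \<notin> \<int>\<^sub>\<le>\<^sub>0" "of_real (1 - mB) + ?S t \<notin> \<int>\<^sub>\<le>\<^sub>0" for t
    using one_minus_nint m_nint m_pos M by (intro res_node_avoids; simp)+
  have j0: "2 + L0 u + L1 v + L2 w \<notin> \<int>\<^sub>\<le>\<^sub>0" for u v w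
    using left_imp_avoids[OF L(1) joint, of v w u] by (simp add: add_ac)
  have j1: "2 + ?S u + L1 v + L2 w \<notin> \<int>\<^sub>\<le>\<^sub>0" for u v w
    using left_imp_avoids[OF L(2) joint1, of u w v] by (simp add: add_ac)
  have j2: "2 + ?S u + ?S v + L2 w \<notin> \<int>\<^sub>\<le>\<^sub>0" for u v w
    using left_imp_avoids[OF L(3) joint2, of u v w] by (simp add: add_ac)
  have j3: "2 + ?S u + ?S v + ?S w \<notin> \<int>\<^sub>\<le>\<^sub>0" for u v w
  proof
    assume "2 + ?S u + ?S v + ?S w \<in> \<int>\<^sub>\<le>\<^sub>0"
    then obtain k :: nat where "2 + ?S u + ?S v + ?S w = - of_nat k" by (auto elim!: nonpos_Ints_cases')
    then have "2 + Re (?S u) + Re (?S v) + Re (?S w) = - real k" by (simp add: complex_eq_iff)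
    then show False using Re_res_node_nonneg[of M u] Re_res_node_nonneg[of M v] Re_res_node_nonneg[of M w] by linarith
  qed
  \<comment> \<open>With none, one, two or three slots in residue form the nodes avoid all poles, so
    every intermediate triple integral converges absolutely.\<close>
  show A0: "admissible_nodes L0 (W L0) L1 (W L1) L2 (W L2)"
    unfolding admissible_nodes_def using sys av j0 by blast
  have A1: "admissible_nodes ?S ?R L1 (W L1) L2 (W L2)"
    unfolding admissible_nodes_def using sys av avR j1 by blast
  have A2: "admissible_nodes ?S ?R ?S ?R L2 (W L2)"
    unfolding admissible_nodes_def using sys av avR j2 by blast
  show A3: "admissible_nodes ?S ?R ?S ?R ?S ?R"
    unfolding admissible_nodes_def using sys avR j3 by blast
  have MB: "B < real M + 1/2" "2 * B < real M + 5/2" using M(1) Bp by auto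
  have ReL: "Re (L0 t) < real M + 1/2" "Re (L1 t) < real M + 1/2" "Re (L2 t) < real M + 1/2" for t
    using B(1)[of t] B(2)[of t] B(3)[of t] MB by linarith+
  have "(\<integral>t. node_integrand L0 (W L0) L1 (W L1) L2 (W L2) t \<partial>lborel3)
      = (\<integral>t. node_integrand ?S ?R L1 (W L1) L2 (W L2) t \<partial>lborel3)"
  proof (rule PiM_integral_replace[where i = 0, OF _ _ node_integrable[OF A0] node_integrable[OF A1]])
    fix t :: "nat \<Rightarrow> real"
    let ?s1 = "L1 (t 1)" and ?s2 = "L2 (t 2)"
    have "- Re (2 + ?s1 + ?s2) < real M + 1/2"
      using B(2)[of "t 1"] B(3)[of "t 2"] MB by (simp add: abs_less_iff)
    then show "(\<integral>x. node_integrand L0 (W L0) L1 (W L1) L2 (W L2) (t(0 := x)) \<partial>lborel)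
        = (\<integral>x. node_integrand ?S ?R L1 (W L1) L2 (W L2) (t(0 := x)) \<partial>lborel)"
      using m_pos M y_pos ReL
      by (intro slot_deformation[OF L(1) right(1) left0 joint[of "t 1" "t 2"], where M = M and y = y1 and \<gamma> = "2 + ?s1"
            and \<kappa> = "W L1 (t 1) * W L2 (t 2) * rGamma (1 + ?s2)
              * (Gamma (of_real mE + ?s1) * of_real y2 powr ?s1) * (Gamma (of_real (1 - mB) + ?s2) * of_real y3 powr ?s2)"])
         (simp_all add: node_integrand_def core_def core0_def W_def mult_ac add_ac)
  qed auto
  also have "\<dots> = (\<integral>t. node_integrand ?S ?R ?S ?R L2 (W L2) t \<partial>lborel3)"
  proof (rule PiM_integral_replace[where i = 1, OF _ _ node_integrable[OF A1] node_integrable[OF A2]])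
    fix t :: "nat \<Rightarrow> real"
    let ?s0 = "?S (t 0)" and ?s2 = "L2 (t 2)"
    have "- Re (2 + ?s0 + ?s2) < real M + 1/2"
      using B(3)[of "t 2"] MB Re_res_node_nonneg[of M "t 0"] by (simp add: abs_less_iff)
    then show "(\<integral>x. node_integrand ?S ?R L1 (W L1) L2 (W L2) (t(1 := x)) \<partial>lborel)
        = (\<integral>x. node_integrand ?S ?R ?S ?R L2 (W L2) (t(1 := x)) \<partial>lborel)"
      using m_pos M y_pos ReL
      by (intro slot_deformation[OF L(2) right(2) left1 joint1[of "t 0" "t 2"], where M = M and y = y2 and \<gamma> = "2 + ?s0"
            and \<kappa> = "?R (t 0) * W L2 (t 2) * rGamma (1 + ?s2)
              * (Gamma (of_real (1 - mE) + ?s0) * of_real y1 powr ?s0) * (Gamma (of_real (1 - mB) + ?s2) * of_real y3 powr ?s2)"])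
         (simp_all add: node_integrand_def core_def core0_def W_def mult_ac add_ac)
  qed auto
  also have "\<dots> = (\<integral>t. node_integrand ?S ?R ?S ?R ?S ?R t \<partial>lborel3)"
  proof (rule PiM_integral_replace[where i = 2, OF _ _ node_integrable[OF A2] node_integrable[OF A3]])
    fix t :: "nat \<Rightarrow> real"
    let ?s0 = "?S (t 0)" and ?s1 = "?S (t 1)"
    have "- Re (2 + ?s0 + ?s1) < real M + 1/2"
      using Re_res_node_nonneg[of M "t 0"] Re_res_node_nonneg[of M "t 1"] by simp
    then show "(\<integral>x. node_integrand ?S ?R ?S ?R L2 (W L2) (t(2 := x)) \<partial>lborel)
        = (\<integral>x. node_integrand ?S ?R ?S ?R ?S ?R (t(2 := x)) \<partial>lborel)"
      using m_pos M y_pos ReL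
      by (intro slot_deformation[OF L(3) right(3) left2 joint2[of "t 0" "t 1"], where M = M and y = y3 and \<gamma> = 1
            and \<kappa> = "?R (t 0) * ?R (t 1) * rGamma (2 + ?s0 + ?s1)
              * (Gamma (of_real (1 - mE) + ?s0) * of_real y1 powr ?s0) * (Gamma (of_real mE + ?s1) * of_real y2 powr ?s1)"])
         (simp_all add: node_integrand_def core_def core0_def W_def mult_ac add_ac)
  qed auto
  finally show "(\<integral>t. node_integrand L0 (W L0) L1 (W L1) L2 (W L2) t \<partial>lborel3)
     = (\<integral>t. node_integrand ?S ?R ?S ?R ?S ?R t \<partial>lborel3)" .
qed

end

section \<open>Existence of separating contours\<close>

text \<open>Supplies the C1 bump function. Since max(0,u)^2 = (u^2 + u |u|)/2, only
  differentiability of u |u| at 0 is at stake.\<close>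

lemma DERIV_max_0_power2: "((\<lambda>u::real. (max 0 u)\<^sup>2) has_real_derivative 2 * max 0 u) (at u)"
proof -
  have abs: "((\<lambda>u::real. u * \<bar>u\<bar>) has_real_derivative 2 * \<bar>u\<bar>) (at u)"
  proof (cases "u = 0")
    case True
    have "((\<lambda>h::real. \<bar>h\<bar>) \<longlongrightarrow> 0) (at 0)" by (rule tendsto_eq_rhs[OF tendsto_rabs[OF tendsto_ident_at]]) simp
    then have "((\<lambda>h::real. h * \<bar>h\<bar> / h) \<longlongrightarrow> 0) (at 0)"
      by (rule Lim_transform_eventually) (auto simp: eventually_at_filter)
    then show ?thesis using True by (simp add: DERIV_def)
  next
    case False
    then consider "u > 0" | "u < 0" by linarith
    then show ?thesis
    proof cases
      case 1
      have "((\<lambda>u::real. u * u) has_real_derivative 2 * \<bar>u\<bar>) (at u)"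
        using 1 by (auto intro!: derivative_eq_intros)
      then show ?thesis
        by (rule has_field_derivative_transform_within_open[of _ _ _ "{0<..}"]) (use 1 in auto)
    next
      case 2
      have "((\<lambda>u::real. - (u * u)) has_real_derivative 2 * \<bar>u\<bar>) (at u)"
        using 2 by (auto intro!: derivative_eq_intros)
      then show ?thesis
        by (rule has_field_derivative_transform_within_open[of _ _ _ "{..<0}"]) (use 2 in auto)
    qed
  qed
  have eq: "(\<lambda>u::real. (max 0 u)\<^sup>2) = (\<lambda>u. (u * u + u * \<bar>u\<bar>) / 2)"
    by (auto simp: max_def power2_eq_square)
  show ?thesis unfolding eq
    by (rule derivative_eq_intros abs | auto)+
qed

text \<open>In the sheared coordinates \<open>(Re z, Im z - h (Re z))\<close> the points to be kept on the left have second coordinate \<open>1\<close>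
  and those to be kept on the right have second coordinate \<open>-1\<close>; the contour is the graph \<open>Re z = g (Im z - h (Re z))\<close>
  of a bump function with support above \<open>-1\<close>.\<close>

lemma separating_contour_exists:
  assumes "\<alpha> \<notin> \<int>"
  shows "\<exists>L T. mb_contour L (-1/4) T \<and> (\<forall>n::nat. MB_right_of L (of_nat n))
     \<and> (\<forall>k::nat. MB_left_of L (- of_real \<alpha> - of_nat k)) \<and> (\<forall>t. -1/4 \<le> Re (L t))"
proof -
  \<comment> \<open>Negative, so that 0 lies to the right, and above -2/3, so that three contours
    with Re s at least \<open>c\<close> keep 2 + s1 + s2 + s3 in the right half-plane.\<close>
  define c :: real where "c = -1/4"
  define X where "X = \<bar>\<alpha>\<bar> + 1"
  define q where "q = 1 - cos (2 * pi * \<alpha>)"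
  have "cos (2 * pi * \<alpha>) \<noteq> 1"
  proof
    assume "cos (2 * pi * \<alpha>) = 1"
    then obtain n :: int where "2 * pi * \<alpha> = of_int n * 2 * pi" by (auto simp: cos_one_2pi_int)
    then show False using assms by simp
  qed
  then have q: "q > 0" using cos_le_one[of "2 * pi * \<alpha>"] by (simp add: q_def less_le)
  \<comment> \<open>A function of period 1 with value 1 at the integers and -1 at the translates of
    -\<alpha>; non-integral \<alpha> makes \<open>q\<close> non-zero.\<close>
  define h where "h x = 1 - 2 * (1 - cos (2 * pi * x)) / q" for x
  define h' where "h' x = - (4 * pi * sin (2 * pi * x)) / q" for x
  \<comment> \<open>Equal to \<open>c\<close> outside (0, 2), with peak \<open>X\<close> at v = 1;
    \<open>X\<close> exceeds all points to be kept on the left.\<close>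
  define g where "g v = c + (X - c) * (max 0 (1 - (v - 1)\<^sup>2))\<^sup>2" for v
  define g' where "g' v = (X - c) * (2 * max 0 (1 - (v - 1)\<^sup>2) * (- 2 * (v - 1)))" for v
  have h_n: "h (real n) = 1" for n :: nat
  proof -
    have "cos (2 * pi * real n) = 1" using cos_2npi[of n] by (simp only: mult_ac)
    then show ?thesis by (simp add: h_def)
  qed
  have h_\<alpha>: "h (- \<alpha> - real k) = - 1" for k :: nat
  proof -
    have "cos (2 * pi * (- \<alpha> - real k)) = cos (- (2 * pi * \<alpha>) - 2 * pi * real k)" by (simp add: algebra_simps)
    also have "\<dots> = cos (2 * pi * \<alpha>)"
    proof -
      have "cos (2 * pi * real k) = 1" "sin (2 * pi * real k) = 0"
        using cos_2npi[of k] sin_2npi[of k] by (simp_all only: mult_ac)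
      then show ?thesis by (simp add: cos_diff)
    qed
    finally show ?thesis using q unfolding h_def q_def[symmetric] by (simp add: q_def[symmetric])
  qed
  have dh: "(h has_real_derivative h' x) (at x)" for x
    unfolding h_def[abs_def] h'_def using q
    by (auto intro!: derivative_eq_intros simp: field_simps)
  have dg: "(g has_real_derivative g' v) (at v)" for v
  proof -
    have "((\<lambda>v. (max 0 (1 - (v - 1)\<^sup>2))\<^sup>2) has_real_derivative 2 * max 0 (1 - (v - 1)\<^sup>2) * (- 2 * (v - 1))) (at v)"
      by (rule DERIV_chain2[OF DERIV_max_0_power2]) (auto intro!: derivative_eq_intros)
    from DERIV_add[OF DERIV_const[of c] DERIV_cmult[OF this, of "X - c"]] show ?thesis
      unfolding g_def[abs_def] g'_def by simp
  qed
  have gc: "g v = c" if "v \<le> 0 \<or> v \<ge> 2" for v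
  proof -
    have "(v - 1)\<^sup>2 \<ge> 1" using that abs_le_square_iff[of 1 "v - 1"] by auto
    then show ?thesis by (simp add: g_def max_def)
  qed
  have Xc: "X > c" by (simp add: X_def c_def)
  have g_ge: "g v \<ge> c" for v using Xc by (simp add: g_def)
  have g_le: "g v \<le> X" for v
  proof -
    have "(max 0 (1 - (v - 1)\<^sup>2))\<^sup>2 \<le> 1\<^sup>2" by (intro power_mono) auto
    then have "(X - c) * (max 0 (1 - (v - 1)\<^sup>2))\<^sup>2 \<le> (X - c) * 1" using Xc by (intro mult_left_mono) auto
    then show ?thesis by (simp add: g_def)
  qed
  \<comment> \<open>Shifting the parameter by \<open>h c\<close> makes the imaginary part exactly
    \<open>t\<close> on the tails, where \<open>g\<close> is \<open>c\<close>.\<close>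
  define L where "L t = Complex (g (t - h c)) (t - h c + h (g (t - h c)))" for t
  define T where "T = \<bar>h c\<bar> + 3"
  have graph: "Re z = g (Im z - h (Re z))" if "z \<in> range L" for z
    using that by (auto simp: L_def)
  have ReL: "c \<le> Re (L t)" "Re (L t) \<le> X" for t by (auto simp: L_def g_ge g_le)
  have "mb_contour L c T"
  proof
    show "T > 0" by (simp add: T_def)
    show "L t = Complex c t" if "T \<le> \<bar>t\<bar>" for t
    proof -
      have "t - h c \<le> 0 \<or> t - h c \<ge> 2" using that by (auto simp: T_def abs_if split: if_splits)
      then show ?thesis by (simp add: L_def gc)
    qed
    have ch': "continuous_on UNIV h'" unfolding h'_def using q by (intro continuous_intros) auto
    have cg': "continuous_on UNIV g'" unfolding g'_def by (intro continuous_intros)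
    have cg: "continuous_on UNIV g" unfolding g_def by (intro continuous_intros)
    have d: "((\<lambda>t. g (t - h c)) has_real_derivative g' (t - h c)) (at t)" for t
      by (rule DERIV_chain2[OF dg, THEN DERIV_cong]) (auto intro!: derivative_eq_intros)
    have "((\<lambda>t. t - h c + h (g (t - h c))) has_real_derivative 1 + h' (g (t - h c)) * g' (t - h c)) (at t)" for t
      by (rule derivative_eq_intros DERIV_chain2[OF dh d] refl | simp)+
    then have "(L has_vector_derivative Complex (g' (t - h c)) (1 + h' (g (t - h c)) * g' (t - h c))) (at t)" for t
      unfolding has_vector_derivative_complex_iff L_def[abs_def] using d by simp
    moreover have "continuous_on UNIV (\<lambda>t. Complex (g' (t - h c)) (1 + h' (g (t - h c)) * g' (t - h c)))"
      unfolding Complex_eq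
      by (intro continuous_intros continuous_on_compose2[OF cg'] continuous_on_compose2[OF ch'] continuous_on_compose2[OF cg]) auto
    ultimately show "L C1_differentiable_on UNIV"
      unfolding C1_differentiable_on_def
      by (intro exI[of _ "\<lambda>t. Complex (g' (t - h c)) (1 + h' (g (t - h c)) * g' (t - h c))"] conjI ballI)
  qed
  moreover have "MB_right_of L (of_nat n)" for n :: nat
  proof -
    \<comment> \<open>An escape path to the right along second coordinate -1, where the contour has
      abscissa c < n.\<close>
    define p where "p r = Complex (real n + r) (- 1 + h (real n + r))" for r
    have "g (- 1) = c" by (rule gc) simp
    then have pL: "p r \<notin> range L" if "r \<ge> 0" for r
      using graph[of "p r"] that by (auto simp: p_def c_def)
    have conn: "connected (p ` {0..})"
      unfolding p_def Complex_eq h_def using q by (intro connected_continuous_image continuous_intros connected_Ici) auto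
    have far: "MB_right_of L (p (X + 1))"
      by (rule MB_right_of_halfplane[of _ X]) (auto simp: ReL p_def)
    have eq: "of_nat n = p 0" by (simp add: p_def h_n complex_eq_iff)
    have mem: "p 0 \<in> p ` {0..}" "p (X + 1) \<in> p ` {0..}"
      by (intro imageI; simp add: X_def)+
    have "p ` {0..} \<inter> range L = {}" using pL by blast
    from MB_right_of_connected[OF conn this mem far] show ?thesis unfolding eq .
  qed
  moreover have "MB_left_of L (- of_real \<alpha> - of_nat k)" for k :: nat
  proof -
    define x where "x = - \<alpha> - real k"
    \<comment> \<open>An escape path to the left along second coordinate 1, where the contour has
      abscissa \<open>X\<close>.\<close>
    define p where "p r = Complex (x - r) (1 + h (x - r))" for r
    have "g 1 = X" by (simp add: g_def)
    then have pL: "p r \<notin> range L" if "r \<ge> 0" for r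
      using graph[of "p r"] that by (auto simp: p_def X_def x_def)
    have conn: "connected (p ` {0..})"
      unfolding p_def Complex_eq h_def using q by (intro connected_continuous_image continuous_intros connected_Ici) auto
    have far: "MB_left_of L (p (\<bar>x\<bar> + 1))"
    proof (rule MB_left_of_halfplane[OF ReL(1)])
      show "Re (p (\<bar>x\<bar> + 1)) < c" by (simp add: p_def c_def)
    qed
    have eq: "- of_real \<alpha> - of_nat k = p 0" using h_\<alpha>[of k] by (simp add: p_def x_def complex_eq_iff)
    have mem: "p 0 \<in> p ` {0..}" "p (\<bar>x\<bar> + 1) \<in> p ` {0..}"
      by (intro imageI; simp add: X_def)+
    have "p ` {0..} \<inter> range L = {}" using pL by blast
    from MB_left_of_connected[OF conn this mem far] show ?thesis unfolding eq .
  qed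
  ultimately show ?thesis using ReL unfolding c_def by blast
qed

section \<open>The H-function in residue form\<close>

lemma MB_contour_imp_mb_contour:
  assumes "MB_contour L"
  obtains c T where "mb_contour L c T"
proof -
  obtain c T where "L C1_differentiable_on UNIV" "\<forall>t. T \<le> \<bar>t\<bar> \<longrightarrow> L t = Complex c t"
    using assms by (auto simp: MB_contour_def)
  then have "mb_contour L c (max T 1)" by unfold_locales auto
  then show ?thesis by (rule that)
qed

lemma (in mb_contour) MB_contour: "MB_contour L"
  unfolding MB_contour_def using C1 tail by blast

context fox_params
begin

abbreviation "fox_A \<equiv> [(-1, [1, 1, 1])] :: (real \<times> real list) list"
abbreviation "fox_B \<equiv> [(-1, [1, 1, 0]), (0, [0, 0, 1])] :: (real \<times> real list) list"
abbreviation "fox_V \<equiv> [(1, 1, [(mE, 1)], [(0, 1)]), (1, 1, [(1 - mE, 1)], [(0, 1)]), (1, 1, [(mB, 1)], [(0, 1)])]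
  :: (nat \<times> nat \<times> (real \<times> real) list \<times> (real \<times> real) list) list"
abbreviation "fox_x \<equiv> [of_real y1, of_real y2, of_real y3] :: complex list"

text \<open>The lower lists (0, 1) yield the factors \<Gamma>(-s), which join the derivatives of the
  contours in the weights; what remains is \<open>core\<close>.\<close>

lemma foxH_integrand_eq:
  "foxH_integrand 1 fox_A fox_B fox_V fox_x Ls
   = node_integrand (Ls 0) (\<lambda>t. Gamma (- Ls 0 t) * vector_derivative (Ls 0) (at t))
       (Ls 1) (\<lambda>t. Gamma (- Ls 1 t) * vector_derivative (Ls 1) (at t))
       (Ls 2) (\<lambda>t. Gamma (- Ls 2 t) * vector_derivative (Ls 2) (at t))"
proof
  fix t
  have l: "{..<3::nat} = {0, 1, 2}" "{..<2::nat} = {0, 1}" by auto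
  show "foxH_integrand 1 fox_A fox_B fox_V fox_x Ls t
   = node_integrand (Ls 0) (\<lambda>t. Gamma (- Ls 0 t) * vector_derivative (Ls 0) (at t))
       (Ls 1) (\<lambda>t. Gamma (- Ls 1 t) * vector_derivative (Ls 1) (at t))
       (Ls 2) (\<lambda>t. Gamma (- Ls 2 t) * vector_derivative (Ls 2) (at t)) t"
    by (simp add: foxH_integrand_def foxH_psi_def foxH_phi_def lin_comb_def node_integrand_def core_def core0_def
        l numeral_2_eq_2[symmetric] numeral_3_eq_3[symmetric] add.assoc mult_ac)
qed

lemma foxH_separates_iff:
  "foxH_separates 1 fox_A fox_V Ls \<longleftrightarrow>
     (\<forall>i<3. \<forall>k::nat. MB_right_of (Ls i) (of_nat k))
   \<and> (\<forall>k::nat. MB_left_of (Ls 0) (- of_real (1 - mE) - of_nat k))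
   \<and> (\<forall>k::nat. MB_left_of (Ls 1) (- of_real mE - of_nat k))
   \<and> (\<forall>k::nat. MB_left_of (Ls 2) (- of_real (1 - mB) - of_nat k))
   \<and> (\<forall>(t::nat \<Rightarrow> real) (k::nat). MB_left_of (Ls 0) (- (2 + Ls 1 (t 1) + Ls 2 (t 2)) - of_nat k))
   \<and> (\<forall>(t::nat \<Rightarrow> real) (k::nat). MB_left_of (Ls 1) (- (2 + Ls 0 (t 0) + Ls 2 (t 2)) - of_nat k))
   \<and> (\<forall>(t::nat \<Rightarrow> real) (k::nat). MB_left_of (Ls 2) (- (2 + Ls 0 (t 0) + Ls 1 (t 1)) - of_nat k))"
proof -
  have l: "{..<3::nat} - {0} = {1, 2}" "{..<3::nat} - {1} = {0, 2}" "{..<3::nat} - {2} = {0, 1}" by auto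
  have all: "(\<forall>i<3. Q i) \<longleftrightarrow> Q 0 \<and> Q 1 \<and> Q (2::nat)" for Q
    by (auto simp: eval_nat_numeral less_Suc_eq)
  have e1: "(mE - 1 - real k) / 1 = - (1 - mE) - real k" "(mB - 1 - real k) / 1 = - (1 - mB) - real k"
     "(1 - mE - 1 - real k) / 1 = - mE - real k" "(0 + real k) / 1 = real k" for k by simp_all
  have e2: "complex_of_real (- 1 - 1 - real k) - (1 * a + 1 * b) = - (2 + a + b) - of_nat k" for k a b
    by simp
  have len: "length fox_V = 3" by simp
  have nth: "fox_V ! 0 = (1, 1, [(mE, 1)], [(0, 1)])" "fox_V ! 1 = (1, 1, [(1 - mE, 1)], [(0, 1)])"
    "fox_V ! 2 = (1, 1, [(mB, 1)], [(0, 1)])" by simp_all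
  have n1: "(\<forall>j<1. Q j) \<longleftrightarrow> Q (0::nat)" for Q by auto
  have s: "(\<Sum>l\<in>{1,2}. f l) = f 1 + f 2" "(\<Sum>l\<in>{0,2}. f l) = f 0 + f 2" "(\<Sum>l\<in>{0,1}. f l) = f 0 + f 1" for f :: "nat \<Rightarrow> complex"
    by simp_all
  have nA: "fox_A ! 0 = (-1, [1, 1, 1])" "[1::real, 1, 1] ! 0 = 1" "[1::real, 1, 1] ! 1 = 1" "[1::real, 1, 1] ! 2 = 1"
    "[a] ! 0 = a" for a :: "real \<times> real" by simp_all
  show ?thesis
    unfolding foxH_separates_def len all nth n1 nA fst_conv snd_conv prod.case l s of_real_1 div_by_1 e1 e2
    by (simp add: e1 nA n1 of_real_diff) (simp only: diff_conv_add_uminus minus_add_distrib add_ac conj_ac)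
qed

text \<open>The choice operator in \<open>foxH\<close> only yields admissible contours if some
  exist, so a family is constructed. The chosen contours remain unknown, but any admissible family
  passes to the same residue form, with a bound on M that depends on the family.\<close>

lemma foxH_admissible_exists: "\<exists>Ls. foxH_admissible 1 fox_A fox_B fox_V fox_x Ls"
  and foxH_eq_residues: "\<exists>M0. \<forall>M\<ge>M0.
     res_admissible M \<and>
     foxH 1 fox_A fox_B fox_V fox_x
      = (\<integral>t. res_integrand M t
           \<partial>lborel3) / (2 * of_real pi * \<i>) ^ 3"
proof -
  let ?W = "\<lambda>L t. Gamma (- L t) * vector_derivative L (at t)"
  have to_res: "\<exists>M0. \<forall>M\<ge>M0. admissible_nodes (Ls 0) (?W (Ls 0)) (Ls 1) (?W (Ls 1)) (Ls 2) (?W (Ls 2))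
     \<and> res_admissible M
     \<and> (\<integral>t. node_integrand (Ls 0) (?W (Ls 0)) (Ls 1) (?W (Ls 1)) (Ls 2) (?W (Ls 2)) t \<partial>lborel3)
       = (\<integral>t. res_integrand M t
           \<partial>lborel3)"
    if mb: "\<forall>i<3. MB_contour (Ls i)" and sep: "foxH_separates 1 fox_A fox_V Ls" for Ls
  proof -
    obtain c0 T0 where L0: "mb_contour (Ls 0) c0 T0" using MB_contour_imp_mb_contour[of "Ls 0"] mb by auto
    obtain c1 T1 where L1: "mb_contour (Ls 1) c1 T1" using MB_contour_imp_mb_contour[of "Ls 1"] mb by auto
    obtain c2 T2 where L2: "mb_contour (Ls 2) c2 T2" using MB_contour_imp_mb_contour[of "Ls 2"] mb by auto
    obtain B0 where B0: "\<And>t. \<bar>Re (Ls 0 t)\<bar> < B0" using mb_contour.bounded_Re[OF L0] by blast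
    obtain B1 where B1: "\<And>t. \<bar>Re (Ls 1 t)\<bar> < B1" using mb_contour.bounded_Re[OF L1] by blast
    obtain B2 where B2: "\<And>t. \<bar>Re (Ls 2 t)\<bar> < B2" using mb_contour.bounded_Re[OF L2] by blast
    define B where "B = max B0 (max B1 B2)"
    note sep' = iffD1[OF foxH_separates_iff sep]
    have right: "MB_right_of (Ls 0) (of_nat k)" "MB_right_of (Ls 1) (of_nat k)" "MB_right_of (Ls 2) (of_nat k)" for k
      using sep' by simp_all
    have j: "MB_left_of (Ls 0) (- (2 + Ls 1 t + Ls 2 t') - of_nat k)" for t t' and k :: nat
    proof -
      define \<tau> where "\<tau> i = (if i = 1 then t else t')" for i :: nat
      have "MB_left_of (Ls 0) (- (2 + Ls 1 (\<tau> 1) + Ls 2 (\<tau> 2)) - of_nat k)"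
        using sep' by blast
      then show ?thesis by (simp add: \<tau>_def)
    qed
    show ?thesis
    proof (intro exI allI impI)
      fix M assume "nat \<lceil>max (2 * B) (max mE mB)\<rceil> \<le> M"
      then have M: "real M \<ge> 2 * B" "real M \<ge> mE" "real M \<ge> mB" by (auto simp: nat_le_iff ceiling_le_iff)
      note s2 = conjunct2[OF sep'] note s3 = conjunct2[OF s2] note s4 = conjunct2[OF s3]
      note l = conjunct1[OF s2, THEN spec] conjunct1[OF s3, THEN spec] conjunct1[OF s4, THEN spec]
      have b: "\<bar>Re (Ls 0 t)\<bar> < B" "\<bar>Re (Ls 1 t)\<bar> < B" "\<bar>Re (Ls 2 t)\<bar> < B" for t
        using B0[of t] B1[of t] B2[of t] by (auto simp: B_def)
      note * = contour_to_residues[OF L0 L1 L2 right l j b M]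
      show "admissible_nodes (Ls 0) (?W (Ls 0)) (Ls 1) (?W (Ls 1)) (Ls 2) (?W (Ls 2))
     \<and> res_admissible M
     \<and> (\<integral>t. node_integrand (Ls 0) (?W (Ls 0)) (Ls 1) (?W (Ls 1)) (Ls 2) (?W (Ls 2)) t \<partial>lborel3)
       = (\<integral>t. res_integrand M t
           \<partial>lborel3)"
        by (intro conjI *)
    qed
  qed
  show ex: "\<exists>Ls. foxH_admissible 1 fox_A fox_B fox_V fox_x Ls"
  proof -
    obtain L0 T0 where L0: "mb_contour L0 (-1/4) T0" "\<And>n::nat. MB_right_of L0 (of_nat n)"
      "\<And>k::nat. MB_left_of L0 (- of_real (1 - mE) - of_nat k)" "\<And>t. -1/4 \<le> Re (L0 t)"
      using separating_contour_exists[OF one_minus_nint(1)] by metis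
    obtain L1 T1 where L1: "mb_contour L1 (-1/4) T1" "\<And>n::nat. MB_right_of L1 (of_nat n)"
      "\<And>k::nat. MB_left_of L1 (- of_real mE - of_nat k)" "\<And>t. -1/4 \<le> Re (L1 t)"
      using separating_contour_exists[OF m_nint(1)] by metis
    obtain L2 T2 where L2: "mb_contour L2 (-1/4) T2" "\<And>n::nat. MB_right_of L2 (of_nat n)"
      "\<And>k::nat. MB_left_of L2 (- of_real (1 - mB) - of_nat k)" "\<And>t. -1/4 \<le> Re (L2 t)"
      using separating_contour_exists[OF one_minus_nint(2)] by metis
    define Ls where "Ls i = (if i = 0 then L0 else if i = 1 then L1 else L2)" for i :: nat
    have Ls: "Ls 0 = L0" "Ls 1 = L1" "Ls 2 = L2" by (auto simp: Ls_def)
    have half: "MB_left_of L (- (2 + a + b) - of_nat k)" if "\<And>t. -1/4 \<le> Re (L t)" "-1/4 \<le> Re a" "-1/4 \<le> Re b" for L a b and k :: nat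
      by (rule MB_left_of_halfplane[OF that(1)]) (use that in simp)
    have mb: "\<forall>i<3. MB_contour (Ls i)"
      unfolding Ls_def using L0(1) L1(1) L2(1) by (auto intro: mb_contour.MB_contour)
    have sep: "foxH_separates 1 fox_A fox_V Ls"
      unfolding foxH_separates_iff Ls
      using L0(3) L1(3) L2(3) half[OF L0(4) L1(4) L2(4)] half[OF L1(4) L0(4) L2(4)] half[OF L2(4) L0(4) L1(4)]
      by (simp add: Ls_def L0(2) L1(2) L2(2))
    have "admissible_nodes (Ls 0) (?W (Ls 0)) (Ls 1) (?W (Ls 1)) (Ls 2) (?W (Ls 2))"
    proof -
      have "P" if "\<exists>M0::nat. \<forall>M\<ge>M0. P \<and> Q M" for P Q using that by blast
      then show ?thesis using to_res[OF mb sep] .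
    qed
    from node_integrable[OF this] have "foxH_admissible 1 fox_A fox_B fox_V fox_x Ls"
      unfolding foxH_admissible_def foxH_integrand_eq using mb sep by (simp add: numeral_3_eq_3)
    then show ?thesis by blast
  qed
  define Ls where "Ls = (SOME Ls. foxH_admissible 1 fox_A fox_B fox_V fox_x Ls)"
  have adm: "foxH_admissible 1 fox_A fox_B fox_V fox_x Ls"
    unfolding Ls_def by (rule someI_ex[OF ex])
  have len: "length fox_V = 3" by simp
  have mb: "\<forall>i<3. MB_contour (Ls i)"
    using adm unfolding foxH_admissible_def len by blast
  have sep: "foxH_separates 1 fox_A fox_V Ls" using adm unfolding foxH_admissible_def by blast
  have fox: "foxH 1 fox_A fox_B fox_V fox_x
     = (\<integral>t. node_integrand (Ls 0) (?W (Ls 0)) (Ls 1) (?W (Ls 1)) (Ls 2) (?W (Ls 2)) t \<partial>lborel3)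
        / (2 * of_real pi * \<i>) ^ 3"
    unfolding foxH_def Let_def Ls_def[symmetric] foxH_integrand_eq len ..
  have "\<exists>M0::nat. \<forall>M\<ge>M0. Q M \<and> a / d = b M / d" if "\<exists>M0. \<forall>M\<ge>M0. P \<and> Q M \<and> a = b M"
    for P Q a and b :: "nat \<Rightarrow> complex" and d using that by auto
  from this[OF to_res[OF mb sep]] show "\<exists>M0. \<forall>M\<ge>M0.
     res_admissible M \<and>
     foxH 1 fox_A fox_B fox_V fox_x
      = (\<integral>t. res_integrand M t
           \<partial>lborel3) / (2 * of_real pi * \<i>) ^ 3"
    unfolding fox .
qed

end

section \<open>Evaluation by residue series\<close>

lemma powr_of_nat_complex: "y > 0 \<Longrightarrow> of_real y powr (of_nat n :: complex) = of_real y ^ n"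
  by (simp add: powr_nat')

lemma tendsto_zero_halving:
  fixes N :: "nat \<Rightarrow> real"
  assumes "\<And>M. M \<ge> M1 \<Longrightarrow> N (Suc M) \<le> N M / 2" "\<And>M. N M \<ge> 0"
  shows "N \<longlonglongrightarrow> 0"
proof -
  have "N (M1 + j) \<le> N M1 * (1/2) ^ j" for j
  proof (induction j)
    case (Suc j)
    have "N (M1 + Suc j) \<le> N (M1 + j) / 2" using assms(1)[of "M1 + j"] by simp
    then show ?case using Suc by simp
  qed simp
  moreover have "(\<lambda>j. N M1 * (1/2) ^ j) \<longlonglongrightarrow> 0"
    by (intro tendsto_mult_right_zero LIMSEQ_realpow_zero) auto
  ultimately have "(\<lambda>j. N (j + M1)) \<longlonglongrightarrow> 0"
    using assms(2) by (intro tendsto_sandwich[of "\<lambda>_. 0" "\<lambda>j. N (j + M1)" _ "\<lambda>j. N M1 * (1/2) ^ j"])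
      (auto simp: add.commute)
  then show ?thesis by (rule LIMSEQ_offset)
qed

text \<open>By the functional equations the step s -> s + 1 multiplies the integrand by (\<alpha> +
  s)/(-s - 1) * w/(\<gamma> + s). This is O(w / Re s) uniformly in Im s, so the line integrals
  shrink as the line moves right.\<close>

lemma line_integrand_step:
  fixes \<alpha> w :: real and \<gamma> s :: complex
  assumes "w > 0" "Re \<gamma> \<ge> 1"
  defines "F \<equiv> \<lambda>s. Gamma (- s) * (Gamma (of_real \<alpha> + s) * (rGamma (\<gamma> + s) * of_real w powr s))"
  assumes "Re s > 0" "- \<alpha> < Re s" "- s \<notin> \<int>\<^sub>\<le>\<^sub>0"
  shows "norm (F (s + 1)) \<le> (1 + \<bar>\<alpha> - 1\<bar>) * w / Re s * norm (F s)"
proof -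
  have s1: "- s - 1 \<noteq> 0" "\<alpha> + s \<noteq> 0" "\<gamma> + s \<noteq> 0"
    using assms by (auto simp: complex_eq_iff)
  have "- s - 1 \<notin> \<int>\<^sub>\<le>\<^sub>0"
  proof
    assume "- s - 1 \<in> \<int>\<^sub>\<le>\<^sub>0"
    then obtain n :: nat where n: "- s - 1 = - of_nat n" by (auto elim!: nonpos_Ints_cases')
    then have s: "s = of_nat n - 1" by (simp add: algebra_simps)
    then have "n \<ge> 2" using assms(4) by simp
    then have "- s = - of_nat (n - 1)" using s by (simp add: of_nat_diff)
    then show False using assms(6) by simp
  qed
  then have "Gamma (- s) = (- s - 1) * Gamma (- s - 1)"
    using Gamma_plus1[of "- s - 1"] by simp
  moreover have "- (s + 1) = - s - 1" by simp
  ultimately have g1: "Gamma (- (s + 1)) = Gamma (- s) / (- s - 1)" using s1(1) by (metis nonzero_mult_div_cancel_left)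
  have "of_real \<alpha> + s \<notin> \<int>\<^sub>\<le>\<^sub>0"
    using assms(5) by (auto elim!: nonpos_Ints_cases' simp: complex_eq_iff)
  then have g2: "Gamma (of_real \<alpha> + (s + 1)) = (of_real \<alpha> + s) * Gamma (of_real \<alpha> + s)"
    using Gamma_plus1[of "of_real \<alpha> + s"] s1 by (simp add: add.assoc)
  have g3: "rGamma (\<gamma> + (s + 1)) = rGamma (\<gamma> + s) / (\<gamma> + s)"
    using rGamma_plus1[of "\<gamma> + s"] s1 by (simp add: field_simps)
  have g4: "of_real w powr (s + 1) = of_real w powr s * of_real w"
    using assms(1) by (simp add: powr_add)
  have "F (s + 1) = F s * ((of_real \<alpha> + s) / (- s - 1) * (of_real w / (\<gamma> + s)))"
    unfolding F_def g1 g2 g3 g4 by (simp add: field_simps)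
  then have "norm (F (s + 1)) = norm (F s) * (norm (of_real \<alpha> + s) / norm (s + 1) * (w / norm (\<gamma> + s)))"
    using assms(1) norm_minus_cancel[of "s + 1"] by (simp add: norm_mult norm_divide del: norm_minus_cancel)
  also have "\<dots> \<le> norm (F s) * ((1 + \<bar>\<alpha> - 1\<bar>) * (w / Re s))"
  proof (intro mult_left_mono mult_mono)
    have n1: "norm (s + 1) \<ge> 1" using abs_Re_le_cmod[of "s + 1"] assms(4) by simp
    have "norm (of_real \<alpha> + s) = norm ((s + 1) + of_real (\<alpha> - 1))" by (simp add: algebra_simps)
    also have "\<dots> \<le> norm (s + 1) + \<bar>\<alpha> - 1\<bar>" by (metis norm_of_real norm_triangle_ineq)
    also have "\<dots> \<le> norm (s + 1) + \<bar>\<alpha> - 1\<bar> * norm (s + 1)" using n1 by (simp add: mult_le_cancel_left1)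
    finally show "norm (of_real \<alpha> + s) / norm (s + 1) \<le> 1 + \<bar>\<alpha> - 1\<bar>"
      using n1 by (subst pos_divide_le_eq) (auto simp: ring_distribs)
    have "Re s \<le> norm (\<gamma> + s)" using complex_Re_le_cmod[of "\<gamma> + s"] assms(2) by simp
    then show "w / norm (\<gamma> + s) \<le> w / Re s" using assms(1,4) by (intro frac_le) auto
  qed (use assms in auto)
  finally show ?thesis by (simp add: mult_ac)
qed

text \<open>Up to sign, the residue of \<Gamma>(-s) \<Gamma>(\<alpha> + s) w^s at s = n.\<close>

definition gcoef :: "real \<Rightarrow> real \<Rightarrow> nat \<Rightarrow> complex" where
  "gcoef \<alpha> w n = (-1) ^ n / fact n * (Gamma (of_real \<alpha> + of_nat n) * of_real w ^ n)"

text \<open>One M has to work for all \<gamma> and \<open>w\<close> at once: \<gamma> contains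
  another integration variable, and \<open>w\<close> will be a multiple of the variable x of Euler's
  integral.\<close>

definition res_series_at :: "nat \<Rightarrow> real \<Rightarrow> bool" where
  "res_series_at M \<alpha> \<longleftrightarrow> (\<forall>\<gamma> w. Re \<gamma> \<ge> 1 \<longrightarrow> w > 0 \<longrightarrow>
    integrable lborel (\<lambda>u. res_weight M u * (Gamma (of_real \<alpha> + res_node M u) * (rGamma (\<gamma> + res_node M u) * of_real w powr res_node M u)))
  \<and> (\<lambda>n. gcoef \<alpha> w n * rGamma (\<gamma> + of_nat n)) sums
    ((\<integral>u. res_weight M u * (Gamma (of_real \<alpha> + res_node M u) * (rGamma (\<gamma> + res_node M u) * of_real w powr res_node M u)) \<partial>lborel)
      / (2 * of_real pi * \<i>)))"

text \<open>The integral over an auxiliary contour does not depend on M, while for every large M it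
  equals the M-th partial sum plus a line integral that tends to 0. Hence the integral for a fixed
  finite M is already the full series. The threshold comes from \<alpha> and the auxiliary contour
  only.\<close>

lemma res_series:
  assumes "\<alpha> \<notin> \<int>"
  shows "\<exists>M0. \<forall>M\<ge>M0. res_series_at M \<alpha>"
proof -
  obtain L T where L: "mb_contour L (-1/4) T" "\<And>n::nat. MB_right_of L (of_nat n)"
    "\<And>k::nat. MB_left_of L (- of_real \<alpha> - of_nat k)"
    using separating_contour_exists[OF assms] by metis
  obtain B where B: "\<And>t. \<bar>Re (L t)\<bar> < B" using mb_contour.bounded_Re[OF L(1)] by blast
  define M0 where "M0 = nat \<lceil>max B \<bar>\<alpha>\<bar>\<rceil>"
  have M0: "- \<alpha> < real M + 1/2 \<and> (\<forall>t. Re (L t) < real M + 1/2)" if "M \<ge> M0" for M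
  proof -
    have "B \<le> real M" "\<bar>\<alpha>\<bar> \<le> real M" using that by (auto simp: M0_def nat_le_iff ceiling_le_iff)
    moreover have "Re (L t) < B" for t using B[of t] by simp
    then have "Re (L t) < real M + 1/2" for t using \<open>B \<le> real M\<close> by (rule less_trans[OF _ le_less_trans]) simp
    ultimately show ?thesis by (auto simp: abs_le_iff)
  qed
  show ?thesis unfolding res_series_at_def
  proof (rule exI[of _ M0], intro allI impI)
    fix M \<gamma> w assume M: "M \<ge> M0" and \<gamma>: "Re \<gamma> \<ge> 1" and w: "w > (0::real)"
    let ?h = "\<lambda>s. rGamma (\<gamma> + s) * of_real w powr s"
    define F where "F s = Gamma (- s) * (Gamma (of_real \<alpha> + s) * ?h s)" for s
    define V where "V = (\<integral>t. Gamma (- L t) * vector_derivative L (at t) * (Gamma (of_real \<alpha> + L t) * ?h (L t)) \<partial>lborel)"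
    define I where "I M = (\<integral>u. res_weight M u * (Gamma (of_real \<alpha> + res_node M u) * ?h (res_node M u)) \<partial>lborel)" for M
    define a where "a n = gcoef \<alpha> w n * rGamma (\<gamma> + of_nat n)" for n
    define \<Lambda> where "\<Lambda> M = (\<integral>t. F (Complex (real M + 1/2) t) \<partial>lborel)" for M
    \<comment> \<open>\<open>?h\<close> is entire; in the deformation lemma the second progression
      of poles is taken equal to the first.\<close>
    have hol: "?h holomorphic_on - range (\<lambda>k::nat. - of_real \<alpha> - of_nat k)"
      by (intro holomorphic_intros)
    have gr: "\<exists>C U. \<forall>s. \<bar>Re s\<bar> \<le> B \<longrightarrow> U \<le> \<bar>Im s\<bar> \<longrightarrow> norm (?h s) \<le> C * exp (17/10 * \<bar>Im s\<bar>)" for B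
      using growth_rGamma_powr[OF w, of B \<gamma>] by blast
    have d1: "integrable lborel (\<lambda>t. F (Complex (real M + 1/2) t))" and d2: "V = I M" if "M \<ge> M0" for M
      unfolding F_def V_def I_def
      using mb_contour.meijer_deformation[OF L L(3) hol gr, of M] M0[OF that] by auto
    have bi: "has_bochner_integral lborel (\<lambda>u. res_weight M u * (Gamma (of_real \<alpha> + res_node M u) * ?h (res_node M u)))
       (2 * of_real pi * \<i> * (\<Sum>n\<le>M. a n) + \<i> * \<Lambda> M)" if "M \<ge> M0" for M
      using res_integral[of M "\<lambda>s. Gamma (of_real \<alpha> + s) * ?h s"] d1[OF that] w
      by (simp add: F_def \<Lambda>_def a_def gcoef_def powr_of_nat_complex mult_ac)
    have eq: "V = 2 * of_real pi * \<i> * (\<Sum>n\<le>M. a n) + \<i> * \<Lambda> M" if "M \<ge> M0" for M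
      using has_bochner_integral_integral_eq[OF bi[OF that]] d2[OF that] by (simp add: I_def)
    define K where "K = (1 + \<bar>\<alpha> - 1\<bar>) * w"
    define N where "N M = (\<integral>t. norm (F (Complex (real M + 1/2) t)) \<partial>lborel)" for M
    have "N \<longlonglongrightarrow> 0"
    proof (rule tendsto_zero_halving)
      \<comment> \<open>From 2 K on, moving the line by 1 at least halves the integral of the
        norm.\<close>
      fix M assume M': "M \<ge> max M0 (nat \<lceil>2 * K\<rceil>)"
      have "norm (F (Complex (real (Suc M) + 1/2) t)) \<le> 1/2 * norm (F (Complex (real M + 1/2) t))" for t
      proof -
        let ?s = "Complex (real M + 1/2) t"
        have "Complex (real (Suc M) + 1/2) t = ?s + 1" by (simp add: complex_eq_iff)
        moreover have "- ?s \<notin> \<int>\<^sub>\<le>\<^sub>0"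
        proof
          assume "- ?s \<in> \<int>\<^sub>\<le>\<^sub>0"
          then obtain n :: nat where "- real M - 1/2 = - real n" by (auto elim!: nonpos_Ints_cases' simp: complex_eq_iff)
          then have "real (2 * M + 1) = real (2 * n)" by simp
          then have "2 * M + 1 = 2 * n" by (simp only: of_nat_eq_iff)
          then show False by presburger
        qed
        ultimately have "norm (F (Complex (real (Suc M) + 1/2) t)) \<le> K / (real M + 1/2) * norm (F ?s)"
          using line_integrand_step[OF w \<gamma>, of ?s \<alpha>] M0[of M] M' unfolding F_def K_def by simp
        also have "\<dots> \<le> 1/2 * norm (F ?s)"
        proof (intro mult_right_mono)
          have "2 * K \<le> real M" using M' by (simp add: nat_le_iff ceiling_le_iff)
          then show "K / (real M + 1/2) \<le> 1/2" by (simp add: field_simps)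
        qed simp
        finally show ?thesis .
      qed
      then have "N (Suc M) \<le> (\<integral>t. 1/2 * norm (F (Complex (real M + 1/2) t)) \<partial>lborel)"
        unfolding N_def using M' d1[of M] d1[of "Suc M"]
        by (intro integral_mono integrable_mult_right integrable_norm) auto
      then show "N (Suc M) \<le> N M / 2" by (simp add: N_def)
    qed (simp add: N_def)
    then have "\<Lambda> \<longlonglongrightarrow> 0"
      unfolding \<Lambda>_def N_def by (rule Lim_null_comparison[rotated]) (auto intro!: always_eventually integral_norm_bound)
    then have "(\<lambda>M. (V - \<i> * \<Lambda> M) / (2 * of_real pi * \<i>)) \<longlonglongrightarrow> (V - \<i> * 0) / (2 * of_real pi * \<i>)"
      by (intro tendsto_intros) auto
    moreover have "\<forall>\<^sub>F M in sequentially. (V - \<i> * \<Lambda> M) / (2 * of_real pi * \<i>) = (\<Sum>n\<le>M. a n)"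
      using eventually_ge_at_top[of M0] by eventually_elim (simp add: eq)
    ultimately have "(\<lambda>M. \<Sum>n\<le>M. a n) \<longlonglongrightarrow> V / (2 * of_real pi * \<i>)"
      using Lim_transform_eventually[of "\<lambda>M. (V - \<i> * \<Lambda> M) / (2 * of_real pi * \<i>)"] by simp
    then have "a sums (V / (2 * of_real pi * \<i>))" by (simp add: sums_def_le)
    then have "a sums (I M / (2 * of_real pi * \<i>))" using d2[OF M] by simp
    moreover have "integrable lborel (\<lambda>u. res_weight M u * (Gamma (of_real \<alpha> + res_node M u) * ?h (res_node M u)))"
      using bi[OF M] by (simp add: has_bochner_integral_iff)
    ultimately show "integrable lborel (\<lambda>u. res_weight M u * (Gamma (of_real \<alpha> + res_node M u) * ?h (res_node M u)))
      \<and> (\<lambda>n. gcoef \<alpha> w n * rGamma (\<gamma> + of_nat n)) sums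
       ((\<integral>u. res_weight M u * (Gamma (of_real \<alpha> + res_node M u) * ?h (res_node M u)) \<partial>lborel) / (2 * of_real pi * \<i>))"
      unfolding a_def I_def by blast
  qed
qed

text \<open>The quotient of the two values is a Pochhammer product whose factors satisfy |z + j| at
  least j + 1. The gain 1/n! is uniform in z and drives the termwise integration.\<close>

lemma norm_rGamma_shift_le:
  assumes "Re z \<ge> 1"
  shows "norm (rGamma (z + of_nat n)) \<le> norm (rGamma z) / fact n"
proof -
  have "fact n = (\<Prod>j<n. real (Suc j))" by (simp add: fact_prod_Suc atLeast0LessThan)
  also have "\<dots> \<le> (\<Prod>j<n. norm (z + of_nat j))"
  proof (intro prod_mono conjI)
    fix j
    have "real (Suc j) \<le> Re (z + of_nat j)" using assms by simp
    also have "\<dots> \<le> norm (z + of_nat j)" by (rule complex_Re_le_cmod)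
    finally show "real (Suc j) \<le> norm (z + of_nat j)" .
  qed auto
  also have "\<dots> = norm (pochhammer z n)" by (simp add: pochhammer_prod prod_norm atLeast0LessThan)
  finally have "fact n * norm (rGamma (z + of_nat n)) \<le> norm (pochhammer z n) * norm (rGamma (z + of_nat n))"
    by (intro mult_right_mono) auto
  also have "\<dots> = norm (rGamma z)" by (subst pochhammer_rGamma[of z n]) (simp add: norm_mult)
  finally show ?thesis by (simp add: field_simps)
qed

text \<open>Consecutive terms have quotient |\<alpha> + n| |w| / (n + 1)^2. This majorant serves
  both the termwise integration and the diagonal summation.\<close>

lemma summable_Gamma_coeff:
  assumes "\<alpha> \<notin> \<int>"
  shows "summable (\<lambda>n. norm (gcoef \<alpha> w n) / fact n)"
proof -
  define f where "f n = norm (gcoef \<alpha> w n) / fact n" for n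
  have nz: "of_real \<alpha> + of_nat n \<notin> (\<int>\<^sub>\<le>\<^sub>0 :: complex set)" for n
  proof
    assume "of_real \<alpha> + of_nat n \<in> (\<int>\<^sub>\<le>\<^sub>0 :: complex set)"
    then obtain k :: nat where "complex_of_real \<alpha> + of_nat n = - of_nat k" by (auto elim!: nonpos_Ints_cases')
    then have "\<alpha> + real n = - real k" by (simp add: complex_eq_iff)
    then have "\<alpha> = - of_nat (k + n)" by simp
    then show False using assms by simp
  qed
  have f: "f n = norm (Gamma (of_real \<alpha> + of_nat n :: complex)) * \<bar>w\<bar> ^ n / (fact n * fact n)" for n
    by (simp add: f_def gcoef_def norm_mult norm_divide norm_power)
  have step: "f (Suc n) = f n * (\<bar>\<alpha> + real n\<bar> * \<bar>w\<bar> / (real (Suc n) * real (Suc n)))" for n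
  proof -
    have "Gamma (of_real \<alpha> + of_nat (Suc n) :: complex) = (of_real \<alpha> + of_nat n) * Gamma (of_real \<alpha> + of_nat n)"
      using Gamma_plus1[of "of_real \<alpha> + of_nat n :: complex"] nz[of n] by (auto simp: add_ac)
    moreover have "norm (of_real \<alpha> + of_nat n :: complex) = \<bar>\<alpha> + real n\<bar>"
      by (metis norm_of_real of_real_add of_real_of_nat_eq)
    ultimately have "norm (Gamma (of_real \<alpha> + of_nat (Suc n) :: complex)) = \<bar>\<alpha> + real n\<bar> * norm (Gamma (of_real \<alpha> + of_nat n :: complex))"
      by (simp only: norm_mult)
    then show ?thesis unfolding f by (simp add: field_simps del: of_nat_Suc)
  qed
  have "(\<lambda>n. \<bar>\<alpha> + real n\<bar> * \<bar>w\<bar> / (real (Suc n) * real (Suc n))) \<longlonglongrightarrow> 0"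
    by real_asymp
  then have "\<forall>\<^sub>F n in sequentially. \<bar>\<alpha> + real n\<bar> * \<bar>w\<bar> / (real (Suc n) * real (Suc n)) < 1/2"
    by (rule order_tendstoD) simp
  then obtain N where N: "\<And>n. n \<ge> N \<Longrightarrow> \<bar>\<alpha> + real n\<bar> * \<bar>w\<bar> / (real (Suc n) * real (Suc n)) < 1/2"
    by (auto simp: eventually_sequentially)
  have "summable f"
  proof (rule summable_ratio_test)
    fix n assume "n \<ge> N"
    have "f n \<ge> 0" by (simp add: f_def)
    then have "f (Suc n) \<le> f n * (1/2)" unfolding step using N[OF \<open>n \<ge> N\<close>] by (intro mult_left_mono) auto
    then show "norm (f (Suc n)) \<le> 1/2 * norm (f n)" by (simp add: f_def)
  qed simp
  then show ?thesis unfolding f_def[abs_def] .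
qed

section \<open>The triple integral without the joint Gamma factor\<close>

context fox_params
begin

text \<open>Humbert's \<Phi>2(1 - mE, mE; 2; -y1, -y2) times \<Gamma>(1 - mE) \<Gamma>(mE); likewise
  \<open>kummer_sum\<close> is \<Gamma>(1 - mB) times 1F1(1 - mB; 1; -y3).\<close>

definition phi2_sum :: complex where
  "phi2_sum = (\<Sum>n. gcoef (1 - mE) y1 n * (\<Sum>k. gcoef mE y2 k * rGamma (2 + of_nat n + of_nat k)))"

definition kummer_sum :: complex where
  "kummer_sum = (\<Sum>n. gcoef (1 - mB) y3 n * rGamma (1 + of_nat n))"

text \<open>Without the joint factor the third variable separates. In the other two,
  \<open>rGamma (2 + s0 + s1)\<close> is summed over the residues in s0 with s1 fixed, and the
  resulting series is then integrated in s1 term by term.\<close>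

lemma core0_eval:
  assumes adm: "res_admissible M"
    and ser: "res_series_at M (1 - mE)" "res_series_at M mE" "res_series_at M (1 - mB)"
  defines "f \<equiv> \<lambda>t::nat \<Rightarrow> real. res_weight M (t 0) * res_weight M (t 1) * res_weight M (t 2)
      * core0 (res_node M (t 0)) (res_node M (t 1)) (res_node M (t 2))"
  shows "(\<integral>t. f t \<partial>lborel3) = (2 * of_real pi * \<i>) ^ 3 * (phi2_sum * kummer_sum)"
proof -
  let ?R = "res_weight M" and ?S = "res_node M" and ?c = "2 * of_real pi * \<i> :: complex"
  have c0: "?c \<noteq> 0" by simp
  interpret product_sigma_finite "\<lambda>_::nat. lborel :: real measure" ..
  have fi: "integrable lborel3 f"
    unfolding f_def by (rule core0_integrable[OF adm])
  define \<Psi> where "\<Psi> s = (\<Sum>n. gcoef (1 - mE) y1 n * rGamma (2 + s + of_nat n))" for s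
  define p where "p u = ?R u * (Gamma (of_real mE + ?S u) * of_real y2 powr ?S u) * (?c * \<Psi> (?S u))" for u
  define q where "q u = ?R u * (Gamma (of_real (1 - mB) + ?S u) * (rGamma (1 + ?S u) * of_real y3 powr ?S u))" for u
  note Re0 = Re_res_node_nonneg
  \<comment> \<open>The residue series with \<gamma> = 2 + s1, allowed because the nodes have
    nonnegative real part.\<close>
  have inner: "(\<integral>x. f (t(0 := x)) \<partial>lborel) = p (t 1) * q (t 2)" for t
  proof -
    let ?s1 = "?S (t 1)" and ?s2 = "?S (t 2)"
    have "(\<lambda>n. gcoef (1 - mE) y1 n * rGamma (2 + ?s1 + of_nat n)) sums
      ((\<integral>u. ?R u * (Gamma (of_real (1 - mE) + ?S u) * (rGamma (2 + ?s1 + ?S u) * of_real y1 powr ?S u)) \<partial>lborel) / ?c)"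
      using ser(1) y_pos Re0[of M "t 1"] unfolding res_series_at_def by simp
    then have i: "(\<integral>u. ?R u * (Gamma (of_real (1 - mE) + ?S u) * (rGamma (2 + ?s1 + ?S u) * of_real y1 powr ?S u)) \<partial>lborel) = ?c * \<Psi> ?s1"
      using c0 by (simp add: \<Psi>_def sums_iff)
    have "(\<lambda>x. f (t(0 := x))) = (\<lambda>u. (?R (t 1) * (Gamma (of_real mE + ?s1) * of_real y2 powr ?s1) * q (t 2))
       * (?R u * (Gamma (of_real (1 - mE) + ?S u) * (rGamma (2 + ?s1 + ?S u) * of_real y1 powr ?S u))))"
      by (auto simp: f_def core0_def q_def fun_eq_iff mult_ac add_ac)
    then have "(\<integral>x. f (t(0 := x)) \<partial>lborel) = (?R (t 1) * (Gamma (of_real mE + ?s1) * of_real y2 powr ?s1) * q (t 2)) * (?c * \<Psi> ?s1)"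
      by (simp only: integral_mult_right_zero i)
    then show ?thesis by (simp only: p_def mult_ac)
  qed
  have q: "integrable lborel q" "(\<integral>u. q u \<partial>lborel) = ?c * kummer_sum"
    using ser(3)[unfolded res_series_at_def, rule_format, of 1 y3] y_pos c0
    by (auto simp: q_def[abs_def] kummer_sum_def sums_iff)
  \<comment> \<open>The n-th term of \<Psi> under the integral over s1: again a residue series, now
    with \<gamma> = 2 + n.\<close>
  define P where "P n u = gcoef (1 - mE) y1 n * (?R u * (Gamma (of_real mE + ?S u) * (rGamma (2 + of_nat n + ?S u) * of_real y2 powr ?S u)))" for n u
  have Pn: "integrable lborel (P n)" "(\<integral>u. P n u \<partial>lborel) = ?c * (gcoef (1 - mE) y1 n * (\<Sum>k. gcoef mE y2 k * rGamma (2 + of_nat n + of_nat k)))" for n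
    using ser(2)[unfolded res_series_at_def, rule_format, of "2 + of_nat n" y2] y_pos c0
    by (auto simp: P_def[abs_def] sums_iff)
  \<comment> \<open>The profile for n = 0 without its coefficient dominates all terms, with the
    additional factor 1/n!.\<close>
  define d where "d u = norm (?R u * (Gamma (of_real mE + ?S u) * (rGamma (2 + ?S u) * of_real y2 powr ?S u)))" for u
  have di: "integrable lborel d"
    using ser(2)[unfolded res_series_at_def, rule_format, of 2 y2] y_pos by (simp add: d_def[abs_def])
  have Pd: "norm (P n u) \<le> norm (gcoef (1 - mE) y1 n) / fact n * d u" for n u
  proof -
    have "norm (rGamma (2 + of_nat n + ?S u)) \<le> norm (rGamma (2 + ?S u)) / fact n"
      using norm_rGamma_shift_le[of "2 + ?S u" n] Re0[of M u] by (simp add: add_ac)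
    then have "norm (P n u) \<le> norm (gcoef (1 - mE) y1 n) * (norm (?R u) * (norm (Gamma (of_real mE + ?S u)) * ((norm (rGamma (2 + ?S u)) / fact n) * norm (of_real y2 powr ?S u))))"
      unfolding P_def norm_mult by (intro mult_left_mono mult_right_mono) auto
    also have "\<dots> = norm (gcoef (1 - mE) y1 n) / fact n * d u" by (simp add: d_def norm_mult)
    finally show ?thesis .
  qed
  note sg = summable_Gamma_coeff[OF one_minus_nint(1), of y1]
  have s1: "AE u in lborel. summable (\<lambda>n. norm (P n u))"
  proof (rule AE_I2)
    fix u
    show "summable (\<lambda>n. norm (P n u))"
      by (rule summable_comparison_test'[OF summable_mult2[OF sg, of "d u"]]) (use Pd in auto)
  qed
  have s2: "summable (\<lambda>n. \<integral>u. norm (P n u) \<partial>lborel)"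
  proof (rule summable_comparison_test'[OF summable_mult2[OF sg, of "\<integral>u. d u \<partial>lborel"]])
    fix n
    have "(\<integral>u. norm (P n u) \<partial>lborel) \<le> (\<integral>u. norm (gcoef (1 - mE) y1 n) / fact n * d u \<partial>lborel)"
      using Pn(1) di Pd by (intro integral_mono integrable_norm integrable_mult_right) auto
    then show "norm (\<integral>u. norm (P n u) \<partial>lborel) \<le> norm (gcoef (1 - mE) y1 n) / fact n * (\<integral>u. d u \<partial>lborel)"
      by simp
  qed
  have pP: "p u = ?c * (\<Sum>n. P n u)" for u
  proof -
    have "(\<Sum>n. P n u) = (\<Sum>n. (?R u * (Gamma (of_real mE + ?S u) * of_real y2 powr ?S u)) * (gcoef (1 - mE) y1 n * rGamma (2 + ?S u + of_nat n)))"
      unfolding P_def by (simp add: mult_ac add_ac)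
    also have "\<dots> = (?R u * (Gamma (of_real mE + ?S u) * of_real y2 powr ?S u)) * \<Psi> (?S u)"
      unfolding \<Psi>_def
    proof (rule suminf_mult)
      show "summable (\<lambda>n. gcoef (1 - mE) y1 n * rGamma (2 + ?S u + of_nat n))"
        using ser(1)[unfolded res_series_at_def, rule_format, of "2 + ?S u" y1] y_pos Re0[of M u] by (auto simp: sums_iff)
    qed
    finally show ?thesis by (simp add: p_def mult_ac)
  qed
  have pi: "integrable lborel p"
    unfolding pP[abs_def] by (intro integrable_mult_right integrable_suminf Pn(1) s1 s2)
  have "(\<integral>u. p u \<partial>lborel) = ?c * (\<Sum>n. \<integral>u. P n u \<partial>lborel)"
    unfolding pP integral_mult_right_zero by (subst integral_suminf[OF Pn(1) s1 s2]) simp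
  also have "(\<Sum>n. \<integral>u. P n u \<partial>lborel) = ?c * phi2_sum"
  proof -
    have sm: "summable (\<lambda>n. \<integral>u. P n u \<partial>lborel)"
      using sums_integral[OF Pn(1) s1 s2] by (simp add: sums_iff)
    then have "summable (\<lambda>n. gcoef (1 - mE) y1 n * (\<Sum>k. gcoef mE y2 k * rGamma (2 + of_nat n + of_nat k)))"
      unfolding Pn(2) using c0 by (simp add: summable_cmult_iff)
    then show ?thesis unfolding Pn(2) phi2_sum_def by (rule suminf_mult)
  qed
  finally have p: "(\<integral>u. p u \<partial>lborel) = ?c * (?c * phi2_sum)" .
  have I3: "{..<3::nat} = insert 0 {1, 2}" by auto
  have "(\<integral>t. f t \<partial>lborel3) = (\<integral>t. (\<integral>x. f (t(0 := x)) \<partial>lborel) \<partial>PiM {1, 2} (\<lambda>_. lborel))"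
    using product_integral_insert[of "{1, 2}" 0 f] fi unfolding I3 by simp
  also have "\<dots> = (\<integral>t. (\<Prod>i\<in>{1, 2::nat}. (if i = 1 then p else q) (t i)) \<partial>PiM {1, 2} (\<lambda>_. lborel))"
    by (simp add: inner)
  also have "\<dots> = (\<Prod>i\<in>{1, 2::nat}. \<integral>u. (if i = 1 then p else q) u \<partial>lborel)"
    by (rule product_integral_prod) (use pi q in auto)
  also have "\<dots> = ?c ^ 3 * (phi2_sum * kummer_sum)"
    by (simp add: p q(2) power3_eq_cube)
  finally show ?thesis .
qed

end

section \<open>Euler's integral for the joint Gamma factor\<close>

lemma powr_of_real_exp: "y > 0 \<Longrightarrow> complex_of_real y powr s = exp (s * of_real (ln y))"
  by (simp add: powr_def Ln_of_real)

text \<open>Euler's integrand x^(z - 1) exp(-x), written with \<open>exp\<close> and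
  \<open>ln\<close> so that measurability in z and x jointly is immediate.\<close>

definition gamma_kernel :: "complex \<Rightarrow> real \<Rightarrow> complex" where
  "gamma_kernel z x = indicator {0<..} x *\<^sub>R (exp ((z - 1) * of_real (ln x)) * of_real (exp (- x)))"

lemma gamma_kernel_integral:
  assumes "Re z > 0"
  shows "has_bochner_integral lborel (gamma_kernel z) (Gamma z)"
proof -
  have m: "gamma_kernel z \<in> borel_measurable borel"
    unfolding gamma_kernel_def by measurable
  have eq: "indicator {0<..} x *\<^sub>R (complex_of_real x powr (z - 1) / of_real (exp x)) = gamma_kernel z x" for x
    by (auto simp: gamma_kernel_def indicator_def powr_of_real_exp exp_minus divide_inverse)
  have "integrable lebesgue (gamma_kernel z)"
    using absolutely_integrable_Gamma_integral'[OF assms] unfolding set_integrable_def eq .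
  then have i: "integrable lborel (gamma_kernel z)"
    using m by (subst (asm) integrable_completion) auto
  have "(gamma_kernel z has_integral (\<integral>x. gamma_kernel z x \<partial>lborel)) UNIV"
    by (rule has_integral_integral_lborel[OF i])
  moreover have "(gamma_kernel z has_integral Gamma z) UNIV"
  proof -
    have "((\<lambda>x. if x \<in> {0<..} then complex_of_real x powr (z - 1) / of_real (exp x) else 0) has_integral Gamma z) UNIV"
      unfolding has_integral_restrict_UNIV by (rule Gamma_integral_complex'[OF assms])
    moreover have "(\<lambda>x. if x \<in> {0<..} then complex_of_real x powr (z - 1) / of_real (exp x) else 0) = gamma_kernel z"
      by (auto simp: fun_eq_iff eq[symmetric] indicator_def)
    ultimately show ?thesis by simp
  qed
  ultimately have "(\<integral>x. gamma_kernel z x \<partial>lborel) = Gamma z" by (rule has_integral_unique)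
  then show ?thesis using i by (simp add: has_bochner_integral_iff)
qed

text \<open>A power of x with exponent between 0 and P - 1 is at most 1 + x^(P - 1). The majorant is
  integrable and free of z, as Fubini requires.\<close>

lemma norm_gamma_kernel_le:
  assumes "1 \<le> Re z" "Re z \<le> P"
  shows "norm (gamma_kernel z x) \<le> norm (gamma_kernel 1 x) + norm (gamma_kernel (of_real P) x)"
proof (cases "x > 0")
  case True
  have "exp ((Re z - 1) * ln x) \<le> 1 + exp ((P - 1) * ln x)"
  proof (cases "ln x \<le> 0")
    case True
    then have "exp ((Re z - 1) * ln x) \<le> 1" using assms by (simp add: mult_nonneg_nonpos)
    then show ?thesis using exp_ge_zero[of "(P - 1) * ln x"] by linarith
  next
    case False
    then have "(Re z - 1) * ln x \<le> (P - 1) * ln x" using assms by (intro mult_right_mono) auto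
    then have "exp ((Re z - 1) * ln x) \<le> exp ((P - 1) * ln x)" by simp
    then show ?thesis by linarith
  qed
  then have "exp ((Re z - 1) * ln x) * exp (- x) \<le> (1 + exp ((P - 1) * ln x)) * exp (- x)"
    by (intro mult_right_mono) auto
  then show ?thesis using True by (simp add: gamma_kernel_def norm_mult ring_distribs)
qed (simp add: gamma_kernel_def)

context fox_params
begin

text \<open>Scaling all arguments by x produces x^(s0 + s1 + s2), which is exactly the part of
  Euler's integrand that depends on the nodes.\<close>

lemma core0_scale:
  assumes "x > 0"
  shows "fox_params.core0 mE mB (y1 * x) (y2 * x) (y3 * x) s0 s1 s2 = core0 s0 s1 s2 * exp ((s0 + s1 + s2) * of_real (ln x))"
proof -
  interpret X: fox_params mE mB "y1 * x" "y2 * x" "y3 * x"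
    using m_pos m_nint y_pos assms by unfold_locales auto
  have p: "complex_of_real (y * x) powr s = of_real y powr s * exp (s * of_real (ln x))" if "y > 0" for y s
    using that assms powr_of_real_exp[of "y * x" s]
    by (simp add: powr_of_real_exp ln_mult ring_distribs exp_add del: of_real_mult)
  show ?thesis
    unfolding X.core0_def core0_def p[OF y_pos(1)] p[OF y_pos(2)] p[OF y_pos(3)] ring_distribs exp_add
    by (simp only: mult_ac)
qed

text \<open>The factor x is what remains of x^(z - 1) for z = 2 + s0 + s1 + s2 after the powers of
  the nodes have gone into the arguments.\<close>

definition fox_density :: "real \<Rightarrow> complex" where
  "fox_density x = of_real (x * exp (- x)) * (fox_params.phi2_sum mE (y1 * x) (y2 * x) * fox_params.kummer_sum mB (y3 * x))"

text \<open>For one fixed M the joint factor is expanded by Euler's integral and the order of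
  integration exchanged. The inner triple integral is then a product of entire series for every x >
  0, with no smallness condition on the arguments.\<close>

lemma foxH_integral:
  "has_bochner_integral lborel (\<lambda>x. indicator {0<..} x *\<^sub>R fox_density x) (foxH 1 fox_A fox_B fox_V fox_x)"
proof -
  obtain M1 M2 M3 M4 where
    M1: "\<And>M. M \<ge> M1 \<Longrightarrow> res_admissible M \<and>
     foxH 1 fox_A fox_B fox_V fox_x = (\<integral>t. res_integrand M t
           \<partial>lborel3) / (2 * of_real pi * \<i>) ^ 3"
    and M2: "\<And>M. M \<ge> M2 \<Longrightarrow> res_series_at M (1 - mE)"
    and M3: "\<And>M. M \<ge> M3 \<Longrightarrow> res_series_at M mE"
    and M4: "\<And>M. M \<ge> M4 \<Longrightarrow> res_series_at M (1 - mB)"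
    using foxH_eq_residues res_series[OF one_minus_nint(1)] res_series[OF m_nint(1)] res_series[OF one_minus_nint(2)] by blast
  define M where "M = max (max M1 M2) (max M3 M4)"
  let ?R = "res_weight M" and ?S = "res_node M" and ?c = "2 * of_real pi * \<i> :: complex"
  have adm: "admissible_nodes ?S ?R ?S ?R ?S ?R"
    and fox: "foxH 1 fox_A fox_B fox_V fox_x = (\<integral>t. node_integrand ?S ?R ?S ?R ?S ?R t \<partial>lborel3) / ?c ^ 3"
    using M1[of M] by (simp_all add: M_def)
  have ser: "res_series_at M (1 - mE)" "res_series_at M mE" "res_series_at M (1 - mB)"
    by (auto intro!: M2 M3 M4 simp: M_def)
  let ?P3 = "lborel3"
  define f where "f t = ?R (t 0) * ?R (t 1) * ?R (t 2) * core0 (?S (t 0)) (?S (t 1)) (?S (t 2))" for t :: "nat \<Rightarrow> real"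
  define z where "z t = 2 + ?S (t 0) + ?S (t 1) + ?S (t 2)" for t :: "nat \<Rightarrow> real"
  define G where "G t x = f t * gamma_kernel (z t) x" for t x
  interpret product_sigma_finite "\<lambda>_::nat. lborel :: real measure" ..
  interpret P3: sigma_finite_measure ?P3 by (rule sigma_finite) simp
  interpret PS: pair_sigma_finite ?P3 "lborel :: real measure" ..
  have [measurable]: "(\<lambda>t. t 0) \<in> borel_measurable ?P3" "(\<lambda>t. t (Suc 0)) \<in> borel_measurable ?P3" "(\<lambda>t. t 2) \<in> borel_measurable ?P3"
    using measurable_component_singleton[of 0 "{..<3::nat}" "\<lambda>_. lborel :: real measure"]
      measurable_component_singleton[of "Suc 0" "{..<3::nat}" "\<lambda>_. lborel :: real measure"]
      measurable_component_singleton[of 2 "{..<3::nat}" "\<lambda>_. lborel :: real measure"] by auto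
  have fm [measurable]: "f \<in> borel_measurable ?P3"
    unfolding f_def by (intro measurable_node_functions measurable_res)
  have zm [measurable]: "z \<in> borel_measurable ?P3"
    unfolding z_def One_nat_def by measurable
  have Gm: "(\<lambda>(t, x). G t x) \<in> borel_measurable (?P3 \<Otimes>\<^sub>M lborel)"
    unfolding G_def gamma_kernel_def by measurable
  have ReS: "0 \<le> Re (?S u)" "Re (?S u) \<le> real M + 1" for u
    by (rule Re_res_node_nonneg) (cases rule: res_node_cases[of M u]; simp)
  define P where "P = 2 + 3 * (real M + 1)"
  have Rez: "2 \<le> Re (z t)" "Re (z t) \<le> P" for t
    using ReS(1)[of "t 0"] ReS(1)[of "t 1"] ReS(1)[of "t 2"] ReS(2)[of "t 0"] ReS(2)[of "t 1"] ReS(2)[of "t 2"]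
    by (simp_all add: z_def P_def)
  define k where "k x = norm (gamma_kernel 1 x) + norm (gamma_kernel (of_real P) x)" for x
  have ki: "integrable lborel k"
    unfolding k_def using gamma_kernel_integral[of 1] gamma_kernel_integral[of "of_real P"]
    by (auto intro!: integrable_norm Bochner_Integration.integrable_add simp: has_bochner_integral_iff P_def)
  have Gk: "norm (G t x) \<le> norm (f t) * k x" for t x
    unfolding G_def k_def norm_mult using norm_gamma_kernel_le[of "z t" P x] Rez[of t]
    by (intro mult_left_mono) auto
  have fi: "integrable ?P3 f"
    unfolding f_def by (rule core0_integrable[OF adm])
  have Gx: "has_bochner_integral lborel (G t) (node_integrand ?S ?R ?S ?R ?S ?R t)" for t
  proof -
    have "has_bochner_integral lborel (G t) (f t * Gamma (z t))"
      unfolding G_def using Rez[of t] by (intro has_bochner_integral_mult_right gamma_kernel_integral) auto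
    moreover have "f t * Gamma (z t) = node_integrand ?S ?R ?S ?R ?S ?R t"
      by (simp add: f_def z_def node_integrand_def core_def mult_ac)
    ultimately show ?thesis by simp
  qed
  have Gi: "integrable (?P3 \<Otimes>\<^sub>M lborel) (\<lambda>(t, x). G t x)"
  proof (rule PS.Fubini_integrable[OF Gm])
    show "AE t in ?P3. integrable lborel (\<lambda>x. case (t, x) of (t, x) \<Rightarrow> G t x)"
      using Gx by (auto simp: has_bochner_integral_iff)
    show "integrable ?P3 (\<lambda>t. \<integral>x. norm (case (t, x) of (t, x) \<Rightarrow> G t x) \<partial>lborel)"
    proof (rule Bochner_Integration.integrable_bound)
      show "integrable ?P3 (\<lambda>t. norm (f t) * (\<integral>x. k x \<partial>lborel))"
        using fi by (intro integrable_mult_left integrable_norm)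
      show "(\<lambda>t. \<integral>x. norm (case (t, x) of (t, x) \<Rightarrow> G t x) \<partial>lborel) \<in> borel_measurable ?P3"
        using Gm by (intro lborel.borel_measurable_lebesgue_integral) simp
      show "AE t in ?P3. norm (\<integral>x. norm (case (t, x) of (t, x) \<Rightarrow> G t x) \<partial>lborel) \<le> norm (norm (f t) * (\<integral>x. k x \<partial>lborel))"
      proof (rule AE_I2)
        fix t
        have "(\<integral>x. norm (G t x) \<partial>lborel) \<le> (\<integral>x. norm (f t) * k x \<partial>lborel)"
          using Gx[of t] ki Gk by (intro integral_mono integrable_norm integrable_mult_right) (auto simp: has_bochner_integral_iff)
        moreover have "0 \<le> (\<integral>x. k x \<partial>lborel)" by (simp add: k_def)
        ultimately show "norm (\<integral>x. norm (case (t, x) of (t, x) \<Rightarrow> G t x) \<partial>lborel) \<le> norm (norm (f t) * (\<integral>x. k x \<partial>lborel))"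
          by (simp add: abs_mult)
      qed
    qed
  qed
  have inner: "(\<integral>t. G t x \<partial>?P3) = ?c ^ 3 * (indicator {0<..} x *\<^sub>R fox_density x)" for x
  proof (cases "x > 0")
    case True
    interpret X: fox_params mE mB "y1 * x" "y2 * x" "y3 * x"
      using m_pos m_nint y_pos True by unfold_locales auto
    have "G t x = of_real (x * exp (- x)) * (?R (t 0) * ?R (t 1) * ?R (t 2) * X.core0 (?S (t 0)) (?S (t 1)) (?S (t 2)))" for t
    proof -
      have "exp ((z t - 1) * of_real (ln x)) = exp (complex_of_real (ln x)) * exp ((?S (t 0) + ?S (t 1) + ?S (t 2)) * of_real (ln x))"
        unfolding exp_add[symmetric] by (simp add: z_def algebra_simps)
      also have "exp (complex_of_real (ln x)) = of_real x" using True by (simp add: exp_of_real)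
      finally show ?thesis
        unfolding core0_scale[OF True] using True by (simp add: G_def f_def gamma_kernel_def)
    qed
    \<comment> \<open>Admissibility of the nodes does not mention the arguments, so it carries over
      to the scaled ones.\<close>
    then have "(\<integral>t. G t x \<partial>?P3) = of_real (x * exp (- x)) * (?c ^ 3 * (X.phi2_sum * X.kummer_sum))"
      by (simp only: integral_mult_right_zero X.core0_eval[OF adm[unfolded admissible_nodes_def, folded X.admissible_nodes_def] ser])
    then show ?thesis using True by (simp add: fox_density_def mult_ac)
  next
    case False
    then show ?thesis by (simp add: G_def gamma_kernel_def)
  qed
  have c3: "?c ^ 3 \<noteq> 0" by simp
  have cancel: "integrable lborel F" if "integrable lborel (\<lambda>x. d * F x)" "d \<noteq> 0" for F :: "real \<Rightarrow> complex" and d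
    using integrable_mult_right[of "1 / d", OF that(1)] that(2) by simp
  have "integrable lborel (\<lambda>x. \<integral>t. G t x \<partial>?P3)"
    by (rule PS.integrable_snd[OF Gi])
  from cancel[OF this[unfolded inner] c3]
  have 1: "integrable lborel (\<lambda>x. indicator {0<..} x *\<^sub>R fox_density x)" .
  have "(\<integral>x. (\<integral>t. G t x \<partial>?P3) \<partial>lborel) = (\<integral>t. (\<integral>x. G t x \<partial>lborel) \<partial>?P3)"
    by (rule PS.Fubini_integral[OF Gi])
  also have "(\<lambda>t. \<integral>x. G t x \<partial>lborel) = node_integrand ?S ?R ?S ?R ?S ?R"
    using has_bochner_integral_integral_eq[OF Gx] by auto
  finally have "?c ^ 3 * (\<integral>x. indicator {0<..} x *\<^sub>R fox_density x \<partial>lborel) = (\<integral>t. node_integrand ?S ?R ?S ?R ?S ?R t \<partial>?P3)"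
    unfolding inner integral_mult_right_zero .
  then have "(\<integral>x. indicator {0<..} x *\<^sub>R fox_density x \<partial>lborel) = foxH 1 fox_A fox_B fox_V fox_x"
    unfolding fox using c3 by (metis nonzero_mult_div_cancel_left)
  then show ?thesis using 1 by (simp add: has_bochner_integral_iff)
qed

end

section \<open>Series for the density and the distribution function\<close>

text \<open>The coefficient of t^N in (1 - t)^(m - 1) (1 - \<theta> t)^(-m). It appears when the
  \<Phi>2 series is summed along diagonals.\<close>

definition kcoef :: "real \<Rightarrow> real \<Rightarrow> nat \<Rightarrow> real" where
  "kcoef m \<theta> N = (\<Sum>n\<le>N. pochhammer (1 - m) n / fact n * (pochhammer m (N - n) / fact (N - n) * \<theta> ^ (N - n)))"

text \<open>The right-hand side is the terminating 2F1(-N, m; 1; 1 - \<theta>). Expanding (1 -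
  \<theta>)^j and comparing powers of \<theta> reduces the identity to Vandermonde's
  convolution.\<close>

lemma kcoef_eq: "kcoef m \<theta> N = (\<Sum>j\<le>N. real (N choose j) * ((-1) ^ j * pochhammer m j / fact j * (1 - \<theta>) ^ j))"
proof -
  have g: "(-1) ^ j * pochhammer m j / fact j = (- m) gchoose j" for j
    by (simp add: gbinomial_pochhammer)
  \<comment> \<open>Trinomial revision takes the factor depending on k out of the sum; Vandermonde
    evaluates what is left.\<close>
  have inner: "(\<Sum>j\<in>{k..N}. real (N choose j) * ((- m) gchoose j) * real (j choose k))
      = ((- m) gchoose k) * ((real (N - k) - m) gchoose (N - k))" if k: "k \<le> N" for k
  proof -
    have "(\<Sum>j\<in>{k..N}. real (N choose j) * ((- m) gchoose j) * real (j choose k))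
        = (\<Sum>j\<in>{k..N}. ((- m) gchoose k) * (real (N choose (N - j)) * ((- m - real k) gchoose (j - k))))"
    proof (intro sum.cong refl)
      fix j assume j: "j \<in> {k..N}"
      have "((- m) gchoose j) * real (j choose k) = ((- m) gchoose k) * ((- m - real k) gchoose (j - k))"
        using gbinomial_trinomial_revision[of k j "- m"] j by (simp add: binomial_gbinomial)
      moreover have "N choose j = N choose (N - j)" using j by (intro binomial_symmetric) auto
      ultimately show "real (N choose j) * ((- m) gchoose j) * real (j choose k)
          = ((- m) gchoose k) * (real (N choose (N - j)) * ((- m - real k) gchoose (j - k)))"
        by (simp add: mult_ac)
    qed
    also have "\<dots> = ((- m) gchoose k) * (\<Sum>j\<in>{k..N}. real (N choose (N - j)) * ((- m - real k) gchoose (j - k)))"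
      by (simp add: sum_distrib_left)
    also have "(\<Sum>j\<in>{k..N}. real (N choose (N - j)) * ((- m - real k) gchoose (j - k)))
        = (\<Sum>i\<in>{0..N - k}. (real N gchoose i) * ((- m - real k) gchoose (N - k - i)))"
      by (rule sum.reindex_bij_witness[of _ "\<lambda>i. N - i" "\<lambda>j. N - j"])
         (use k in \<open>auto simp: binomial_gbinomial diff_diff_left\<close>)
    also have "\<dots> = (real N + (- m - real k)) gchoose (N - k)"
      by (rule gbinomial_Vandermonde)
    also have "real N + (- m - real k) = real (N - k) - m" using k by (simp add: of_nat_diff)
    finally show ?thesis .
  qed
  have "(\<Sum>j\<le>N. real (N choose j) * ((-1) ^ j * pochhammer m j / fact j * (1 - \<theta>) ^ j))
      = (\<Sum>j\<le>N. \<Sum>k\<le>j. real (N choose j) * ((- m) gchoose j) * real (j choose k) * (- \<theta>) ^ k)"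
  proof (intro sum.cong refl)
    fix j
    have "(1 - \<theta>) ^ j = (\<Sum>k\<le>j. real (j choose k) * (- \<theta>) ^ k)"
      using binomial_ring[of "- \<theta>" 1 j] by simp
    then show "real (N choose j) * ((-1) ^ j * pochhammer m j / fact j * (1 - \<theta>) ^ j)
        = (\<Sum>k\<le>j. real (N choose j) * ((- m) gchoose j) * real (j choose k) * (- \<theta>) ^ k)"
      unfolding g by (simp add: sum_distrib_left mult_ac)
  qed
  also have "\<dots> = (\<Sum>k\<le>N. \<Sum>j\<in>{k..N}. real (N choose j) * ((- m) gchoose j) * real (j choose k) * (- \<theta>) ^ k)"
    unfolding sum.Sigma[OF finite_atMost ballI[OF finite_atMost]] sum.Sigma[OF finite_atMost ballI[OF finite_atLeastAtMost]]
    by (rule sum.reindex_bij_witness[of _ "\<lambda>(k, j). (j, k)" "\<lambda>(j, k). (k, j)"]) auto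
  also have "\<dots> = (\<Sum>k\<le>N. (((- m) gchoose k) * ((real (N - k) - m) gchoose (N - k))) * (- \<theta>) ^ k)"
  proof (intro sum.cong refl)
    fix k assume "k \<in> {..N}"
    then have "k \<le> N" by simp
    from inner[OF this] show "(\<Sum>j\<in>{k..N}. real (N choose j) * ((- m) gchoose j) * real (j choose k) * (- \<theta>) ^ k)
        = ((- m) gchoose k) * ((real (N - k) - m) gchoose (N - k)) * (- \<theta>) ^ k"
      by (simp only: sum_distrib_right[symmetric])
  qed
  also have "\<dots> = (\<Sum>k\<le>N. pochhammer (1 - m) (N - k) / fact (N - k) * (pochhammer m k / fact k * \<theta> ^ k))"
  proof (intro sum.cong refl)
    fix k
    have a: "((- m) gchoose k) * (- \<theta>) ^ k = pochhammer m k / fact k * \<theta> ^ k"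
    proof -
      have "(-1) ^ k * (- \<theta>) ^ k = \<theta> ^ k" by (metis minus_minus mult.left_neutral mult_minus_left power_mult_distrib)
      then show ?thesis unfolding g[symmetric] by (simp add: field_simps)
    qed
    have b: "(real (N - k) - m) gchoose (N - k) = pochhammer (1 - m) (N - k) / fact (N - k)"
      by (simp add: gbinomial_pochhammer' algebra_simps)
    show "((- m) gchoose k) * ((real (N - k) - m) gchoose (N - k)) * (- \<theta>) ^ k
        = pochhammer (1 - m) (N - k) / fact (N - k) * (pochhammer m k / fact k * \<theta> ^ k)"
      unfolding a[symmetric] b[symmetric] by (simp only: mult_ac)
  qed
  also have "\<dots> = kcoef m \<theta> N"
    unfolding kcoef_def by (rule sum.reindex_bij_witness[of _ "\<lambda>n. N - n" "\<lambda>k. N - k"]) auto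
  finally show ?thesis ..
qed

lemma summable_hyp1F1: "summable (\<lambda>n. norm (pochhammer m n / pochhammer 1 n * z ^ n / fact n :: real))"
proof -
  define f where "f n = norm (pochhammer m n / pochhammer 1 n * z ^ n / fact n)" for n
  have step: "f (Suc n) = f n * (\<bar>m + real n\<bar> * \<bar>z\<bar> / (real (Suc n) * real (Suc n)))" for n
  proof -
    have f: "f n = \<bar>pochhammer m n\<bar> * \<bar>z\<bar> ^ n / (fact n * fact n)" for n
      by (simp add: f_def pochhammer_fact[symmetric] abs_mult power_abs)
    show ?thesis unfolding f pochhammer_Suc abs_mult by (simp add: field_simps del: of_nat_Suc)
  qed
  have "(\<lambda>n. \<bar>m + real n\<bar> * \<bar>z\<bar> / (real (Suc n) * real (Suc n))) \<longlonglongrightarrow> 0"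
    by real_asymp
  then have "\<forall>\<^sub>F n in sequentially. \<bar>m + real n\<bar> * \<bar>z\<bar> / (real (Suc n) * real (Suc n)) < 1/2"
    by (rule order_tendstoD) simp
  then obtain N where N: "\<And>n. n \<ge> N \<Longrightarrow> \<bar>m + real n\<bar> * \<bar>z\<bar> / (real (Suc n) * real (Suc n)) < 1/2"
    by (auto simp: eventually_sequentially)
  have "summable f"
  proof (rule summable_ratio_test)
    fix n assume "n \<ge> N"
    have "f n \<ge> 0" by (simp add: f_def)
    then have "f (Suc n) \<le> f n * (1/2)" unfolding step using N[OF \<open>n \<ge> N\<close>] by (intro mult_left_mono) auto
    then show "norm (f (Suc n)) \<le> 1/2 * norm (f n)" by (simp add: f_def)
  qed simp
  then show ?thesis unfolding f_def[abs_def] .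
qed

text \<open>The Cauchy product of the two power series has as coefficients the expansion in powers
  of 1 - \<theta> found for \<open>kcoef\<close>.\<close>

lemma exp_hyp1F1_sums:
  "(\<lambda>N. (- x) ^ N / fact N * kcoef m \<theta> N) sums (exp (- x) * hyp1F1 m 1 ((1 - \<theta>) * x))"
proof -
  define a where "a j = pochhammer m j / pochhammer 1 j * ((1 - \<theta>) * x) ^ j / fact j" for j
  define b where "b i = (- x) ^ i / fact i" for i
  define T where "T = 1 - \<theta>"
  have "summable (\<lambda>i. norm (b i))"
    using summable_norm_exp[of "- x"] by (simp add: b_def divide_inverse mult.commute)
  moreover have "summable (\<lambda>j. norm (a j))" unfolding a_def by (rule summable_hyp1F1)
  ultimately have "(\<lambda>N. \<Sum>j\<le>N. a j * b (N - j)) sums (suminf a * suminf b)"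
    by (intro Cauchy_product_sums)
  moreover have "suminf b = exp (- x)" by (simp add: exp_def b_def[abs_def] divide_inverse mult.commute)
  moreover have "suminf a = hyp1F1 m 1 ((1 - \<theta>) * x)" by (simp add: hyp1F1_def a_def[abs_def])
  moreover have "(\<Sum>j\<le>N. a j * b (N - j)) = (- x) ^ N / fact N * kcoef m \<theta> N" for N
    unfolding kcoef_eq sum_distrib_left
  proof (intro sum.cong refl)
    fix j assume "j \<in> {..N}"
    then have j: "j \<le> N" by simp
    have e: "(- x) ^ N = (-1) ^ j * x ^ j * (- x) ^ (N - j)"
      using j by (metis le_add_diff_inverse power_add power_minus)
    have "pochhammer (1::real) j = fact j" by (simp add: pochhammer_fact)
    then show "a j * b (N - j) = (- x) ^ N / fact N * (real (N choose j) * ((-1) ^ j * pochhammer m j / fact j * (1 - \<theta>) ^ j))"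
      unfolding a_def b_def e binomial_fact[OF j, where 'a = real] T_def[symmetric] power_mult_distrib
      by (simp add: field_simps)
  qed
  ultimately show ?thesis by (simp add: mult.commute)
qed

text \<open>At \<theta> = 0 only the term n = N of \<open>kcoef\<close> survives, and the previous
  series becomes the transformed 1F1.\<close>

lemma kummer_transformation: "exp (- x) * hyp1F1 m 1 x = hyp1F1 (1 - m) 1 (- x)"
proof -
  have "kcoef m 0 N = pochhammer (1 - m) N / fact N" for N
  proof -
    have "kcoef m 0 N = (\<Sum>n\<le>N. if n = N then pochhammer (1 - m) N / fact N else 0)"
      unfolding kcoef_def by (intro sum.cong) auto
    then show ?thesis by simp
  qed
  then have "(\<lambda>N. pochhammer (1 - m) N / pochhammer 1 N * (- x) ^ N / fact N) sums (exp (- x) * hyp1F1 m 1 x)"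
    using exp_hyp1F1_sums[of x m 0] by (simp add: pochhammer_fact[symmetric] mult_ac)
  then show ?thesis by (simp add: hyp1F1_def sums_iff)
qed

text \<open>\<Phi>2(1 - m, m; 2; -u, -\<theta> u), arranged by total degree N; the denominator is
  (2)_N = (N + 1)!.\<close>

definition phi_series :: "real \<Rightarrow> real \<Rightarrow> real \<Rightarrow> real" where
  "phi_series m \<theta> u = (\<Sum>N. (- u) ^ N / fact (Suc N) * kcoef m \<theta> N)"

lemma integral_exp_hyp1F1:
  assumes "g \<ge> 0"
  shows "((\<lambda>x. exp (- (a * x)) * hyp1F1 m 1 ((1 - \<theta>) * (a * x))) has_integral g * phi_series m \<theta> (a * g)) {0..g}"
proof -
  define d where "d N = (- a) ^ N / fact N * kcoef m \<theta> N" for N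
  \<comment> \<open>Coefficients of the termwise primitive, with constant term 0, so that
    \<open>diffs e\<close> is \<open>d\<close>.\<close>
  define e where "e n = (case n of 0 \<Rightarrow> 0 | Suc N \<Rightarrow> d N / real (Suc N))" for n
  have pw: "(- (a * x)) ^ N = (- a) ^ N * x ^ N" for x N
    by (metis mult_minus_left power_mult_distrib)
  have key: "e (Suc N) * x ^ Suc N = x * ((- (a * x)) ^ N / fact (Suc N) * kcoef m \<theta> N)" for x N
    unfolding pw by (simp add: e_def d_def fact_Suc field_simps del: of_nat_Suc)
  have ds: "(\<lambda>N. d N * x ^ N) sums (exp (- (a * x)) * hyp1F1 m 1 ((1 - \<theta>) * (a * x)))" for x
    using exp_hyp1F1_sums[of "a * x" m \<theta>] unfolding pw d_def by (simp add: mult_ac)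
  have dabs: "summable (\<lambda>N. norm (d N * x ^ N))" for x
    by (rule powser_insidea[OF sums_summable[OF ds[of "\<bar>x\<bar> + 1"]]]) simp
  have es: "summable (\<lambda>n. e n * x ^ n)" for x
  proof -
    have "summable (\<lambda>N. e (Suc N) * x ^ Suc N)"
    proof (rule summable_comparison_test'[OF summable_mult[OF dabs[of x], of "\<bar>x\<bar>"]])
      fix N
      have "norm (e (Suc N) * x ^ Suc N) = \<bar>x\<bar> * norm (d N * x ^ N) / real (Suc N)"
        by (simp add: e_def abs_mult field_simps)
      also have "\<dots> \<le> \<bar>x\<bar> * norm (d N * x ^ N) / 1" by (intro divide_left_mono) auto
      finally show "norm (e (Suc N) * x ^ Suc N) \<le> \<bar>x\<bar> * norm (d N * x ^ N)" by simp
    qed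
    then show ?thesis by (rule iffD1[OF summable_Suc_iff])
  qed
  define h where "h x = (\<Sum>n. e n * x ^ n)" for x
  have de: "diffs e = d" by (auto simp: diffs_def e_def fun_eq_iff)
  have dh: "(h has_real_derivative exp (- (a * x)) * hyp1F1 m 1 ((1 - \<theta>) * (a * x))) (at x)" for x
    using termdiffs_strong_converges_everywhere[of e x, OF es] ds[of x]
    by (simp add: h_def[abs_def] de sums_iff)
  have "((\<lambda>x. exp (- (a * x)) * hyp1F1 m 1 ((1 - \<theta>) * (a * x))) has_integral (h g - h 0)) {0..g}"
  proof (rule fundamental_theorem_of_calculus[OF assms])
    fix x
    show "(h has_vector_derivative exp (- (a * x)) * hyp1F1 m 1 ((1 - \<theta>) * (a * x))) (at x within {0..g})"
      unfolding has_real_derivative_iff_has_vector_derivative[symmetric]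
      by (rule has_field_derivative_at_within[OF dh])
  qed
  moreover have "h 0 = 0"
    by (simp add: h_def powser_zero e_def)
  moreover have "h g = g * phi_series m \<theta> (a * g)"
  proof -
    have "h g = (\<Sum>N. e (Suc N) * g ^ Suc N)"
      using suminf_split_head[OF es[of g]] by (simp add: h_def e_def)
    also have "\<dots> = (\<Sum>N. g * ((- (a * g)) ^ N / fact (Suc N) * kcoef m \<theta> N))"
      unfolding key ..
    also have "\<dots> = g * phi_series m \<theta> (a * g)"
    \<comment> \<open>Summability of \<open>phi_series\<close> is obtained by cancelling the factor
      \<open>g\<close>, so g = 0 is treated apart.\<close>
    proof (cases "g = 0")
      case False
      have "summable (\<lambda>N. e (Suc N) * g ^ Suc N)" using es[of g] by (rule iffD2[OF summable_Suc_iff])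
      then have "summable (\<lambda>N. (- (a * g)) ^ N / fact (Suc N) * kcoef m \<theta> N)"
        unfolding key summable_cmult_iff using False by blast
      then show ?thesis
        unfolding phi_series_def by (rule suminf_mult)
    qed simp
    finally show ?thesis .
  qed
  ultimately show ?thesis by simp
qed

text \<open>The product majorant makes the family absolutely summable over all pairs, so the sum by
  rows and the sum by diagonals agree through the bijection (N, n) -> (n, N - n).\<close>

lemma sums_diagonal:
  fixes F :: "nat \<Rightarrow> nat \<Rightarrow> complex"
  assumes "summable a" "summable b" "\<And>n. a n \<ge> 0" "\<And>n. b n \<ge> 0" "\<And>n k. norm (F n k) \<le> a n * b k"
  shows "(\<lambda>N. \<Sum>n\<le>N. F n (N - n)) sums (\<Sum>n. \<Sum>k. F n k)"
proof -
  have as: "a summable_on UNIV" "b summable_on UNIV"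
    using assms by (simp_all add: summable_on_UNIV_nonneg_real_iff)
  have "(\<lambda>p. norm (case p of (n, k) \<Rightarrow> a n * b k)) summable_on (UNIV \<times> UNIV)"
    using as assms(3,4)
    by (subst Infinite_Sum.abs_summable_on_Sigma_iff)
       (auto simp: abs_mult infsum_cmult_right' intro!: summable_on_cmult_right summable_on_cmult_left infsum_nonneg)
  then have Fabs: "(\<lambda>p. norm (case p of (n, k) \<Rightarrow> F n k)) summable_on (UNIV \<times> UNIV)"
    by (rule Infinite_Sum.abs_summable_on_comparison_test) (use assms in auto)
  then have Fs: "(\<lambda>(n, k). F n k) summable_on (UNIV \<times> UNIV)" by (rule Infinite_Sum.abs_summable_summable)
  have inf_sum: "infsum h UNIV = (\<Sum>n. h n)" if "h summable_on UNIV" for h :: "nat \<Rightarrow> complex"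
    using has_sum_imp_sums[OF has_sum_infsum[OF that]] by (rule sums_unique)
  have row: "F n summable_on UNIV" for n
    using Fabs unfolding Infinite_Sum.abs_summable_on_Sigma_iff
    by (auto intro: Infinite_Sum.abs_summable_summable)
  have 1: "infsum (\<lambda>(n, k). F n k) (UNIV \<times> UNIV) = (\<Sum>n. \<Sum>k. F n k)"
    using infsum_Sigma'_banach[OF Fs] summable_on_Sigma_banach[OF Fs] by (simp add: inf_sum row)
  have bij: "bij_betw (\<lambda>(N, n). (n, N - n)) (Sigma UNIV (\<lambda>N::nat. {..N})) (UNIV \<times> UNIV)"
    by (rule bij_betwI[where g = "\<lambda>(n, k). (n + k, n)"]) auto
  have Ds: "(\<lambda>(N, n). F n (N - n)) summable_on Sigma UNIV (\<lambda>N. {..N})"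
    using summable_on_reindex_bij_betw[OF bij, of "\<lambda>(n, k). F n k"] Fs by (simp add: case_prod_unfold)
  have 2: "infsum (\<lambda>(N, n). F n (N - n)) (Sigma UNIV (\<lambda>N. {..N})) = infsum (\<lambda>(n, k). F n k) (UNIV \<times> UNIV)"
    using infsum_reindex_bij_betw[OF bij, of "\<lambda>(n, k). F n k"] by (simp add: case_prod_unfold)
  have "(\<lambda>N. infsum (\<lambda>n. F n (N - n)) {..N}) summable_on UNIV"
    using summable_on_Sigma_banach[OF Ds] .
  from has_sum_imp_sums[OF has_sum_infsum[OF this]]
  have "(\<lambda>N. \<Sum>n\<le>N. F n (N - n)) sums infsum (\<lambda>N. infsum (\<lambda>n. F n (N - n)) {..N}) UNIV"
    by simp
  then show ?thesis
    using infsum_Sigma'_banach[OF Ds] 1 2 by simp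
qed

lemma gcoef_eq:
  assumes "\<alpha> \<notin> \<int>"
  shows "gcoef \<alpha> w n = of_real (Gamma \<alpha> * (pochhammer \<alpha> n / fact n * (- w) ^ n))"
proof -
  have "\<alpha> \<notin> \<int>\<^sub>\<le>\<^sub>0" using assms nonpos_Ints_Int by blast
  then have "Gamma (\<alpha> + real n) = Gamma \<alpha> * pochhammer \<alpha> n"
    by (simp add: pochhammer_Gamma Gamma_eq_zero_iff)
  moreover have "Gamma (of_real \<alpha> + of_nat n :: complex) = of_real (Gamma (\<alpha> + real n))"
    by (simp flip: Gamma_complex_of_real)
  ultimately have "Gamma (of_real \<alpha> + of_nat n :: complex) = of_real (Gamma \<alpha> * pochhammer \<alpha> n)" by simp
  moreover have "(- w) ^ n = (-1) ^ n * w ^ n" by (rule power_minus)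
  ultimately show ?thesis unfolding gcoef_def by (simp add: mult_ac)
qed

lemma rGamma_Suc: "rGamma (1 + of_nat n :: complex) = 1 / fact n"
  by (simp add: rGamma_inverse_Gamma Gamma_fact divide_inverse)

context fox_params
begin

lemma kummer_sum_eq: "kummer_sum = of_real (Gamma (1 - mB) * hyp1F1 (1 - mB) 1 (- y3))"
proof -
  have "gcoef (1 - mB) y3 n * rGamma (1 + of_nat n)
      = of_real (Gamma (1 - mB) * (pochhammer (1 - mB) n / pochhammer 1 n * (- y3) ^ n / fact n))" for n
    unfolding gcoef_eq[OF one_minus_nint(2)] rGamma_Suc by (simp add: pochhammer_fact[symmetric])
  moreover have "(\<lambda>n. complex_of_real (Gamma (1 - mB) * (pochhammer (1 - mB) n / pochhammer 1 n * (- y3) ^ n / fact n)))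
      sums of_real (Gamma (1 - mB) * hyp1F1 (1 - mB) 1 (- y3))"
    unfolding hyp1F1_def
    by (intro sums_of_real sums_mult summable_sums summable_norm_cancel[OF summable_hyp1F1])
  ultimately show ?thesis by (simp add: kummer_sum_def sums_iff)
qed

text \<open>When y2 = \<theta> y1 all terms with n + k = N share the power y1^N, and the diagonal
  sums become multiples of \<open>kcoef\<close>. The majorant rests on n! k! being at most (n + k +
  1)!.\<close>

lemma phi2_sum_eq:
  assumes "y2 = \<theta> * y1"
  shows "phi2_sum = of_real (Gamma (1 - mE) * Gamma mE * phi_series mE \<theta> y1)"
proof -
  define F where "F n k = gcoef (1 - mE) y1 n * (gcoef mE y2 k * rGamma (2 + of_nat n + of_nat k))" for n k
  have rG: "rGamma (2 + of_nat n + of_nat k :: complex) = 1 / fact (Suc (n + k))" for n k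
    using rGamma_Suc[of "Suc (n + k)"] by (simp add: add_ac)
  have sm: "summable (\<lambda>k. gcoef mE y2 k * rGamma (2 + of_nat n + of_nat k))" for n
  proof (rule summable_norm_cancel, rule summable_comparison_test'[OF summable_Gamma_coeff[OF m_nint(1), of y2]])
    fix k
    have "(fact k :: real) \<le> fact (Suc (n + k))" by (rule fact_mono) simp
    then have "norm (gcoef mE y2 k) / fact (Suc (n + k)) \<le> norm (gcoef mE y2 k) / fact k"
      by (intro divide_left_mono) auto
    then show "norm (norm (gcoef mE y2 k * rGamma (2 + of_nat n + of_nat k))) \<le> norm (gcoef mE y2 k) / fact k"
      unfolding rG by (simp add: norm_mult norm_divide del: fact_Suc)
  qed
  have "(\<lambda>N. \<Sum>n\<le>N. F n (N - n)) sums (\<Sum>n. \<Sum>k. F n k)"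
  proof (rule sums_diagonal[OF summable_Gamma_coeff[OF one_minus_nint(1), of y1] summable_Gamma_coeff[OF m_nint(1), of y2]])
    fix n k
    have "(fact n * fact k :: real) \<le> fact (Suc (n + k))"
    proof -
      have "fact n * fact k \<le> (fact (n + k) :: nat)" using fact_fact_dvd_fact[of n k] by (intro dvd_imp_le) auto
      also have "\<dots> \<le> fact (Suc (n + k))" by (rule fact_mono) simp
      finally have "real (fact n * fact k) \<le> real (fact (Suc (n + k)))" by (rule of_nat_mono)
      then show ?thesis by (simp only: of_nat_mult of_nat_fact)
    qed
    then have "norm (gcoef (1 - mE) y1 n) * norm (gcoef mE y2 k) / fact (Suc (n + k))
        \<le> norm (gcoef (1 - mE) y1 n) * norm (gcoef mE y2 k) / (fact n * fact k)"
      by (intro divide_left_mono) auto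
    then show "norm (F n k) \<le> norm (gcoef (1 - mE) y1 n) / fact n * (norm (gcoef mE y2 k) / fact k)"
      unfolding F_def rG by (simp add: norm_mult norm_divide del: fact_Suc)
  qed auto
  moreover have "(\<Sum>n. \<Sum>k. F n k) = phi2_sum"
    unfolding phi2_sum_def F_def by (subst suminf_mult[OF sm]) (rule refl)
  moreover have "(\<Sum>n\<le>N. F n (N - n)) = of_real (Gamma (1 - mE) * Gamma mE * ((- y1) ^ N / fact (Suc N) * kcoef mE \<theta> N))" for N
  proof -
    have "F n (N - n) = of_real (Gamma (1 - mE) * Gamma mE * ((- y1) ^ N / fact (Suc N)
        * (pochhammer (1 - mE) n / fact n * (pochhammer mE (N - n) / fact (N - n) * \<theta> ^ (N - n)))))" if "n \<le> N" for n
    proof -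
      have "(- y1) ^ N = (- y1) ^ n * (- y1) ^ (N - n)" using that by (simp flip: power_add)
      moreover have "(- y2) ^ (N - n) = \<theta> ^ (N - n) * (- y1) ^ (N - n)"
        unfolding assms by (simp flip: power_mult_distrib)
      ultimately show ?thesis
        unfolding F_def rG gcoef_eq[OF one_minus_nint(1)] gcoef_eq[OF m_nint(1)] using that by (simp add: mult_ac)
    qed
    then show ?thesis
      unfolding kcoef_def by (simp add: sum_distrib_left)
  qed
  ultimately have s: "(\<lambda>N. complex_of_real (Gamma (1 - mE) * Gamma mE * ((- y1) ^ N / fact (Suc N) * kcoef mE \<theta> N))) sums phi2_sum"
    by simp
  \<comment> \<open>Convergence of \<open>phi_series\<close> is read off from a non-zero multiple of
    it.\<close>
  have G0: "Gamma (1 - mE) * Gamma mE \<noteq> 0"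
    using one_minus_nint m_nint by (auto simp: Gamma_eq_zero_iff dest: nonpos_Ints_Int)
  have "(\<lambda>N. Gamma (1 - mE) * Gamma mE * ((- y1) ^ N / fact (Suc N) * kcoef mE \<theta> N)) sums Re phi2_sum"
    using sums_Re[OF s] by (simp only: Re_complex_of_real)
  from sums_summable[OF this] G0 have "summable (\<lambda>N. (- y1) ^ N / fact (Suc N) * kcoef mE \<theta> N)"
    unfolding summable_cmult_iff by blast
  then have "(\<lambda>N. Gamma (1 - mE) * Gamma mE * ((- y1) ^ N / fact (Suc N) * kcoef mE \<theta> N)) sums (Gamma (1 - mE) * Gamma mE * phi_series mE \<theta> y1)"
    unfolding phi_series_def by (intro sums_mult summable_sums)
  then have "(\<lambda>N. complex_of_real (Gamma (1 - mE) * Gamma mE * ((- y1) ^ N / fact (Suc N) * kcoef mE \<theta> N)))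
      sums of_real (Gamma (1 - mE) * Gamma mE * phi_series mE \<theta> y1)"
    by (rule sums_of_real)
  with s show ?thesis by (rule sums_unique2)
qed

end

section \<open>The shadowed Rician laws and the integral of their product\<close>

lemma f_RS_eq:
  fixes m K Kb gbar g :: real
  assumes "0 < m" "0 < K" "0 < gbar"
  defines "a \<equiv> (1 + Kb) / gbar" and "\<theta> \<equiv> m / (m + K)"
  shows "f_RS m K Kb gbar g = a * \<theta> powr m * (exp (- (a * g)) * hyp1F1 m 1 ((1 - \<theta>) * (a * g)))"
proof -
  have "K * (1 + Kb) * g / (gbar * (m + K)) = (1 - \<theta>) * (a * g)"
    using assms(1-3) by (simp add: a_def \<theta>_def field_simps)
  moreover have "(1 + Kb) * g / gbar = a * g" by (simp add: a_def)
  ultimately show ?thesis by (simp add: f_RS_def flip: a_def \<theta>_def)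
qed

text \<open>Since 1 - \<theta> = (K/m) \<theta>, Kummer's transformation turns the exponential rate
  into a \<theta> and the argument into -(K/m) a \<theta> g. Measured in units of 1/(a \<theta>),
  the only parameter left in the argument is K/m, which is y3.\<close>

lemma f_RS_kummer:
  fixes m K Kb gbar g :: real
  assumes "0 < m" "0 < K" "0 < gbar"
  defines "a \<equiv> (1 + Kb) / gbar" and "\<theta> \<equiv> m / (m + K)"
  shows "f_RS m K Kb gbar g = a * \<theta> powr m * (exp (- (a * \<theta> * g)) * hyp1F1 (1 - m) 1 (- (K / m * (a * \<theta> * g))))"
proof -
  have "(1 - \<theta>) = K / m * \<theta>" using assms(1,2) by (simp add: \<theta>_def field_simps)
  then have x: "(1 - \<theta>) * (a * g) = K / m * (a * \<theta> * g)" by (simp add: mult_ac)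
  have "exp (- (a * g)) = exp (- (a * \<theta> * g)) * exp (- ((1 - \<theta>) * (a * g)))"
    by (simp add: exp_add[symmetric] algebra_simps)
  then show ?thesis
    using f_RS_eq[OF assms(1-3), of Kb g] kummer_transformation[of "(1 - \<theta>) * (a * g)" m]
    unfolding a_def[symmetric] \<theta>_def[symmetric] by (simp add: x)
qed

lemma F_RS_eq:
  fixes m K Kb gbar g :: real
  assumes "0 < m" "0 < K" "0 < gbar" "0 \<le> g"
  defines "a \<equiv> (1 + Kb) / gbar" and "\<theta> \<equiv> m / (m + K)"
  shows "F_RS m K Kb gbar g = a * \<theta> powr m * (g * phi_series m \<theta> (a * g))"
proof -
  have f: "f_RS m K Kb gbar = (\<lambda>x. a * \<theta> powr m * (exp (- (a * x)) * hyp1F1 m 1 ((1 - \<theta>) * (a * x))))"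
    unfolding a_def \<theta>_def by (rule ext, rule f_RS_eq[OF assms(1-3)])
  have "(f_RS m K Kb gbar has_integral a * \<theta> powr m * (g * phi_series m \<theta> (a * g))) {0..g}"
    unfolding f by (intro has_integral_mult_right integral_exp_hyp1F1 assms)
  then show ?thesis unfolding F_RS_def by (rule integral_unique)
qed

lemma RS_product_integral:
  assumes m: "0 < mB" "0 < mE" "mB \<notin> \<int>" "mE \<notin> \<int>" and K: "0 < KB" "0 < KE" "0 < KbB" "0 < KbE" and g: "0 < gB" "0 < gE"
  shows "has_bochner_integral lborel (\<lambda>g. indicator {0..} g *\<^sub>R complex_of_real (F_RS mE KE KbE gE g * f_RS mB KB KbB gB g))
     (D_term 1 1 mB mE KB KE KbB KbE gB gE)"
proof -
  define a b \<theta>E \<theta>B where "a = (1 + KbE) / gE" and "b = (1 + KbB) / gB" and "\<theta>E = mE / (mE + KE)" and "\<theta>B = mB / (mB + KB)"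
  \<comment> \<open>The exponential rate of the transformed density; g = x / lam turns it into
    exp(-x) and the argument a g of the distribution function into y1 x.\<close>
  define lam where "lam = b * \<theta>B"
  define y1 where "y1 = gB * (mB + KB) * (1 + KbE) / (gE * mB * (1 + KbB))"
  define y2 where "y2 = gB * mE * (mB + KB) * (1 + KbE) / (gE * mB * (mE + KE) * (1 + KbB))"
  define y3 where "y3 = KB / mB"
  have pos: "a > 0" "b > 0" "\<theta>E > 0" "\<theta>B > 0" "lam > 0" "y1 > 0" "y2 > 0" "y3 > 0"
    using m K g by (auto simp: a_def b_def \<theta>E_def \<theta>B_def lam_def y1_def y2_def y3_def intro!: divide_pos_pos mult_pos_pos add_pos_pos)
  have y1: "a / lam = y1" using m K g by (simp add: a_def b_def lam_def \<theta>B_def y1_def field_simps)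
  have y2: "y2 = \<theta>E * y1" using m K g by (simp add: y2_def y1_def \<theta>E_def field_simps)
  interpret fox_params mE mB y1 y2 y3 using m pos by unfold_locales auto
  define \<Gamma>3 where "\<Gamma>3 = Gamma (1 - mB) * Gamma (1 - mE) * Gamma mE"
  have G0: "\<Gamma>3 \<noteq> 0" using m one_minus_nint unfolding \<Gamma>3_def by (auto simp: Gamma_eq_zero_iff dest: nonpos_Ints_Int)
  \<comment> \<open>The factor 1/lam comes from the linear factor g of the distribution function; a
    second one comes from dg. Together they turn the exponent mB of \<theta>B into mB - 2.\<close>
  define \<kappa> where "\<kappa> = a * \<theta>E powr mE * (b * \<theta>B powr mB) / lam / \<Gamma>3"
  define H where "H g = indicator {0..} g *\<^sub>R complex_of_real (F_RS mE KE KbE gE g * f_RS mB KB KbB gB g)" for g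
  have eq: "H (0 + 1 / lam * x) = of_real \<kappa> * (indicator {0<..} x *\<^sub>R fox_density x)" for x
  proof (cases "x > 0")
    case True
    interpret X: fox_params mE mB "y1 * x" "y2 * x" "y3 * x"
      using m pos True by unfold_locales auto
    have F: "F_RS mE KE KbE gE (x / lam) = a * \<theta>E powr mE * (x / lam * phi_series mE \<theta>E (y1 * x))"
      using F_RS_eq[OF m(2) K(2) g(2), of "x / lam" KbE] True pos
      by (simp add: y1[symmetric] flip: a_def \<theta>E_def)
    have f: "f_RS mB KB KbB gB (x / lam) = b * \<theta>B powr mB * (exp (- x) * hyp1F1 (1 - mB) 1 (- (y3 * x)))"
      using f_RS_kummer[OF m(1) K(1) g(1), of KbB "x / lam", folded b_def \<theta>B_def, folded lam_def y3_def] pos by simp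
    have p: "X.phi2_sum = of_real (Gamma (1 - mE) * Gamma mE * phi_series mE \<theta>E (y1 * x))"
      by (rule X.phi2_sum_eq) (simp add: y2)
    have "H (0 + 1 / lam * x) = complex_of_real (F_RS mE KE KbE gE (x / lam) * f_RS mB KB KbB gB (x / lam))"
      using True pos by (simp add: H_def)
    also have "\<dots> = of_real (\<kappa> * (x * exp (- x) * ((Gamma (1 - mE) * Gamma mE * phi_series mE \<theta>E (y1 * x)) * (Gamma (1 - mB) * hyp1F1 (1 - mB) 1 (- (y3 * x))))))"
      unfolding F f \<kappa>_def using G0 by (simp add: \<Gamma>3_def)
    also have "\<dots> = of_real \<kappa> * fox_density x"
      unfolding fox_density_def p X.kummer_sum_eq by simp
    finally show ?thesis using True by simp
  next
    case False
    show ?thesis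
    \<comment> \<open>The two indicators differ at 0, where the distribution function
      vanishes.\<close>
    proof (cases "x = 0")
      case True
      then show ?thesis by (simp add: H_def F_RS_def)
    next
      case x: False
      then have "1 / lam * x < 0" using False pos by (simp add: divide_neg_pos)
      then show ?thesis using False by (simp add: H_def)
    qed
  qed
  have "has_bochner_integral lborel (\<lambda>x. H (0 + 1 / lam * x)) (of_real \<kappa> * foxH 1 fox_A fox_B fox_V fox_x)"
    unfolding eq by (intro has_bochner_integral_mult_right foxH_integral)
  moreover have "of_real \<kappa> * foxH 1 fox_A fox_B fox_V fox_x = D_term 1 1 mB mE KB KE KbB KbE gB gE /\<^sub>R \<bar>1 / lam\<bar>"
  proof -
    have D: "D_term 1 1 mB mE KB KE KbB KbE gB gE = of_real (1 / \<Gamma>3 * (gB * (1 + KbE) / (gE * (1 + KbB))) * \<theta>E powr mE * \<theta>B powr (mB - 2))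
        * foxH 1 fox_A fox_B fox_V fox_x"
      unfolding D_term_def Let_def y1_def[symmetric] y2_def[symmetric] y3_def[symmetric] \<theta>E_def[symmetric] \<theta>B_def[symmetric] \<Gamma>3_def[symmetric]
      by simp
    have k: "1 / \<Gamma>3 * (gB * (1 + KbE) / (gE * (1 + KbB))) * \<theta>E powr mE * \<theta>B powr (mB - 2) = \<kappa> / lam"
    proof -
      have e1: "gB * (1 + KbE) / (gE * (1 + KbB)) = a / b" using K g by (simp add: a_def b_def field_simps)
      have e2: "\<theta>B powr (mB - 2) = \<theta>B powr mB / (\<theta>B * \<theta>B)"
        using pos by (simp add: powr_diff powr_numeral power2_eq_square)
      show ?thesis
        unfolding e1 e2 \<kappa>_def lam_def using pos G0 by (simp add: field_simps)
    qed
    show ?thesis unfolding D k using pos by (simp add: scaleR_conv_of_real)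
  qed
  ultimately have "has_bochner_integral lborel H (D_term 1 1 mB mE KB KE KbB KbE gB gE)"
    using pos by (subst lborel_has_bochner_integral_real_affine_iff[where c = "1 / lam" and t = 0]) auto
  then show ?thesis unfolding H_def .
qed

text \<open>The mixture weights enter bilinearly, so the four products of component laws can be
  integrated without weights and combined afterwards.\<close>

lemma D_term_scale:
  "D_term QB QE mB mE KB KE KbB KbE gB gE = of_real (QB * QE) * D_term 1 1 mB mE KB KE KbB KbE gB gE"
  unfolding D_term_def Let_def by simp

theorem theorem3:
  fixes pB pE mB mE KB1 KB2 KE1 KE2 gB gE :: real
  assumes "0 \<le> pB" "pB \<le> 1" "0 \<le> pE" "pE \<le> 1"
    and "0 < mB" "0 < mE" "mB \<notin> \<int>" "mE \<notin> \<int>"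
    and "0 < KB1" "0 < KB2" "0 < KE1" "0 < KE2"
    and "0 < gB" "0 < gE"
  shows "complex_of_real
           (\<integral>g\<in>{0..}. F_ARS pE mE KE1 KE2 gE g * f_ARS pB mB KB1 KB2 gB g \<partial>lborel)
       = D_term pB pE mB mE KB1 KE1 (Kbar pB KB1 KB2) (Kbar pE KE1 KE2) gB gE
       + D_term pB (1 - pE) mB mE KB1 KE2 (Kbar pB KB1 KB2) (Kbar pE KE1 KE2) gB gE
       + D_term (1 - pB) pE mB mE KB2 KE1 (Kbar pB KB1 KB2) (Kbar pE KE1 KE2) gB gE
       + D_term (1 - pB) (1 - pE) mB mE KB2 KE2 (Kbar pB KB1 KB2) (Kbar pE KE1 KE2) gB gE"
proof -
  let ?KB = "Kbar pB KB1 KB2" and ?KE = "Kbar pE KE1 KE2"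
  have Kpos: "Kbar p K1 K2 > 0" if "0 \<le> p" "p \<le> 1" "0 < K1" "0 < K2" for p K1 K2
    using that unfolding Kbar_def
    by (cases "p = 0") (auto intro!: add_pos_nonneg)
  define P where "P KB KE g = indicator {0..} g *\<^sub>R complex_of_real (F_RS mE KE ?KE gE g * f_RS mB KB ?KB gB g)" for KB KE g
  have P: "has_bochner_integral lborel (P KB KE) (D_term 1 1 mB mE KB KE ?KB ?KE gB gE)" if "0 < KB" "0 < KE" for KB KE
    unfolding P_def using assms that Kpos by (intro RS_product_integral) auto
  have "has_bochner_integral lborel
      (\<lambda>g. of_real (pB * pE) * P KB1 KE1 g + of_real (pB * (1 - pE)) * P KB1 KE2 g
         + of_real ((1 - pB) * pE) * P KB2 KE1 g + of_real ((1 - pB) * (1 - pE)) * P KB2 KE2 g)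
      (of_real (pB * pE) * D_term 1 1 mB mE KB1 KE1 ?KB ?KE gB gE + of_real (pB * (1 - pE)) * D_term 1 1 mB mE KB1 KE2 ?KB ?KE gB gE
       + of_real ((1 - pB) * pE) * D_term 1 1 mB mE KB2 KE1 ?KB ?KE gB gE
       + of_real ((1 - pB) * (1 - pE)) * D_term 1 1 mB mE KB2 KE2 ?KB ?KE gB gE)" (is "has_bochner_integral _ ?S ?I")
    using assms by (intro has_bochner_integral_add has_bochner_integral_mult_right P) auto
  moreover have "?S = (\<lambda>g. complex_of_real (indicator {0..} g *\<^sub>R (F_ARS pE mE KE1 KE2 gE g * f_ARS pB mB KB1 KB2 gB g)))"
    by (auto simp: fun_eq_iff P_def F_ARS_def f_ARS_def algebra_simps indicator_def)
  ultimately have "has_bochner_integral lborel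
      (\<lambda>g. complex_of_real (indicator {0..} g *\<^sub>R (F_ARS pE mE KE1 KE2 gE g * f_ARS pB mB KB1 KB2 gB g))) ?I"
    by simp
  then have "(\<integral>g. complex_of_real (indicator {0..} g *\<^sub>R (F_ARS pE mE KE1 KE2 gE g * f_ARS pB mB KB1 KB2 gB g)) \<partial>lborel) = ?I"
    by (rule has_bochner_integral_integral_eq)
  then show ?thesis
    unfolding set_lebesgue_integral_def integral_complex_of_real
      D_term_scale[of pB pE] D_term_scale[of pB "1 - pE"] D_term_scale[of "1 - pB" pE] D_term_scale[of "1 - pB" "1 - pE"] .
qed

end
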